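(* Let $m\ge r\ge 2$ be integers. Let $F$ be an $r$-graph that either has at most $m$ vertices, or has exactly $m+1$ vertices one of which has degree $1$. Suppose that either $\pi_\lambda(F)<\frac{[m]_r}{m^r}$, or $\pi_\lambda(F)=\frac{[m]_r}{m^r}$ and $\mathcal{K}^F_{m+1}$ is $m$-stable. Then there exists a positive integer $n_3$ such that for all $n\ge n_3$ we have $\mathrm{ex}(n,H^F_{m+1})=|T_r(n,m)|$.
   Context: An $r$-graph is a finite $r$-uniform hypergraph; $|G|$ denotes the number of edges and $n(G)$ the number of vertices of $G$. $F\subseteq G$ means $G$ contains a (not necessarily induced) copy of $F$ as a subgraph; $G$ is $F$-free if $F\not\subseteq G$, and is free of a family if it contains no member of the family. The Turán number $\mathrm{ex}(n,F)$ is the maximum number of edges in an $F$-free $r$-graph on $n$ vertices. The degree of a vertex is the number of edges containing it. $[m]_r=m(m-1)\cdots(m-r+1)$ is the falling factorial. $T_r(n,m)$ is the complete $m$-partite $r$-graph on $n$ vertices in which no two parts differ in size by more than one (its edges are all $r$-sets meeting each part in at most one vertex). A pair of vertices is covered in a hypergraph if some edge contains both vertices. For an $r$-graph $F$ and an integer $p\ge n(F)$, $\mathcal{K}^F_p$ is the family of all $r$-graphs $H$ that contain a set $C$ of $p$ vertices (called the core) such that the subgraph $H[C]$ induced by $C$ contains a copy of $F$ and every pair of vertices in $C$ is covered in $H$. $H^F_p$ is the following member of $\mathcal{K}^F_p$: label the vertices of $F$ as $v_1,\dots,v_{n(F)}$, add new vertices $v_{n(F)+1},\dots,v_p$, and for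 each pair $v_i,v_j$ ($1\le i<j\le p$) not covered in $F$ add a set $B_{i,j}$ of $r-2$ new vertices and the edge $\{v_i,v_j\}\cup B_{i,j}$, where the sets $B_{i,j}$ are pairwise disjoint. For an $r$-graph $G$ on $[t]=\{1,\dots,t\}$, let $p_G(x_1,\dots,x_t)=r!\sum_{e\in E(G)}\prod_{i\in e}x_i$. The Lagrangian of $G$ is $\lambda(G)=\max\{p_G(x): x_i\ge 0\ \forall i,\ \sum_i x_i=1\}$. The Lagrangian density of an $r$-graph $F$ is $\pi_\lambda(F)=\sup\{\lambda(G): G \text{ an } r\text{-graph with } F\not\subseteq G\}$. An $r$-graph is $m$-partite if its vertex set can be partitioned into $m$ parts (possibly empty) such that every edge contains at most one vertex of each part. For an $r$-graph $F$ on at most $m+1$ vertices with $\pi_\lambda(F)\le\frac{[m]_r}{m^r}$, the family $\mathcal{K}^F_{m+1}$ is called $m$-stable if for every real $\varepsilon>0$ there are a real $\delta_1>0$ and an integer $n_1$ such that every $\mathcal{K}^F_{m+1}$-free $r$-graph $G$ with $n\ge n_1$ vertices and more than $\left(\frac{[m]_r}{m^r}-\delta_1\right)\binom{n}{r}$ edges can be made $m$-partite by deleting at most $\varepsilon n$ vertices. *)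

theory Defs
  imports Complex_Main
begin

datatype 'a hypergraph = Hypergraph (verts: "'a set") (edges: "'a set set")

definition r_graph :: "nat \<Rightarrow> 'a hypergraph \<Rightarrow> bool" where
  "r_graph r G \<longleftrightarrow> finite (verts G) \<and> (\<forall>e\<in>edges G. e \<subseteq> verts G \<and> card e = r)"

definition degree :: "'a hypergraph \<Rightarrow> 'a \<Rightarrow> nat" where
  "degree G v = card {e \<in> edges G. v \<in> e}"

definition contains_copy :: "'a hypergraph \<Rightarrow> 'b hypergraph \<Rightarrow> bool" where
  "contains_copy G F \<longleftrightarrow>
    (\<exists>f. inj_on f (verts F) \<and> f ` verts F \<subseteq> verts G \<and> (\<forall>e\<in>edges F. f ` e \<in> edges G))"

definition family_free :: "'b hypergraph set \<Rightarrow> 'a hypergraph \<Rightarrow> bool" where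
  "family_free \<F> G \<longleftrightarrow> (\<forall>H\<in>\<F>. \<not> contains_copy G H)"

definition induced :: "'a hypergraph \<Rightarrow> 'a set \<Rightarrow> 'a hypergraph" where
  "induced G C = Hypergraph C {e \<in> edges G. e \<subseteq> C}"

definition covered :: "'a hypergraph \<Rightarrow> 'a \<Rightarrow> 'a \<Rightarrow> bool" where
  "covered G u v \<longleftrightarrow> (\<exists>e\<in>edges G. u \<in> e \<and> v \<in> e)"

text \<open>Host graphs (here and below) have vertices in \<^typ>\<open>nat\<close>; every finite
  hypergraph has an isomorphic copy of this kind.\<close>

definition turan_number :: "nat \<Rightarrow> nat \<Rightarrow> 'a hypergraph \<Rightarrow> nat" where
  "turan_number r n F =
    Max {card (edges G) | G :: nat hypergraph.
           r_graph r G \<and> card (verts G) = n \<and> \<not> contains_copy G F}"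

text \<open>The complete balanced \<open>m\<close>-partite \<open>r\<close>-graph, unique up to isomorphism. Its parts
  are the residue classes modulo \<open>m\<close>; see \<open>turan_part_balanced\<close>.\<close>

definition turan_part :: "nat \<Rightarrow> nat \<Rightarrow> nat \<Rightarrow> nat set" where
  "turan_part n m i = {v. v < n \<and> v mod m = i}"

definition turan_graph :: "nat \<Rightarrow> nat \<Rightarrow> nat \<Rightarrow> nat hypergraph" where
  "turan_graph r n m = Hypergraph {..<n}
    {e. e \<subseteq> {..<n} \<and> card e = r \<and> (\<forall>i<m. card (e \<inter> turan_part n m i) \<le> 1)}"

lemma turan_part_card:
  assumes "i < m"
  shows "card (turan_part n m i) = n div m + (if i < n mod m then 1 else 0)"
proof (induction n)
  case 0
  then show ?case by (simp add: turan_part_def)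
next
  case (Suc n)
  have "turan_part (Suc n) m i =
      (if n mod m = i then insert n (turan_part n m i) else turan_part n m i)"
    by (auto simp: turan_part_def less_Suc_eq)
  moreover have "n \<notin> turan_part n m i" "finite (turan_part n m i)"
    by (auto simp: turan_part_def)
  ultimately have "card (turan_part (Suc n) m i) =
      card (turan_part n m i) + (if n mod m = i then 1 else 0)"
    by simp
  with Suc assms show ?case
    by (auto simp: div_Suc mod_Suc)
qed

lemma turan_part_balanced:
  "\<lbrakk>i < m; j < m\<rbrakk> \<Longrightarrow> card (turan_part n m i) \<le> card (turan_part n m j) + 1"
  by (simp add: turan_part_card)

definition core_family :: "nat \<Rightarrow> 'a hypergraph \<Rightarrow> nat \<Rightarrow> nat hypergraph set" where
  "core_family r F p = {H. r_graph r H \<and>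
     (\<exists>C\<subseteq>verts H. card C = p \<and> contains_copy (induced H C) F \<and>
        (\<forall>u\<in>C. \<forall>v\<in>C. u \<noteq> v \<longrightarrow> covered H u v))}"

text \<open>Vertices of the extension of \<open>F\<close>: those of \<open>F\<close>, the further core vertices
  \<open>New i\<close> with \<open>card (verts F) < i \<le> p\<close>, and, for each uncovered pair \<open>{u, v}\<close> of core
  vertices, the \<open>r - 2\<close> vertices \<open>Pad {u, v} k\<close> making up the set \<open>B\<close> of that pair.\<close>

datatype 'a core_vertex = Old 'a | New nat
datatype 'a ext_vertex = Core "'a core_vertex" | Pad "'a core_vertex set" nat

definition core_vertices :: "'a hypergraph \<Rightarrow> nat \<Rightarrow> 'a core_vertex set" where
  "core_vertices F p = Old ` verts F \<union> New ` {card (verts F)<..p}"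

definition uncovered_pairs :: "'a hypergraph \<Rightarrow> nat \<Rightarrow> 'a core_vertex set set" where
  "uncovered_pairs F p = {{u, v} | u v.
     u \<in> core_vertices F p \<and> v \<in> core_vertices F p \<and> u \<noteq> v \<and>
     \<not> (\<exists>e\<in>edges F. u \<in> Old ` e \<and> v \<in> Old ` e)}"

definition extension :: "nat \<Rightarrow> 'a hypergraph \<Rightarrow> nat \<Rightarrow> 'a ext_vertex hypergraph" where
  "extension r F p = Hypergraph
     (Core ` core_vertices F p \<union> (\<Union>P\<in>uncovered_pairs F p. Pad P ` {..<r - 2}))
     ((\<lambda>e. (Core \<circ> Old) ` e) ` edges F \<union>
      (\<lambda>P. Core ` P \<union> Pad P ` {..<r - 2}) ` uncovered_pairs F p)"

definition lagrange_poly :: "nat \<Rightarrow> 'a hypergraph \<Rightarrow> ('a \<Rightarrow> real) \<Rightarrow> real" where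
  "lagrange_poly r G x = fact r * (\<Sum>e\<in>edges G. \<Prod>i\<in>e. x i)"

text \<open>The supremum is a maximum when \<open>G\<close> has a vertex (the simplex is then compact and
  nonempty).\<close>

definition lagrangian :: "nat \<Rightarrow> 'a hypergraph \<Rightarrow> real" where
  "lagrangian r G =
    Sup {lagrange_poly r G x | x. (\<forall>i\<in>verts G. x i \<ge> 0) \<and> (\<Sum>i\<in>verts G. x i) = 1}"

text \<open>Lagrangians lie in \<open>[0, 1]\<close>, so inserting \<open>0\<close> only fixes the supremum of the empty set
  to be \<open>0\<close>; this concerns only \<open>F\<close> with at most one vertex and no edges.\<close>

definition lagrangian_density :: "nat \<Rightarrow> 'a hypergraph \<Rightarrow> real" where
  "lagrangian_density r F =
    Sup (insert 0 {lagrangian r G | G :: nat hypergraph.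
           r_graph r G \<and> verts G \<noteq> {} \<and> \<not> contains_copy G F})"

definition falling_factorial :: "nat \<Rightarrow> nat \<Rightarrow> real" where
  "falling_factorial m r = (\<Prod>i<r. real m - real i)"

definition multipartite :: "nat \<Rightarrow> 'a hypergraph \<Rightarrow> bool" where
  "multipartite m G \<longleftrightarrow>
    (\<exists>P :: nat \<Rightarrow> 'a set. (\<Union>i<m. P i) = verts G \<and>
       (\<forall>i<m. \<forall>j<m. i \<noteq> j \<longrightarrow> P i \<inter> P j = {}) \<and>
       (\<forall>e\<in>edges G. \<forall>i<m. card (e \<inter> P i) \<le> 1))"

definition stable_family :: "nat \<Rightarrow> nat \<Rightarrow> nat hypergraph set \<Rightarrow> bool" where
  "stable_family r m \<F> \<longleftrightarrow>
    (\<forall>\<epsilon>::real. \<epsilon> > 0 \<longrightarrow> (\<exists>\<delta>\<^sub>1::real. \<delta>\<^sub>1 > 0 \<and> (\<exists>n\<^sub>1::nat. \<forall>G :: nat hypergraph.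
       r_graph r G \<and> family_free \<F> G \<and> card (verts G) \<ge> n\<^sub>1 \<and>
       real (card (edges G)) >
         (falling_factorial m r / real m ^ r - \<delta>\<^sub>1) * real (card (verts G) choose r)
       \<longrightarrow> (\<exists>D\<subseteq>verts G. real (card D) \<le> \<epsilon> * real (card (verts G)) \<and>
              multipartite m (induced G (verts G - D))))))"

end

theory Submission
  imports Defs "HOL-Library.FuncSet"
begin

text \<open>The lower bound holds because a core of \<open>m + 1\<close> pairwise covered vertices does not fit into an
  \<open>m\<close>-partite graph. For the upper bound it suffices that extension-free graphs of minimum degree
  close to that of the Turan graph are \<open>m\<close>-partite, since low-degree vertices can be deleted one at a
  time, each deletion increasing the surplus over the Turan number.

  Deleting the few edges through pairs of small codegree makes an extension-free graph free of the whole
  core family. It is then nearly \<open>m\<close>-partite: by assumption if the density is attained, and otherwise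
  by symmetrizing one vertex at a time, where every symmetric graph either is \<open>m\<close>-partite or has few
  edges by the Lagrangian density of \<open>F\<close>, and where the partition is pulled back along each single
  change. Both the pulling back and the passage from nearly \<open>m\<close>-partite to \<open>m\<close>-partite rest on
  counting maps of the extension: an edge inside a part, or a vertex of large degree that sees all
  parts, together with an almost complete \<open>m\<close>-partite graph, yields a copy. This uses that some core
  vertex lies in at most one edge of \<open>F\<close>.\<close>

section \<open>Elementary symmetric polynomials\<close>

text \<open>Edge counts are normalized by n^r rather than by a binomial coefficient, so that
  Maclaurin's inequality bounds \<open>m\<close>-partite graphs by \<open>A\<close> times n^r
  without an error term. The number of symmetrization steps is not controlled, so an error growing
  with each step would be fatal. The statement carried back therefore says that all edges between
  vertices of large degree are rainbow. Undoing a step costs only the edges at the changed vertex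
  and at the few vertices of low degree, and the embedding lemmas then restore the same statement in
  full. Strict inequality is essential there: only then does the Lagrangian bound exclude dense
  symmetric graphs that are not \<open>m\<close>-partite. With equality it excludes nothing, and
  stability takes over. The vertex \<open>b\<close> lying in at most one edge of \<open>F\<close> is
  the place for a vertex that sees all parts. The edges of the extension through \<open>b\<close>
  are pairwise disjoint outside \<open>b\<close>, so they can be chosen independently from the link
  of that vertex; no correlation between its link sets has to be known.\<close>

definition esym :: "nat \<Rightarrow> 'i set \<Rightarrow> ('i \<Rightarrow> real) \<Rightarrow> real" where
  "esym r I x = (\<Sum>S | S \<subseteq> I \<and> card S = r. \<Prod>i\<in>S. x i)"

lemma esym_0 [simp]: "finite I \<Longrightarrow> esym 0 I x = 1"
proof -
  assume "finite I"
  then have "{S. S \<subseteq> I \<and> card S = 0} = {{}}"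
    by (auto dest: finite_subset)
  then show ?thesis by (simp add: esym_def)
qed

lemma esym_insert:
  assumes "finite I" "i \<notin> I"
  shows "esym (Suc r) (insert i I) x = esym (Suc r) I x + x i * esym r I x"
proof -
  let ?A = "{S. S \<subseteq> I \<and> card S = Suc r}"
  let ?B = "{S. S \<subseteq> I \<and> card S = r}"
  have fin: "finite ?A" "finite ?B"
    using assms by simp_all
  have split: "{S. S \<subseteq> insert i I \<and> card S = Suc r} = ?A \<union> insert i ` ?B" (is "?L = ?R")
  proof
    show "?L \<subseteq> ?R"
    proof
      fix S assume S: "S \<in> ?L"
      show "S \<in> ?R"
      proof (cases "i \<in> S")
        case True
        then have "S = insert i (S - {i})" "S - {i} \<subseteq> I" "card (S - {i}) = r"
          using S by auto
        then show ?thesis by blast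
      next
        case False
        then show ?thesis using S by blast
      qed
    qed
    show "?R \<subseteq> ?L"
    proof -
      have "card (insert i S) = Suc r" if "S \<subseteq> I" "card S = r" for S
        using that assms finite_subset[OF that(1)] by (subst card_insert_disjoint) auto
      then show ?thesis by auto
    qed
  qed
  have disj: "?A \<inter> insert i ` ?B = {}"
    using assms by auto
  have inj: "inj_on (insert i) ?B"
    using assms(2) by (intro inj_onI) (auto dest!: insert_ident[THEN iffD1, rotated 2])
  have "(\<Sum>S\<in>insert i ` ?B. \<Prod>j\<in>S. x j) = (\<Sum>S\<in>?B. \<Prod>j\<in>insert i S. x j)"
    by (simp add: sum.reindex[OF inj])
  also have "\<dots> = (\<Sum>S\<in>?B. x i * (\<Prod>j\<in>S. x j))"
  proof (rule sum.cong[OF refl])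
    fix S assume "S \<in> ?B"
    then have "finite S" "i \<notin> S" using assms finite_subset by auto
    then show "(\<Prod>j\<in>insert i S. x j) = x i * (\<Prod>j\<in>S. x j)" by simp
  qed
  finally have "(\<Sum>S\<in>insert i ` ?B. \<Prod>j\<in>S. x j) = x i * esym r I x"
    by (simp add: esym_def sum_distrib_left)
  then show ?thesis
    using fin disj by (simp add: esym_def split sum.union_disjoint)
qed

lemma esym_cong: "(\<And>i. i \<in> I \<Longrightarrow> x i = y i) \<Longrightarrow> esym r I x = esym r I y"
  unfolding esym_def by (intro sum.cong prod.cong) auto

lemma esym_nonneg: "(\<And>i. i \<in> I \<Longrightarrow> x i \<ge> 0) \<Longrightarrow> esym r I x \<ge> 0"
  unfolding esym_def by (intro sum_nonneg prod_nonneg) auto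

lemma esym_mono:
  "(\<And>i. i \<in> I \<Longrightarrow> 0 \<le> x i \<and> x i \<le> y i) \<Longrightarrow> esym r I x \<le> esym r I y"
  unfolding esym_def by (intro sum_mono prod_mono) auto

lemma esym_const: "finite I \<Longrightarrow> esym r I (\<lambda>_. c) = real (card I choose r) * c ^ r"
  by (simp add: esym_def n_subsets)

lemma esym_scale: "esym r I (\<lambda>i. c * x i) = c ^ r * esym r I x"
proof -
  have "(\<Sum>S | S \<subseteq> I \<and> card S = r. \<Prod>i\<in>S. c * x i) =
      (\<Sum>S | S \<subseteq> I \<and> card S = r. c ^ r * (\<Prod>i\<in>S. x i))"
    by (rule sum.cong) (auto simp: prod.distrib)
  then show ?thesis by (simp add: esym_def sum_distrib_left)
qed

lemma esym_1: "finite I \<Longrightarrow> esym (Suc 0) I x = sum x I"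
proof (induction I rule: finite_induct)
  case empty
  have "{S. S \<subseteq> ({}::'a set) \<and> card S = Suc 0} = {}" by auto
  then show ?case by (simp only: esym_def sum.empty)
next
  case (insert i I)
  then show ?case by (simp add: esym_insert)
qed

text \<open>Multiplying out \<open>sum x I * esym r I x\<close> produces every product over r + 1
  distinct indices, and the other terms are nonnegative.\<close>

lemma esym_Suc_le:
  assumes "finite I" "\<And>i. i \<in> I \<Longrightarrow> x i \<ge> 0"
  shows "esym (Suc r) I x \<le> sum x I * esym r I x"
  using assms
proof (induction I arbitrary: r rule: finite_induct)
  case empty
  have "{S. S \<subseteq> ({}::'a set) \<and> card S = Suc r} = {}" by auto
  then have "esym (Suc r) ({}::'a set) x = 0" by (simp only: esym_def sum.empty)
  then show ?case by simp
next
  case (insert i I)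
  show ?case
  proof (cases r)
    case 0
    then show ?thesis using insert by (simp add: esym_1)
  next
    case (Suc k)
    have IH: "esym (Suc r) I x \<le> sum x I * esym r I x" "esym r I x \<le> sum x I * esym k I x"
      using insert Suc by auto
    have nn: "esym k I x \<ge> 0" "esym r I x \<ge> 0" "sum x I \<ge> 0" "x i \<ge> 0"
      using insert by (auto intro: esym_nonneg sum_nonneg)
    have "x i * (x i * esym k I x) \<ge> 0" "x i * (sum x I * esym k I x) \<ge> 0"
      using nn by simp_all
    moreover have "esym (Suc r) (insert i I) x = esym (Suc r) I x + x i * esym r I x"
      "esym r (insert i I) x = esym r I x + x i * esym k I x"
      using insert Suc by (simp_all add: esym_insert)
    ultimately show ?thesis
      using insert(1,2) IH(1) by (simp add: algebra_simps)
  qed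
qed

lemma esym_insert2:
  assumes "finite I" "i \<notin> I" "j \<notin> I" "i \<noteq> j"
  shows "esym (Suc (Suc r)) (insert i (insert j I)) x =
    esym (Suc (Suc r)) I x + (x i + x j) * esym (Suc r) I x + x i * x j * esym r I x"
  using assms by (simp add: esym_insert algebra_simps)

text \<open>With \<open>x i + x j\<close> fixed, the polynomial is affine in the product
  \<open>x i * x j\<close>; the slope is the polynomial of degree two less in the remaining
  coordinates.\<close>

lemma esym_smooth_eq:
  assumes "finite I" "i \<in> I" "j \<in> I" "i \<noteq> j" "x i + x j = p + q"
  shows "esym (Suc (Suc r)) I (x(i := p, j := q)) =
    esym (Suc (Suc r)) I x + (p * q - x i * x j) * esym r (I - {i, j}) x"
proof -
  define J where "J = I - {i, j}"
  have J: "finite J" "i \<notin> J" "j \<notin> J" "I = insert i (insert j J)"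
    using assms by (auto simp: J_def)
  define x' where "x' = x(i := p, j := q)"
  have c: "esym k J x' = esym k J x" for k
    by (rule esym_cong) (use J in \<open>auto simp: x'_def\<close>)
  have x': "x' i = p" "x' j = q" using assms(4) by (auto simp: x'_def)
  show ?thesis
    unfolding J_def[symmetric] x'_def[symmetric]
    unfolding J(4) esym_insert2[OF J(1-3) assms(4)] c x' assms(5)[symmetric]
    by (simp add: algebra_simps)
qed

lemma esym_smooth:
  assumes "finite I" "i \<in> I" "j \<in> I" "i \<noteq> j" "x i + x j = p + q" "x i * x j \<le> p * q"
    and "\<And>k. k \<in> I \<Longrightarrow> x k \<ge> 0"
  shows "esym r I x \<le> esym r I (x(i := p, j := q))"
proof -
  consider "r = 0" | "r = Suc 0" | k where "r = Suc (Suc k)"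
    by (cases r; cases "r - 1") auto
  then show ?thesis
  proof cases
    case 1
    then show ?thesis using assms by simp
  next
    case 2
    define J where "J = I - {i, j}"
    have J: "finite J" "i \<notin> J" "j \<notin> J" "I = insert i (insert j J)"
      using assms by (auto simp: J_def)
    have "sum (x(i := p, j := q)) J = sum x J"
      by (rule sum.cong) (use J in auto)
    then have "sum (x(i := p, j := q)) I = sum x I"
      using J assms(4,5) by simp
    then show ?thesis using 2 assms(1) by (simp add: esym_1)
  next
    case 3
    have "(p * q - x i * x j) * esym k (I - {i, j}) x \<ge> 0"
      using assms by (intro mult_nonneg_nonneg esym_nonneg) auto
    then show ?thesis
      unfolding 3 esym_smooth_eq[OF assms(1-5)] by simp
  qed
qed

lemma exists_below_above_mean:
  fixes x :: "'i \<Rightarrow> real"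
  assumes "finite I" "I \<noteq> {}" "sum x I = real (card I) * \<mu>" "k \<in> I" "x k \<noteq> \<mu>"
  shows "\<exists>i\<in>I. \<exists>j\<in>I. x i < \<mu> \<and> \<mu> < x j"
proof -
  have "\<exists>i\<in>I. x i < \<mu>"
  proof (rule ccontr)
    assume "\<not> ?thesis"
    then have "sum (\<lambda>_. \<mu>) I < sum x I"
      using assms by (intro sum_strict_mono_ex1) (auto simp: not_less intro!: bexI[of _ k])
    then show False using assms by simp
  qed
  moreover have "\<exists>i\<in>I. x i > \<mu>"
  proof (rule ccontr)
    assume "\<not> ?thesis"
    then have "sum x I < sum (\<lambda>_. \<mu>) I"
      using assms by (intro sum_strict_mono_ex1) (auto simp: not_less intro!: bexI[of _ k])
    then show False using assms by simp
  qed
  ultimately show ?thesis by blast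
qed

text \<open>Smoothing: a coordinate below the mean is moved onto it at the expense of one above it.
  This does not lower the polynomial, and fewer coordinates differ from the mean.\<close>

theorem maclaurin_esym:
  assumes "finite I" "I \<noteq> {}" "\<And>i. i \<in> I \<Longrightarrow> x i \<ge> 0"
  shows "esym r I x \<le> real (card I choose r) * (sum x I / real (card I)) ^ r"
proof -
  define \<mu> where "\<mu> = sum x I / real (card I)"
  have cI: "real (card I) > 0" using assms by (simp add: card_gt_0_iff)
  have \<mu>0: "\<mu> \<ge> 0" unfolding \<mu>_def using assms cI by (auto intro!: divide_nonneg_nonneg sum_nonneg)
  have "sum x I = real (card I) * \<mu>" using cI by (simp add: \<mu>_def)
  then have "esym r I x \<le> real (card I choose r) * \<mu> ^ r"
    using assms(3)
  proof (induction "card {i\<in>I. x i \<noteq> \<mu>}" arbitrary: x rule: less_induct)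
    case less
    show ?case
    proof (cases "\<exists>k\<in>I. x k \<noteq> \<mu>")
      case False
      then have "esym r I x = esym r I (\<lambda>_. \<mu>)" by (intro esym_cong) auto
      then show ?thesis using assms(1) by (simp add: esym_const)
    next
      case True
      then obtain i j where ij: "i \<in> I" "j \<in> I" "x i < \<mu>" "\<mu> < x j"
        using exists_below_above_mean[OF assms(1,2) less.prems(1)] by blast
      then have ne: "i \<noteq> j" by auto
      define y where "y = x(i := \<mu>, j := x i + x j - \<mu>)"
      have yi: "y i = \<mu>" "y j = x i + x j - \<mu>" using ne by (auto simp: y_def)
      have xi: "x i \<ge> 0" using less.prems ij by auto
      have "0 \<le> (\<mu> - x i) * (x j - \<mu>)" using ij by simp
      then have "x i * x j \<le> \<mu> * (x i + x j - \<mu>)" by (simp add: algebra_simps)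
      then have "esym r I x \<le> esym r I y"
        unfolding y_def using ij ne less.prems assms(1) by (intro esym_smooth) auto
      also have "\<dots> \<le> real (card I choose r) * \<mu> ^ r"
      proof (rule less.hyps)
        have "y k = x k" if "k \<noteq> i" "k \<noteq> j" for k using that by (simp add: y_def)
        then have "{k\<in>I. y k \<noteq> \<mu>} \<subseteq> {k\<in>I. x k \<noteq> \<mu>} - {i}"
          using ij(4) yi(1) by fastforce
        moreover have "i \<in> {k\<in>I. x k \<noteq> \<mu>}" using ij(1,3) by simp
        ultimately have "{k\<in>I. y k \<noteq> \<mu>} \<subset> {k\<in>I. x k \<noteq> \<mu>}" by blast
        then show "card {k\<in>I. y k \<noteq> \<mu>} < card {k\<in>I. x k \<noteq> \<mu>}"
          using assms(1) by (intro psubset_card_mono) auto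
        define J where "J = I - {i, j}"
        have J: "finite J" "i \<notin> J" "j \<notin> J" "I = insert i (insert j J)"
          using ij assms(1) by (auto simp: J_def)
        have "sum y J = sum x J"
          by (rule sum.cong) (use J in \<open>auto simp: y_def\<close>)
        then have "sum y I = sum x I" using J ne yi by simp
        then show "sum y I = real (card I) * \<mu>" using less.prems by simp
        show "y k \<ge> 0" if "k \<in> I" for k
          using that less.prems(2)[OF that] xi ij \<mu>0 by (auto simp: y_def)
      qed
      finally show ?thesis .
    qed
  qed
  then show ?thesis by (simp add: \<mu>_def)
qed

text \<open>Averaging two unequal coordinates multiplies the polynomial by a definite factor,
  because it is at most four times its part over the remaining coordinates.\<close>

lemma esym_stability:
  assumes "finite I" "card I = m" "r \<ge> 2" "\<And>i. i \<in> I \<Longrightarrow> x i \<ge> 0" "sum x I = 1"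
    and "k \<in> I" "\<bar>x k - 1 / real m\<bar> > \<eta>" "\<eta> \<ge> 0"
  shows "esym r I x * (1 + \<eta>\<^sup>2 / 16) \<le> real (m choose r) / real m ^ r"
proof -
  have ne: "I \<noteq> {}" using assms by auto
  have m: "real m > 0" using assms ne by (auto simp: card_gt_0_iff)
  \<comment> \<open>Coordinate \<open>k\<close> is off by more than \<eta>, and some coordinate lies
    on the other side of the mean 1 / m; these two are far apart.\<close>
  obtain i j where ij: "i \<in> I" "j \<in> I" "x j - x i \<ge> \<eta>" "i \<noteq> j"
  proof -
    have "\<exists>i\<in>I. \<exists>j\<in>I. x i < 1 / real m \<and> 1 / real m < x j"
      using assms m ne by (intro exists_below_above_mean[where k = k]) auto
    then obtain i j where *: "i \<in> I" "j \<in> I" "x i < 1 / real m" "1 / real m < x j" by blast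
    show ?thesis
    proof (cases "x k < 1 / real m")
      case True
      then have "x j - x k \<ge> \<eta>" using * assms(7) by linarith
      moreover have "k \<noteq> j" using True * by auto
      ultimately show ?thesis using that[of k j] * assms(6) by blast
    next
      case False
      then have "x k - x i \<ge> \<eta>" using * assms(7) by linarith
      moreover have "i \<noteq> k" using False * by auto
      ultimately show ?thesis using that[of i k] * assms(6) by blast
    qed
  qed
  obtain s where s: "r = Suc (Suc s)"
    using assms(3) by (auto simp: le_iff_add)
  define J where "J = I - {i, j}"
  have J: "finite J" "i \<notin> J" "j \<notin> J" "I = insert i (insert j J)"
    using ij assms by (auto simp: J_def)
  have xnn: "x i \<ge> 0" "x j \<ge> 0" "\<And>l. l \<in> J \<Longrightarrow> x l \<ge> 0" using assms ij J by auto
  have s1: "x i + x j + sum x J = 1" using assms(5) J ij by simp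
  have sJ: "sum x J \<ge> 0" "sum x J \<le> 1" using s1 xnn by (auto intro: sum_nonneg)
  define c where "c = esym s J x"
  have c0: "c \<ge> 0" unfolding c_def using xnn by (intro esym_nonneg)
  have e1: "esym (Suc s) J x \<le> c"
  proof -
    have "esym (Suc s) J x \<le> sum x J * c" unfolding c_def using esym_Suc_le J xnn by blast
    also have "\<dots> \<le> c" using sJ c0 by (simp add: mult_left_le_one_le)
    finally show ?thesis .
  qed
  have e2: "esym (Suc (Suc s)) J x \<le> c"
  proof -
    have "esym (Suc (Suc s)) J x \<le> sum x J * esym (Suc s) J x" using esym_Suc_le J xnn by blast
    also have "\<dots> \<le> esym (Suc s) J x"
      using sJ xnn by (intro mult_left_le_one_le esym_nonneg) auto
    finally show ?thesis using e1 by simp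
  qed
  have "(x i + x j) * esym (Suc s) J x \<le> 1 * c"
    using s1 sJ e1 xnn by (intro mult_mono esym_nonneg) auto
  moreover have "x i * x j \<le> 1 * 1"
    using s1 sJ xnn by (intro mult_mono) auto
  then have "x i * x j * c \<le> 1 * c" using c0 by (intro mult_right_mono) auto
  \<comment> \<open>Each of the three terms in \<open>esym_insert2\<close> is at most
    \<open>c\<close>; the fourth \<open>c\<close> is slack.\<close>
  ultimately have le4: "esym r I x \<le> 4 * c"
    unfolding s J(4) esym_insert2[OF J(1-3) ij(4)] using e2 c0 by (simp add: c_def)
  define h where "h = (x i + x j) / 2"
  have "esym r I (x(i := h, j := h)) = esym r I x + (h * h - x i * x j) * c"
    unfolding s c_def J_def using ij assms by (intro esym_smooth_eq) (auto simp: h_def)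
  moreover have "h * h - x i * x j = (x j - x i)\<^sup>2 / 4"
    by (simp add: h_def power2_eq_square field_simps)
  moreover have "(x j - x i)\<^sup>2 \<ge> \<eta>\<^sup>2" using ij assms by (intro power_mono) auto
  ultimately have "esym r I (x(i := h, j := h)) \<ge> esym r I x + \<eta>\<^sup>2 / 4 * c"
    using c0 by (simp add: mult_right_mono)
  moreover have "\<eta>\<^sup>2 / 4 * c \<ge> \<eta>\<^sup>2 / 16 * esym r I x"
    using mult_left_mono[OF le4, of "\<eta>\<^sup>2 / 16"] by (simp add: mult.commute)
  moreover have "esym r I (x(i := h, j := h)) \<le> real (m choose r) / real m ^ r"
  proof -
    have "sum (x(i := h, j := h)) J = sum x J" by (rule sum.cong) (use J in auto)
    then have "sum (x(i := h, j := h)) I = 1" using J ij s1 by (simp add: h_def)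
    moreover have "(x(i := h, j := h)) l \<ge> 0" if "l \<in> I" for l
      using that assms(4) xnn by (auto simp: h_def)
    ultimately show ?thesis
      using maclaurin_esym[OF assms(1) ne, of "x(i := h, j := h)" r] assms(2)
      by (simp add: power_divide)
  qed
  ultimately show ?thesis by (simp add: algebra_simps)
qed

text \<open>Integral smoothing: one unit moves from an index where \<open>a\<close> exceeds
  \<open>b\<close> to one where it falls short. Balancedness of \<open>b\<close> forces
  \<open>a i \<ge> a j + 1\<close> there, so the product of the two does not drop, while the
  distance to \<open>b\<close> does.\<close>

lemma esym_balanced_max:
  fixes a b :: "'i \<Rightarrow> nat"
  assumes "finite I" "sum a I = sum b I" "\<And>i j. i \<in> I \<Longrightarrow> j \<in> I \<Longrightarrow> b i \<le> b j + 1"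
  shows "esym r I (\<lambda>i. real (a i)) \<le> esym r I (\<lambda>i. real (b i))"
  using assms(2)
proof (induction "\<Sum>i\<in>I. (a i - b i) + (b i - a i)" arbitrary: a rule: less_induct)
  case less
  show ?case
  proof (cases "\<forall>i\<in>I. a i = b i")
    case True
    then have "esym r I (\<lambda>i. real (a i)) = esym r I (\<lambda>i. real (b i))" by (intro esym_cong) auto
    then show ?thesis by simp
  next
    case False
    then obtain k where k: "k \<in> I" "a k \<noteq> b k" by auto
    have "\<exists>i\<in>I. a i > b i"
    proof (rule ccontr)
      assume "\<not> ?thesis"
      then have "sum a I < sum b I"
        using assms k by (intro sum_strict_mono_ex1) (auto simp: not_less intro!: bexI[of _ k])
      then show False using less by simp
    qed
    moreover have "\<exists>j\<in>I. a j < b j"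
    proof (rule ccontr)
      assume "\<not> ?thesis"
      then have "sum b I < sum a I"
        using assms k by (intro sum_strict_mono_ex1) (auto simp: not_less intro!: bexI[of _ k])
      then show False using less by simp
    qed
    ultimately obtain i j where ij: "i \<in> I" "j \<in> I" "a i > b i" "a j < b j" by blast
    then have ne: "i \<noteq> j" by auto
    have ge: "a i \<ge> a j + 1" using ij assms(3)[of j i] by linarith
    define y where "y = a(i := a i - 1, j := a j + 1)"
    define J where "J = I - {i, j}"
    have J: "finite J" "i \<notin> J" "j \<notin> J" "I = insert i (insert j J)"
      using ij assms(1) by (auto simp: J_def)
    have yJ: "y l = a l" if "l \<in> J" for l using that J by (auto simp: y_def)
    have yi: "y i = a i - 1" "y j = a j + 1" using ne by (auto simp: y_def)
    have "(\<lambda>i. real (y i)) = (\<lambda>i. real (a i))(i := real (a i) - 1, j := real (a j) + 1)"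
      using ge by (auto simp: y_def)
    moreover have "real (a i) * real (a j) \<le> (real (a i) - 1) * (real (a j) + 1)"
      using ge by (simp add: algebra_simps)
    ultimately have "esym r I (\<lambda>i. real (a i)) \<le> esym r I (\<lambda>i. real (y i))"
      using esym_smooth[OF assms(1) ij(1,2) ne, of "\<lambda>i. real (a i)" "real (a i) - 1" "real (a j) + 1" r]
      by simp
    also have "\<dots> \<le> esym r I (\<lambda>i. real (b i))"
    proof (rule less.hyps)
      have "sum y J = sum a J" using yJ by (intro sum.cong) auto
      then have "sum y I = sum a I" using J ne yi ge by simp
      then show "sum y I = sum b I" using less by simp
      have "(\<Sum>i\<in>J. (y i - b i) + (b i - y i)) = (\<Sum>i\<in>J. (a i - b i) + (b i - a i))"
        using yJ by (intro sum.cong) auto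
      then show "(\<Sum>i\<in>I. (y i - b i) + (b i - y i)) < (\<Sum>i\<in>I. (a i - b i) + (b i - a i))"
        using J ne yi ij by simp
    qed
    finally show ?thesis .
  qed
qed

section \<open>Counting transversals\<close>

lemma card_transversals:
  assumes "finite V" "finite S"
  shows "card {e. e \<subseteq> V \<and> inj_on c e \<and> c ` e = S} = (\<Prod>i\<in>S. card {v\<in>V. c v = i})"
proof -
  let ?P = "PiE S (\<lambda>i. {v\<in>V. c v = i})"
  have "bij_betw (\<lambda>f. f ` S) ?P {e. e \<subseteq> V \<and> inj_on c e \<and> c ` e = S}"
  proof (rule bij_betw_byWitness[where f' = "\<lambda>e. \<lambda>i\<in>S. the_inv_into e c i"])
    show "\<forall>f\<in>?P. (\<lambda>i\<in>S. the_inv_into (f ` S) c i) = f"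
    proof
      fix f assume f: "f \<in> ?P"
      then have cf: "c (f i) = i" if "i \<in> S" for i using that by auto
      then have inj: "inj_on c (f ` S)" by (auto intro!: inj_onI)
      have "the_inv_into (f ` S) c i = f i" if "i \<in> S" for i
        using the_inv_into_f_f[OF inj, of "f i"] that cf by auto
      then show "(\<lambda>i\<in>S. the_inv_into (f ` S) c i) = f"
        using f by (intro ext) (auto simp: PiE_def extensional_def restrict_def)
    qed
    show "\<forall>e\<in>{e. e \<subseteq> V \<and> inj_on c e \<and> c ` e = S}. (\<lambda>i\<in>S. the_inv_into e c i) ` S = e"
    proof
      fix e assume "e \<in> {e. e \<subseteq> V \<and> inj_on c e \<and> c ` e = S}"
      then have e: "inj_on c e" "c ` e = S" by auto
      then have "the_inv_into e c ` S = e"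
        using the_inv_into_onto[OF e(1)] by simp
      then show "(\<lambda>i\<in>S. the_inv_into e c i) ` S = e" by simp
    qed
    show "(\<lambda>f. f ` S) ` ?P \<subseteq> {e. e \<subseteq> V \<and> inj_on c e \<and> c ` e = S}"
    proof clarify
      fix f assume f: "f \<in> ?P"
      then have cf: "c (f i) = i" if "i \<in> S" for i using that by auto
      have "c ` f ` S = S" using cf by force
      moreover have "inj_on c (f ` S)" using cf by (auto intro!: inj_onI)
      ultimately show "f ` S \<subseteq> V \<and> inj_on c (f ` S) \<and> c ` f ` S = S" using f by auto
    qed
    show "(\<lambda>e. \<lambda>i\<in>S. the_inv_into e c i) ` {e. e \<subseteq> V \<and> inj_on c e \<and> c ` e = S} \<subseteq> ?P"
    proof clarify
      fix e assume e: "e \<subseteq> V" "inj_on c e"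
      have "the_inv_into e c i \<in> e \<and> c (the_inv_into e c i) = i" if "i \<in> c ` e" for i
        using the_inv_into_into[OF e(2) that subset_refl] f_the_inv_into_f[OF e(2) that] by simp
      then show "(\<lambda>i\<in>c ` e. the_inv_into e c i) \<in> PiE (c ` e) (\<lambda>i. {v\<in>V. c v = i})"
        using e by auto
    qed
  qed
  then have "card ?P = card {e. e \<subseteq> V \<and> inj_on c e \<and> c ` e = S}"
    by (rule bij_betw_same_card)
  then show ?thesis using assms by (simp add: card_PiE)
qed

text \<open>The edge set of the complete multipartite graph whose parts are the fibres of
  \<open>c\<close>. Partitions into \<open>m\<close> parts are represented throughout by colourings
  with values below \<open>m\<close>.\<close>

definition rainbow :: "nat \<Rightarrow> 'v set \<Rightarrow> ('v \<Rightarrow> 'i) \<Rightarrow> 'v set set" where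
  "rainbow r V c = {e. e \<subseteq> V \<and> card e = r \<and> inj_on c e}"

text \<open>Sorting rainbow sets by the colours they use gives one product of part sizes for each
  set of r colours.\<close>

lemma card_rainbow:
  assumes "finite V" "finite I" "c ` V \<subseteq> I"
  shows "real (card (rainbow r V c)) = esym r I (\<lambda>i. real (card {v\<in>V. c v = i}))"
proof -
  let ?T = "{S. S \<subseteq> I \<and> card S = r}"
  let ?X = "\<lambda>S. {e. e \<subseteq> V \<and> inj_on c e \<and> c ` e = S}"
  have "rainbow r V c = (\<Union>S\<in>?T. ?X S)"
    using assms(3) unfolding rainbow_def by (auto simp: card_image subset_iff)
  moreover have "card (\<Union>S\<in>?T. ?X S) = (\<Sum>S\<in>?T. card (?X S))"
    using assms by (intro card_UN_disjoint) auto
  moreover have "real (\<Sum>S\<in>?T. card (?X S)) = (\<Sum>S\<in>?T. \<Prod>i\<in>S. real (card {v\<in>V. c v = i}))"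
    unfolding of_nat_sum
  proof (rule sum.cong[OF refl])
    fix S assume "S \<in> ?T"
    then have "finite S" using assms(2) finite_subset by auto
    then show "real (card (?X S)) = (\<Prod>i\<in>S. real (card {v\<in>V. c v = i}))"
      using card_transversals[OF assms(1), of S c] by (simp only: of_nat_prod)
  qed
  ultimately show ?thesis by (simp add: esym_def)
qed

lemma finite_rainbow [simp]: "finite V \<Longrightarrow> finite (rainbow r V c)"
  unfolding rainbow_def by simp

lemma sum_card_fibres:
  assumes "finite V" "finite I" "c ` V \<subseteq> I"
  shows "(\<Sum>i\<in>I. card {v\<in>V. c v = i}) = card V"
proof -
  have "card V = card (\<Union>i\<in>I. {v\<in>V. c v = i})"
    using assms(3) by (intro arg_cong[where f = card]) auto
  also have "\<dots> = (\<Sum>i\<in>I. card {v\<in>V. c v = i})"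
    using assms by (intro card_UN_disjoint) auto
  finally show ?thesis by simp
qed

lemma card_rainbow_le:
  assumes "finite V" "finite I" "I \<noteq> {}" "c ` V \<subseteq> I"
  shows "real (card (rainbow r V c)) \<le> real (card I choose r) * (real (card V) / real (card I)) ^ r"
proof -
  have "(\<Sum>i\<in>I. real (card {v\<in>V. c v = i})) = real (card V)"
    using sum_card_fibres[OF assms(1,2,4)] by (simp flip: of_nat_sum)
  then show ?thesis
    using maclaurin_esym[of I "\<lambda>i. real (card {v\<in>V. c v = i})" r] assms
    by (simp add: card_rainbow)
qed

section \<open>Embedding by counting\<close>

lemma binomial_le_power: "n choose k \<le> n ^ k"
proof (cases "k \<le> n")
  case True
  then show ?thesis by (rule binomial_le_pow)
next
  case False
  then show ?thesis by (simp add: binomial_eq_0)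
qed

lemma card_supersets_le:
  assumes "finite V" "finite S"
  shows "card {e. e \<subseteq> V \<and> card e = r \<and> S \<subseteq> e} \<le> card V ^ (r - card S)"
proof -
  let ?A = "{e. e \<subseteq> V \<and> card e = r \<and> S \<subseteq> e}"
  have "inj_on (\<lambda>e. e - S) ?A" by (rule inj_onI) blast
  moreover have "(\<lambda>e. e - S) ` ?A \<subseteq> {f. f \<subseteq> V \<and> card f = r - card S}"
    using assms by (auto simp: card_Diff_subset)
  moreover have "finite {f. f \<subseteq> V \<and> card f = r - card S}" using assms by simp
  ultimately have "card ?A \<le> card {f. f \<subseteq> V \<and> card f = r - card S}"
    by (rule card_inj_on_le)
  also have "\<dots> \<le> card V ^ (r - card S)"
    using n_subsets[OF assms(1)] binomial_le_power by simp
  finally show ?thesis .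
qed

lemma card_restrict_le:
  assumes "finite I" "finite V" "J \<subseteq> I" "B \<subseteq> PiE J (\<lambda>_. V)"
  shows "card {g \<in> PiE I (\<lambda>_. V). restrict g J \<in> B} \<le> card B * card V ^ (card I - card J)"
proof -
  let ?A = "{g \<in> PiE I (\<lambda>_. V). restrict g J \<in> B}"
  let ?f = "\<lambda>g. (restrict g J, restrict g (I - J))"
  have fJ: "finite J" using assms finite_subset by blast
  have "inj_on ?f ?A"
  proof (rule inj_onI)
    fix g h assume gh: "g \<in> ?A" "h \<in> ?A" "?f g = ?f h"
    have "g x = h x" if "x \<in> I" for x
      using gh(3) that by (metis Diff_iff Pair_inject restrict_apply')
    then show "g = h" using gh(1,2) by (auto intro: PiE_ext)
  qed
  moreover have "?f ` ?A \<subseteq> B \<times> PiE (I - J) (\<lambda>_. V)" by auto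
  moreover have "finite B"
    using assms fJ by (meson finite_PiE finite_subset)
  then have "finite (B \<times> PiE (I - J) (\<lambda>_. V))" using assms by (auto intro!: finite_PiE)
  ultimately have "card ?A \<le> card (B \<times> PiE (I - J) (\<lambda>_. V))" by (rule card_inj_on_le)
  also have "\<dots> = card B * card V ^ (card I - card J)"
    using assms fJ by (simp add: card_cartesian_product card_PiE card_Diff_subset)
  finally show ?thesis .
qed

text \<open>A union bound over the maps in \<Omega>, with the placement \<phi> of \<open>T\<close>
  fixed in advance. A map fails to embed only if some edge is bad, two free vertices collide, or a
  free vertex hits the image of \<open>T\<close>. Each of these events contains at most a fraction
  \<beta> of all maps, and \<Omega> is larger than all of them together.\<close>

lemma embed_by_counting:
  fixes \<beta> :: real and X :: "'x set" and V :: "'v set"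
  assumes "finite X" "finite V" "T \<subseteq> X" "inj_on \<phi> T" "\<phi> ` T \<subseteq> V" "finite D" "\<beta> \<ge> 0"
    and DX: "\<And>e. e \<in> D \<Longrightarrow> e \<subseteq> X"
    and \<Omega>: "\<Omega> \<subseteq> PiE (X - T) (\<lambda>_. V)"
    and good: "\<And>g e. g \<in> \<Omega> \<Longrightarrow> e \<in> D \<Longrightarrow>
        (\<lambda>x. if x \<in> T then \<phi> x else g x) ` e \<in> E \<or> restrict g (e - T) \<in> Bad e"
    and Bad: "\<And>e. e \<in> D \<Longrightarrow> Bad e \<subseteq> PiE (e - T) (\<lambda>_. V)"
      "\<And>e. e \<in> D \<Longrightarrow> real (card (Bad e)) \<le> \<beta> * real (card V) ^ card (e - T)"
    and \<beta>: "real (card X) \<le> \<beta> * real (card V)"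
    and large: "real (card D + card X * card X + card X) * (\<beta> * real (card V) ^ card (X - T))
        < real (card \<Omega>)"
  shows "contains_copy (Hypergraph V E) (Hypergraph X D)"
proof -
  define I where "I = X - T"
  define n where "n = card V"
  have fI: "finite I" using assms by (simp add: I_def)
  define G where "G = PiE I (\<lambda>_. V)"
  \<comment> \<open>An event that depends on the coordinates in \<open>J\<close> only has the
    density of \<open>B\<close> among the maps on \<open>J\<close>.\<close>
  define ev where "ev J B = {g \<in> G. restrict g J \<in> B}" for J B
  have ev_bound: "real (card (ev J B)) \<le> \<beta> * real n ^ card I"
    if J: "J \<subseteq> I" "B \<subseteq> PiE J (\<lambda>_. V)" "real (card B) \<le> \<beta> * real n ^ card J" for J B
  proof -
    have "card (ev J B) \<le> card B * n ^ (card I - card J)"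
      unfolding ev_def G_def n_def using card_restrict_le fI assms(2) J by blast
    then have "real (card (ev J B)) \<le> real (card B) * real n ^ (card I - card J)"
      by (metis of_nat_le_iff of_nat_mult of_nat_power)
    also have "\<dots> \<le> \<beta> * real n ^ card J * real n ^ (card I - card J)"
      using J by (intro mult_right_mono) auto
    also have "\<dots> = \<beta> * real n ^ card I"
      using card_mono[OF fI J(1)] by (simp flip: power_add)
    finally show ?thesis .
  qed
  \<comment> \<open>Besides the bad edges there are two kinds of failure of injectivity: equal
    values at two free vertices (\<open>C\<close>), and a value already taken by \<open>T\<close>
    (\<open>K\<close>).\<close>
  define C where "C x y = {h \<in> PiE {x, y} (\<lambda>_. V). h x = h y}" for x y :: 'x
  define K where "K x = {h \<in> PiE {x} (\<lambda>_. V). h x \<in> \<phi> ` T}" for x :: 'x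
  define \<A> where "\<A> = (\<lambda>e. ev (e - T) (Bad e)) ` D \<union>
    (\<lambda>(x, y). ev {x, y} (C x y)) ` {p \<in> I \<times> I. fst p \<noteq> snd p} \<union> (\<lambda>x. ev {x} (K x)) ` I"
  have cIX: "card I \<le> card X" unfolding I_def using assms(1) by (intro card_mono) auto
  have pairs: "card {p \<in> I \<times> I. fst p \<noteq> snd p} \<le> card X * card X"
  proof -
    have "card {p \<in> I \<times> I. fst p \<noteq> snd p} \<le> card (I \<times> I)"
      using fI by (intro card_mono) auto
    also have "\<dots> \<le> card X * card X"
      unfolding card_cartesian_product using cIX by (rule mult_le_mono[OF _ cIX])
    finally show ?thesis .
  qed
  have fA: "finite \<A>" unfolding \<A>_def using fI assms(6) by simp
  have "card \<A> \<le> card D + card X * card X + card X"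
  proof -
    have "card \<A> \<le> card ((\<lambda>e. ev (e - T) (Bad e)) ` D) +
        card ((\<lambda>(x, y). ev {x, y} (C x y)) ` {p \<in> I \<times> I. fst p \<noteq> snd p}) + card ((\<lambda>x. ev {x} (K x)) ` I)"
      unfolding \<A>_def by (rule order_trans[OF card_Un_le add_right_mono[OF card_Un_le]])
    also have "\<dots> \<le> card D + card {p \<in> I \<times> I. fst p \<noteq> snd p} + card I"
      using fI assms(6) by (intro add_le_mono card_image_le) simp_all
    finally show ?thesis using pairs cIX by linarith
  qed
  moreover have each: "real (card A) \<le> \<beta> * real n ^ card I" if A: "A \<in> \<A>" for A
  proof -
    have inX: "real (card X) \<le> \<beta> * real n" using \<beta> by (simp add: n_def)
    consider e where "e \<in> D" "A = ev (e - T) (Bad e)"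
      | x y where "x \<in> I" "y \<in> I" "x \<noteq> y" "A = ev {x, y} (C x y)"
      | x where "x \<in> I" "A = ev {x} (K x)"
      using A unfolding \<A>_def by auto
    then show ?thesis
    proof cases
      case 1
      then show ?thesis using DX[of e] Bad[of e] ev_bound[of "e - T" "Bad e"] by (auto simp: I_def n_def)
    next
      case 2
      have "inj_on (\<lambda>h. h x) (C x y)"
      proof (rule inj_onI)
        fix g h assume "g \<in> C x y" "h \<in> C x y" "g x = h x"
        then show "g = h" unfolding C_def by (auto intro!: PiE_ext[of g "{x, y}" "\<lambda>_. V" h])
      qed
      then have "card (C x y) \<le> n"
        unfolding n_def by (rule card_inj_on_le[OF _ _ assms(2)]) (auto simp: C_def)
      \<comment> \<open>A collision leaves n choices for two coordinates; since \<beta> n is at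
        least 1, this is at most \<beta> n^2.\<close>
      moreover have "1 \<le> card X"
        using 2(1) assms(1) by (auto simp: I_def card_gt_0_iff Suc_le_eq)
      then have "1 \<le> \<beta> * real n" using inX by linarith
      then have "real n \<le> \<beta> * real n * real n"
        using mult_right_mono[of 1 "\<beta> * real n" "real n"] by simp
      ultimately have "real (card (C x y)) \<le> \<beta> * real n ^ card {x, y}"
        using 2(3) by (simp add: power2_eq_square mult.assoc)
      then show ?thesis using 2 ev_bound[of "{x, y}" "C x y"] by (auto simp: C_def)
    next
      case 3
      have "inj_on (\<lambda>h. h x) (K x)"
      proof (rule inj_onI)
        fix g h assume "g \<in> K x" "h \<in> K x" "g x = h x"
        then show "g = h" unfolding K_def by (auto intro!: PiE_ext[of g "{x}" "\<lambda>_. V" h])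
      qed
      moreover have "(\<lambda>h. h x) ` K x \<subseteq> \<phi> ` T" by (auto simp: K_def)
      moreover have "finite T" using assms(1,3) finite_subset by blast
      ultimately have "card (K x) \<le> card (\<phi> ` T)" by (intro card_inj_on_le[of "\<lambda>h. h x"]) auto
      also have "\<dots> \<le> card X"
        using assms(1,3,4) by (simp add: card_image card_mono)
      finally have "real (card (K x)) \<le> \<beta> * real n ^ card {x}"
        using inX by simp
      then show ?thesis using 3 ev_bound[of "{x}" "K x"] by (auto simp: K_def)
    qed
  qed
  ultimately have "real (card (\<Union>\<A>)) \<le> real (card D + card X * card X + card X) * (\<beta> * real n ^ card I)"
  proof -
    have "real (card (\<Union>\<A>)) \<le> real (\<Sum>A\<in>\<A>. card A)"
      using card_Union_le_sum_card[of \<A>] by (simp only: of_nat_le_iff)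
    also have "\<dots> \<le> (\<Sum>A\<in>\<A>. \<beta> * real n ^ card I)"
      unfolding of_nat_sum using each by (rule sum_mono)
    also have "\<dots> = real (card \<A>) * (\<beta> * real n ^ card I)" by simp
    also have "\<dots> \<le> real (card D + card X * card X + card X) * (\<beta> * real n ^ card I)"
      using \<open>card \<A> \<le> _\<close> assms(7) by (intro mult_right_mono) (simp_all only: of_nat_le_iff, simp)
    finally show ?thesis .
  qed
  then have "card (\<Union>\<A>) < card \<Omega>" using large by (simp add: n_def I_def)
  moreover have "finite (\<Union>\<A>)"
  proof -
    have "\<Union>\<A> \<subseteq> G" by (auto simp: \<A>_def ev_def)
    moreover have "finite G" unfolding G_def using fI assms(2) by (simp add: finite_PiE)
    ultimately show ?thesis by (rule finite_subset)
  qed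
  ultimately have "\<not> \<Omega> \<subseteq> \<Union>\<A>" using card_mono by (metis leD)
  then obtain g where g: "g \<in> \<Omega>" "g \<notin> \<Union>\<A>" by blast
  have gG: "g \<in> G" using g \<Omega> by (auto simp: G_def I_def)
  then have gV: "g x \<in> V" if "x \<in> I" for x using that by (auto simp: G_def)
  define f where "f x = (if x \<in> T then \<phi> x else g x)" for x
  have e: "f ` e \<in> E" if "e \<in> D" for e
  proof -
    have "g \<notin> ev (e - T) (Bad e)" using g(2) that by (auto simp: \<A>_def)
    then have "restrict g (e - T) \<notin> Bad e" using gG by (auto simp: ev_def)
    then show ?thesis using good[OF g(1) that] unfolding f_def by auto
  qed
  have d: "g x \<noteq> g y" if "x \<in> I" "y \<in> I" "x \<noteq> y" for x y
  proof
    assume "g x = g y"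
    then have "restrict g {x, y} \<in> C x y" using gV that by (auto simp: C_def)
    then have "g \<in> ev {x, y} (C x y)" using gG by (simp add: ev_def)
    moreover have "ev {x, y} (C x y) \<in> \<A>"
      unfolding \<A>_def using that by (auto intro!: image_eqI[of _ _ "(x, y)"])
    ultimately show False using g(2) by blast
  qed
  have t: "g x \<notin> \<phi> ` T" if "x \<in> I" for x
  proof
    assume "g x \<in> \<phi> ` T"
    then have "restrict g {x} \<in> K x" using gV that by (auto simp: K_def)
    then have "g \<in> ev {x} (K x)" using gG by (simp add: ev_def)
    moreover have "ev {x} (K x) \<in> \<A>" unfolding \<A>_def using that by auto
    ultimately show False using g(2) by blast
  qed
  have "inj_on f X"
  proof (rule inj_onI)
    fix x y assume xy: "x \<in> X" "y \<in> X" "f x = f y"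
    show "x = y"
    proof (cases "x \<in> T"; cases "y \<in> T")
      assume "x \<in> T" "y \<in> T"
      then show ?thesis using xy assms(4) by (auto simp: f_def inj_on_def)
    next
      assume "x \<in> T" "y \<notin> T"
      then have "y \<in> I" "g y = \<phi> x" using xy by (auto simp: f_def I_def)
      then show ?thesis using t[of y] \<open>x \<in> T\<close> by auto
    next
      assume "x \<notin> T" "y \<in> T"
      then have "x \<in> I" "g x = \<phi> y" using xy by (auto simp: f_def I_def)
      then show ?thesis using t[of x] \<open>y \<in> T\<close> by auto
    next
      assume "x \<notin> T" "y \<notin> T"
      then show ?thesis using xy d[of x y] by (auto simp: f_def I_def)
    qed
  qed
  moreover have "f ` X \<subseteq> V" using gV assms(5) by (auto simp: f_def I_def)
  ultimately show ?thesis unfolding contains_copy_def using e by auto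
qed

text \<open>Constraints on disjoint blocks are independent: gluing one admissible map per block is
  injective, whence the product.\<close>

lemma card_blocks_ge:
  assumes "finite I" "finite V"
    and "\<And>k. k \<in> blk ` I \<Longrightarrow> \<Lambda> k \<subseteq> PiE {x\<in>I. blk x = k} (\<lambda>_. V)"
  shows "(\<Prod>k\<in>blk ` I. card (\<Lambda> k)) \<le>
    card {g \<in> PiE I (\<lambda>_. V). \<forall>k\<in>blk ` I. restrict g {x\<in>I. blk x = k} \<in> \<Lambda> k}"
    (is "_ \<le> card ?\<Omega>")
proof -
  let ?f = "\<lambda>h. \<lambda>x\<in>I. h (blk x) x"
  have *: "restrict (?f h) {x\<in>I. blk x = k} = h k"
    if "h \<in> PiE (blk ` I) \<Lambda>" "k \<in> blk ` I" for h k
  proof -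
    have "h k \<in> PiE {x\<in>I. blk x = k} (\<lambda>_. V)" using that assms(3) by blast
    then show ?thesis
      by (intro ext) (auto simp: restrict_def PiE_def extensional_def)
  qed
  have "inj_on ?f (PiE (blk ` I) \<Lambda>)"
  proof (rule inj_onI)
    fix g h assume gh: "g \<in> PiE (blk ` I) \<Lambda>" "h \<in> PiE (blk ` I) \<Lambda>" "?f g = ?f h"
    show "g = h"
    proof (rule PiE_ext[OF gh(1,2)])
      fix k assume "k \<in> blk ` I"
      then show "g k = h k" using *[OF gh(1)] *[OF gh(2)] gh(3) by metis
    qed
  qed
  moreover have "?f ` PiE (blk ` I) \<Lambda> \<subseteq> ?\<Omega>"
  proof clarify
    fix h assume h: "h \<in> PiE (blk ` I) \<Lambda>"
    have "h (blk x) x \<in> V" if "x \<in> I" for x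
    proof -
      have "h (blk x) \<in> PiE {y\<in>I. blk y = blk x} (\<lambda>_. V)" using h that assms(3) by blast
      then show ?thesis using that by blast
    qed
    moreover have "restrict (?f h) {x\<in>I. blk x = k} \<in> \<Lambda> k" if "k \<in> blk ` I" for k
      using *[OF h that] h that by auto
    ultimately show "?f h \<in> PiE I (\<lambda>_. V) \<and>
        (\<forall>k\<in>blk ` I. restrict (?f h) {x\<in>I. blk x = k} \<in> \<Lambda> k)"
      by auto
  qed
  moreover have "finite ?\<Omega>" using assms by (auto intro!: finite_PiE)
  ultimately have "card (PiE (blk ` I) \<Lambda>) \<le> card ?\<Omega>" by (rule card_inj_on_le)
  then show ?thesis using assms(1) by (simp add: card_PiE)
qed

lemma card_maps_onto_ge:
  assumes "finite B" "finite V" "\<And>s. s \<in> L \<Longrightarrow> \<exists>h\<in>\<Lambda>. h ` B = s" "\<Lambda> \<subseteq> PiE B (\<lambda>_. V)"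
  shows "card L \<le> card \<Lambda>"
proof -
  have "L \<subseteq> (\<lambda>h. h ` B) ` \<Lambda>" using assms(3) by blast
  moreover have "finite \<Lambda>" using assms by (meson finite_PiE finite_subset)
  ultimately show ?thesis by (meson surj_card_le)
qed

text \<open>A colour-preserving map of a rainbow set is determined by its image.\<close>

lemma card_coloured_maps_le:
  assumes "inj_on col e" "finite M"
    and "\<And>h x. h \<in> H \<Longrightarrow> x \<in> e \<Longrightarrow> c (F h x) = col x"
    and "\<And>h. h \<in> H \<Longrightarrow> F h ` e \<in> M"
    and "\<And>g h. g \<in> H \<Longrightarrow> h \<in> H \<Longrightarrow> (\<And>x. x \<in> e \<Longrightarrow> F g x = F h x) \<Longrightarrow> g = h"
  shows "card H \<le> card M"
proof (rule card_inj_on_le[OF _ _ assms(2)])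
  show "inj_on (\<lambda>h. F h ` e) H"
  proof (rule inj_onI)
    fix g h assume gh: "g \<in> H" "h \<in> H" "F g ` e = F h ` e"
    show "g = h"
    proof (rule assms(5)[OF gh(1,2)])
      fix x assume x: "x \<in> e"
      then obtain y where y: "y \<in> e" "F g x = F h y" using gh(3) by (metis imageE imageI)
      then have "col x = col y" using assms(3) gh x by metis
      then show "F g x = F h x" using assms(1) x y by (metis inj_onD)
    qed
  qed
  show "(\<lambda>h. F h ` e) ` H \<subseteq> M" using assms(4) by blast
qed

section \<open>Embedding the extension\<close>

text \<open>If no edge of \<open>F\<close> contains \<open>b\<close>, then \<open>R\<close> is an arbitrary set of \<open>r - 1\<close> core vertices.\<close>

locale extension_host =
  fixes m r :: nat and F :: "'a hypergraph" and b :: "'a core_vertex" and R :: "'a core_vertex set"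
  assumes r2: "2 \<le> r" and mr: "r \<le> m" and rF: "r_graph r F" and cF: "card (verts F) \<le> m + 1"
    and b0: "b \<in> core_vertices F (m + 1)"
    and R0: "R \<subseteq> core_vertices F (m + 1) - {b}" "card R = r - 1"
    and bR: "\<And>e. e \<in> edges F \<Longrightarrow> b \<in> Old ` e \<Longrightarrow> Old ` e = insert b R"
begin

section \<open>Structure and colourings of the extension\<close>

definition Cv :: "'a core_vertex set" where "Cv = core_vertices F (m + 1)"
definition UP :: "'a core_vertex set set" where "UP = uncovered_pairs F (m + 1)"
definition HH :: "'a ext_vertex hypergraph" where "HH = extension r F (m + 1)"

lemma b: "b \<in> Cv"
  using b0 by (simp add: Cv_def)

lemma R: "R \<subseteq> Cv - {b}" "card R = r - 1"
  using R0 by (simp_all add: Cv_def)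

definition pair_edge :: "'a core_vertex set \<Rightarrow> 'a ext_vertex set" where
  "pair_edge P = Core ` P \<union> Pad P ` {..<r - 2}"

definition X :: "'a ext_vertex set" where "X = verts HH"
definition D :: "'a ext_vertex set set" where "D = edges HH"

lemma HH_eq: "HH = Hypergraph X D"
  by (simp add: X_def D_def)

lemma X_eq: "X = Core ` Cv \<union> (\<Union>P\<in>UP. Pad P ` {..<r - 2})"
  by (simp add: X_def HH_def extension_def Cv_def UP_def)

lemma D_eq: "D = (\<lambda>f. Core ` Old ` f) ` edges F \<union> pair_edge ` UP"
  unfolding D_def HH_def extension_def pair_edge_def UP_def by (simp add: image_comp)

lemma finite_F: "finite (verts F)"
  using rF by (simp add: r_graph_def)

lemma edge_F: "f \<in> edges F \<Longrightarrow> f \<subseteq> verts F" "f \<in> edges F \<Longrightarrow> card f = r"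
  using rF by (auto simp: r_graph_def)

lemma finite_edges_F: "finite (edges F)"
  using finite_F edge_F(1) by (meson PowI finite_Pow_iff finite_subset subsetI)

lemma finite_Cv: "finite Cv"
  using finite_F by (simp add: core_vertices_def Cv_def)

lemma card_Cv: "card Cv = m + 1"
proof -
  have "card Cv = card (Old ` verts F) + card (New ` {card (verts F)<..m + 1} :: 'a core_vertex set)"
    unfolding core_vertices_def Cv_def using finite_F by (intro card_Un_disjoint) auto
  also have "\<dots> = card (verts F) + (m + 1 - card (verts F))"
    by (simp add: card_image inj_on_def)
  finally show ?thesis using cF by simp
qed

lemma card_Cv_b: "card (Cv - {b}) = m"
  using card_Cv finite_Cv b by simp

lemma UP_iff: "P \<in> UP \<longleftrightarrow> (\<exists>u v. P = {u, v} \<and> u \<in> Cv \<and> v \<in> Cv \<and> u \<noteq> v \<and>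
    \<not> (\<exists>e\<in>edges F. u \<in> Old ` e \<and> v \<in> Old ` e))"
  unfolding uncovered_pairs_def UP_def Cv_def by simp

lemma UP_sub: "P \<in> UP \<Longrightarrow> P \<subseteq> Cv" and UP_card: "P \<in> UP \<Longrightarrow> card P = 2"
  by (auto simp: UP_iff)

lemma UP_covered: "P \<in> UP \<Longrightarrow> e \<in> edges F \<Longrightarrow> \<not> P \<subseteq> Old ` e"
  by (auto simp: UP_iff)

lemma finite_UP: "finite UP"
proof -
  have "UP \<subseteq> Pow Cv" using UP_sub by auto
  then show ?thesis using finite_Cv by (meson finite_Pow_iff finite_subset)
qed

lemma finite_X: "finite X"
  using finite_Cv finite_UP by (simp add: X_eq)

lemma finite_D: "finite D"
  using finite_edges_F finite_UP by (simp add: D_eq)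

lemma Old_edge_sub: "f \<in> edges F \<Longrightarrow> Old ` f \<subseteq> Cv"
  using edge_F(1) by (force simp: core_vertices_def Cv_def)

lemma D_cases:
  assumes "e \<in> D"
  obtains f where "f \<in> edges F" "e = Core ` Old ` f" | P where "P \<in> UP" "e = pair_edge P"
  using assms unfolding D_eq by blast

lemma D_sub:
  assumes "e \<in> D"
  shows "e \<subseteq> X"
  using assms
proof (cases rule: D_cases)
  case (1 f)
  then show ?thesis using Old_edge_sub[OF 1(1)] unfolding X_eq by blast
next
  case (2 P)
  then show ?thesis using UP_sub[OF 2(1)] unfolding X_eq pair_edge_def by blast
qed

lemma card_pair_edge: "P \<in> UP \<Longrightarrow> card (pair_edge P) = r"
proof -
  assume P: "P \<in> UP"
  have "card (pair_edge P) = card (Core ` P) + card (Pad P ` {..<r - 2})"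
    unfolding pair_edge_def using UP_sub[OF P] finite_Cv finite_subset
    by (intro card_Un_disjoint) auto
  also have "\<dots> = card P + (r - 2)" by (simp add: card_image inj_on_def)
  finally show ?thesis using UP_card[OF P] r2 by simp
qed

lemma card_D:
  assumes "e \<in> D"
  shows "card e = r"
  using assms
proof (cases rule: D_cases)
  case (1 f)
  have "card (Core ` Old ` f) = card f"
    unfolding image_image by (rule card_image) (simp add: inj_on_def)
  then show ?thesis using 1 edge_F(2) by simp
next
  case (2 P)
  then show ?thesis using card_pair_edge by simp
qed

lemma finite_D_edge: "e \<in> D \<Longrightarrow> finite e"
  using D_sub finite_X finite_subset by blast

lemma Core_pair_edge [simp]: "Core x \<in> pair_edge P \<longleftrightarrow> x \<in> P"
  and Pad_pair_edge [simp]: "Pad Q k \<in> pair_edge P \<longleftrightarrow> Q = P \<and> k < r - 2"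
  by (auto simp: pair_edge_def)

text \<open>\<open>R\<close> has only r - 1 < m of the \<open>m\<close> core vertices other than
  \<open>b\<close>. A vertex \<open>a\<close> outside it shares no edge of \<open>F\<close> with
  \<open>b\<close>, which makes it possible to give both the same colour.\<close>

lemma exists_a: "\<exists>a. a \<in> Cv \<and> a \<noteq> b \<and> a \<notin> R"
proof (rule ccontr)
  assume "\<not> ?thesis"
  then have "Cv - {b} \<subseteq> R" by auto
  moreover have "finite R" using R(1) finite_Cv finite_subset by auto
  ultimately have "m \<le> r - 1" using card_Cv_b R(2) card_mono by metis
  then show False using r2 mr by simp
qed

lemma ab_uncovered:
  assumes "a \<in> Cv" "a \<noteq> b" "a \<notin> R"
  shows "{a, b} \<in> UP"
proof -
  have "\<not> (\<exists>e\<in>edges F. a \<in> Old ` e \<and> b \<in> Old ` e)" using assms bR by blast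
  then show ?thesis unfolding UP_iff using assms b by blast
qed

lemma edge_through_ab:
  assumes "a \<in> Cv" "a \<noteq> b" "a \<notin> R" "e \<in> D" "Core a \<in> e" "Core b \<in> e"
  shows "e = pair_edge {a, b}"
proof -
  from assms(4) show ?thesis
  proof (cases rule: D_cases)
    case (1 f)
    then have "a \<in> Old ` f" "b \<in> Old ` f" using assms by auto
    then show ?thesis using bR[OF 1(1)] assms by blast
  next
    case (2 P)
    then have "{a, b} \<subseteq> P" using assms by auto
    moreover have "card P = 2" "card {a, b} = 2" "finite P"
      using UP_card[OF 2(1)] assms(2) UP_sub[OF 2(1)] finite_Cv finite_subset by auto
    ultimately have "{a, b} = P" using card_subset_eq by metis
    then show ?thesis using 2 by simp
  qed
qed

text \<open>There are m + 1 core vertices but only \<open>m\<close> colours, so \<open>b\<close>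
  repeats the colour of \<open>a\<close>, and only an edge through both fails to be rainbow. The
  ends of a pair use at most two colours, which leaves m - 2 \<ge> r - 2 for its private padding
  vertices.\<close>

lemma ex_colouring:
  assumes a: "a \<in> Cv" "a \<noteq> b" "a \<notin> R" and \<sigma>: "bij_betw \<sigma> (Cv - {b}) {..<m}"
  obtains col where "\<And>x. x \<in> Cv \<Longrightarrow> x \<noteq> b \<Longrightarrow> col (Core x) = \<sigma> x" "col (Core b) = \<sigma> a"
    "\<And>x. x \<in> X \<Longrightarrow> col x < m"
    "\<And>e. e \<in> D \<Longrightarrow> \<not> (Core a \<in> e \<and> Core b \<in> e) \<Longrightarrow> inj_on col e"
proof -
  define \<tau> where "\<tau> = \<sigma>(b := \<sigma> a)"
  have inj: "inj_on \<sigma> (Cv - {b})" and img: "\<sigma> ` (Cv - {b}) = {..<m}"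
    using \<sigma> by (auto simp: bij_betw_def)
  have \<tau>inj: "inj_on \<tau> S" if "S \<subseteq> Cv" "\<not> (a \<in> S \<and> b \<in> S)" for S
  proof (rule inj_onI)
    fix x y assume xy: "x \<in> S" "y \<in> S" "\<tau> x = \<tau> y"
    \<comment> \<open>\<open>f\<close> folds \<open>b\<close> onto \<open>a\<close>, and \<tau> is
      \<sigma> after this folding; on a set that lacks one of the two vertices the folding is
      injective.\<close>
    define f where "f z = (if z = b then a else z)" for z
    have f: "\<tau> z = \<sigma> (f z)" "z \<in> S \<Longrightarrow> f z \<in> Cv - {b}" for z
      using that a by (auto simp: \<tau>_def f_def)
    then have "f x = f y" using xy inj by (metis inj_onD)
    then show "x = y" using xy that by (auto simp: f_def split: if_splits)
  qed
  have \<tau>m: "\<tau> x < m" if "x \<in> Cv" for x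
    using that img a by (auto simp: \<tau>_def)
  have "\<exists>q. inj_on q {..<r - 2} \<and> q ` {..<r - 2} \<subseteq> {..<m} - \<tau> ` P" if "P \<in> UP" for P
  proof -
    have fP: "finite P" using UP_sub[OF that] finite_Cv finite_subset by blast
    have "card (\<tau> ` P) \<le> 2" using card_image_le[OF fP, of \<tau>] UP_card[OF that] by simp
    moreover have "card ({..<m} - \<tau> ` P) \<ge> m - card (\<tau> ` P)"
      using fP by (metis card_lessThan diff_card_le_card_Diff finite_imageI)
    ultimately have "card {..<r - 2} \<le> card ({..<m} - \<tau> ` P)" using mr by simp
    then show ?thesis using inj_on_iff_card_le[of "{..<r - 2}" "{..<m} - \<tau> ` P"] by simp
  qed
  then obtain q where q: "inj_on (q P) {..<r - 2}" "q P ` {..<r - 2} \<subseteq> {..<m} - \<tau> ` P"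
    if "P \<in> UP" for P by metis
  define col where "col x = (case x of Core y \<Rightarrow> \<tau> y | Pad P k \<Rightarrow> q P k)" for x
  show ?thesis
  proof
    show "col (Core x) = \<sigma> x" if "x \<in> Cv" "x \<noteq> b" for x using that by (simp add: col_def \<tau>_def)
    show "col (Core b) = \<sigma> a" by (simp add: col_def \<tau>_def)
    show "col x < m" if "x \<in> X" for x
      using that \<tau>m q(2) unfolding X_eq col_def by fastforce
    show "inj_on col e" if e: "e \<in> D" "\<not> (Core a \<in> e \<and> Core b \<in> e)" for e
    proof -
      from e(1) show ?thesis
      proof (cases rule: D_cases)
        case (1 f)
        then have "inj_on \<tau> (Old ` f)" using e Old_edge_sub by (intro \<tau>inj) auto
        then show ?thesis unfolding 1 by (auto simp: inj_on_def col_def)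
      next
        case (2 P)
        have "inj_on \<tau> P" using 2 e UP_sub by (intro \<tau>inj) auto
        moreover have "q P k \<noteq> \<tau> y" if "k < r - 2" "y \<in> P" for k y
          using q(2)[OF 2(1)] that by auto
        moreover have "inj_on (q P) {..<r - 2}" using q(1)[OF 2(1)] .
        ultimately have "inj_on col (Core ` P)" "inj_on col (Pad P ` {..<r - 2})"
          "col ` (Core ` P) \<inter> col ` (Pad P ` {..<r - 2}) = {}"
          unfolding inj_on_def col_def by (fastforce, fastforce, auto, metis)
        then show ?thesis unfolding 2 pair_edge_def inj_on_Un by blast
      qed
    qed
  qed
qed

definition missing :: "nat set \<Rightarrow> nat set set \<Rightarrow> (nat \<Rightarrow> nat) \<Rightarrow> nat set set" where
  "missing V E c = rainbow r V c - E"

text \<open>Nearly all rainbow sets are edges, but edges need not be rainbow. Every part has at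
  least half its balanced size n / m, so that a positive proportion of all maps respects a given
  colouring.\<close>

definition dense :: "real \<Rightarrow> nat set \<Rightarrow> nat set set \<Rightarrow> (nat \<Rightarrow> nat) \<Rightarrow> bool" where
  "dense \<beta> V E c \<longleftrightarrow> finite V \<and> (\<forall>e\<in>E. e \<subseteq> V \<and> card e = r) \<and> (\<forall>x\<in>V. c x < m) \<and>
     (\<forall>i<m. real (card V) / (2 * real m) \<le> real (card {x\<in>V. c x = i})) \<and>
     real (card (missing V E c)) \<le> \<beta> * real (card V) ^ r"

text \<open>The coefficient of the union bound in \<open>embed_by_counting\<close>: edges, pairs and
  single vertices.\<close>

definition events :: real where
  "events = real (card D + card X * card X + card X)"

lemma events_pos: "events \<ge> 1"
proof -
  have "Core b \<in> X" using b by (simp add: X_eq)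
  then have "card X \<ge> 1" using finite_X by (metis One_nat_def Suc_leI card_gt_0_iff empty_iff)
  then show ?thesis unfolding events_def by (simp only: of_nat_add)
qed

text \<open>For a core vertex \<open>a\<close> outside \<open>R\<close> the pair \<open>{a, b}\<close> is uncovered. Its padded edge is placed on a
  given edge through \<open>u\<close> and \<open>v\<close>, and the remaining vertices, coloured so that all other edges are
  rainbow, are placed by counting.\<close>

lemma no_monochromatic_edge:
  "\<exists>\<beta>>0. \<exists>n0. \<forall>V E c u v. dense \<beta> V E c \<and> n0 \<le> card V \<and> u \<in> V \<and> v \<in> V \<and> u \<noteq> v \<and> c u = c v \<and>
     real (card {e \<in> missing V E c. u \<in> e}) \<le> \<beta> * real (card V) ^ (r - 1) \<and>
     real (card {e \<in> missing V E c. v \<in> e}) \<le> \<beta> * real (card V) ^ (r - 1) \<and>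
     \<not> contains_copy (Hypergraph V E) HH \<longrightarrow> (\<forall>e\<in>E. \<not> (u \<in> e \<and> v \<in> e))"
proof -
  obtain a where a: "a \<in> Cv" "a \<noteq> b" "a \<notin> R" using exists_a by blast
  define T where "T = pair_edge {a, b}"
  have ab: "{a, b} \<in> UP" using ab_uncovered[OF a] .
  have TD: "T \<in> D" using ab by (auto simp: T_def D_eq)
  have m0: "m > 0" using r2 mr by simp
  \<comment> \<open>A lower bound for the proportion of colour-respecting maps: each vertex outside
    \<open>T\<close> has at least n / (2 m) possible images. Below, \<beta> is chosen so that bad
    events consume at most half of them, and \<open>n0\<close> so that
    \<open>card X \<le> \<beta> * n\<close>.\<close>
  define \<kappa> :: real where "\<kappa> = (1 / (2 * real m)) ^ card (X - T)"
  have \<kappa>0: "\<kappa> > 0" using m0 by (simp add: \<kappa>_def)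
  define \<beta> where "\<beta> = \<kappa> / (2 * events)"
  have \<beta>0: "\<beta> > 0" using \<kappa>0 events_pos by (simp add: \<beta>_def)
  define n0 where "n0 = nat \<lceil>real (card X) / \<beta>\<rceil> + 1"
  show ?thesis
  proof (intro exI[of _ \<beta>] conjI exI[of _ n0] allI impI ballI notI; (elim conjE)?)
    show "\<beta> > 0" by fact
    fix V E c u v e
    assume dense: "dense \<beta> V E c" and n0: "n0 \<le> card V" and uv: "u \<in> V" "v \<in> V" "u \<noteq> v" "c u = c v"
      and du: "real (card {e \<in> missing V E c. u \<in> e}) \<le> \<beta> * real (card V) ^ (r - 1)"
      and dv: "real (card {e \<in> missing V E c. v \<in> e}) \<le> \<beta> * real (card V) ^ (r - 1)"
      and free: "\<not> contains_copy (Hypergraph V E) HH" and e: "e \<in> E" "u \<in> e" "v \<in> e"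
    have V: "finite V" and E: "\<And>e. e \<in> E \<Longrightarrow> e \<subseteq> V \<and> card e = r" and cm: "\<And>x. x \<in> V \<Longrightarrow> c x < m"
      and parts: "\<And>i. i < m \<Longrightarrow> real (card V) / (2 * real m) \<le> real (card {x\<in>V. c x = i})"
      and miss: "real (card (missing V E c)) \<le> \<beta> * real (card V) ^ r"
      using dense by (auto simp: dense_def)
    have fm: "finite (missing V E c)" using V by (simp add: missing_def)
    define n where "n = card V"
    have n1: "n \<ge> 1" using n0 by (simp add: n0_def n_def)
    have nX: "real (card X) \<le> \<beta> * real n"
    proof -
      have "real (card X) / \<beta> \<le> real n" using n0 unfolding n0_def n_def by linarith
      then show ?thesis using \<beta>0 by (simp add: divide_le_eq mult.commute)
    qed
    \<comment> \<open>The common colour of \<open>a\<close> and \<open>b\<close> must be that of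
      \<open>u\<close> and \<open>v\<close>, on which they are placed.\<close>
    obtain \<sigma> where \<sigma>: "bij_betw \<sigma> (Cv - {b}) {..<m}" "\<sigma> a = c u"
    proof -
      have "card (Cv - {b} - {a}) = card ({..<m} - {c u})"
        using card_Cv_b a cm[OF uv(1)] finite_Cv by simp
      then obtain \<sigma>0 where \<sigma>0: "bij_betw \<sigma>0 (Cv - {b} - {a}) ({..<m} - {c u})"
        using finite_same_card_bij[of "Cv - {b} - {a}" "{..<m} - {c u}"] finite_Cv by auto
      define \<sigma> where "\<sigma> = \<sigma>0(a := c u)"
      have "bij_betw \<sigma> (Cv - {b} - {a}) ({..<m} - {c u})"
        using \<sigma>0 by (rule bij_betw_cong[THEN iffD1, rotated]) (auto simp: \<sigma>_def)
      moreover have "bij_betw \<sigma> {a} {c u}" by (simp add: \<sigma>_def)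
      ultimately have "bij_betw \<sigma> (Cv - {b} - {a} \<union> {a}) ({..<m} - {c u} \<union> {c u})"
        by (rule bij_betw_combine) auto
      moreover have "Cv - {b} - {a} \<union> {a} = Cv - {b}" using a by auto
      moreover have "{..<m} - {c u} \<union> {c u} = {..<m}" using cm[OF uv(1)] by auto
      ultimately show ?thesis using that[of \<sigma>] by (simp add: \<sigma>_def)
    qed
    obtain col where col: "\<And>x. x \<in> Cv \<Longrightarrow> x \<noteq> b \<Longrightarrow> col (Core x) = \<sigma> x" "col (Core b) = \<sigma> a"
      "\<And>x. x \<in> X \<Longrightarrow> col x < m"
      "\<And>e. e \<in> D \<Longrightarrow> \<not> (Core a \<in> e \<and> Core b \<in> e) \<Longrightarrow> inj_on col e"
      using ex_colouring[OF a \<sigma>(1)] by blast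
    obtain h where h: "bij_betw h (Pad {a, b} ` {..<r - 2}) (e - {u, v})"
    proof -
      have "finite e" using E[OF e(1)] V finite_subset by blast
      then have "card (e - {u, v}) = r - 2" using E[OF e(1)] e uv by (simp add: card_Diff_subset)
      moreover have "card (Pad {a, b} ` {..<r - 2}) = r - 2" by (simp add: card_image inj_on_def)
      ultimately show ?thesis
        using that finite_same_card_bij[of "Pad {a, b} ` {..<r - 2}" "e - {u, v}"] \<open>finite e\<close> by auto
    qed
    define g0 where "g0 x = (if x = Core a then u else if x = Core b then v else h x)" for x
    have Tsplit: "T = insert (Core a) (insert (Core b) (Pad {a, b} ` {..<r - 2}))"
      by (auto simp: T_def pair_edge_def)
    have hpad: "h (Pad {a, b} k) \<in> e - {u, v}" if "k < r - 2" for k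
      using h that by (auto simp: bij_betw_def)
    have g0T: "g0 ` T = e"
    proof -
      have "g0 ` T = insert u (insert v (h ` Pad {a, b} ` {..<r - 2}))"
        unfolding Tsplit using a(2) by (auto simp: g0_def image_image)
      then show ?thesis using h e by (auto simp: bij_betw_def)
    qed
    have "card (g0 ` T) = card T" using g0T E[OF e(1)] card_D[OF TD] by simp
    then have g0inj: "inj_on g0 T" using finite_D_edge[OF TD] by (rule eq_card_imp_inj_on[rotated])
    define \<Omega> where "\<Omega> = PiE (X - T) (\<lambda>x. {y\<in>V. c y = col x})"
    define mrg where "mrg g x = (if x \<in> T then g0 x else g x)" for g :: "'a ext_vertex \<Rightarrow> nat" and x
    define Bad where "Bad e' = (if e' = T then {} else
      {g \<in> PiE (e' - T) (\<lambda>_. V). (\<forall>x\<in>e' - T. c (g x) = col x) \<and> mrg g ` e' \<in> missing V E c})" for e'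
    \<comment> \<open>Padding vertices are private to their edge, so every other edge meets
      \<open>T\<close> in at most one of the two core vertices.\<close>
    have eT: "e' \<inter> T \<subseteq> {Core a, Core b}" "\<not> (Core a \<in> e' \<and> Core b \<in> e')" if "e' \<in> D" "e' \<noteq> T" for e'
    proof -
      show "\<not> (Core a \<in> e' \<and> Core b \<in> e')" using edge_through_ab[OF a that(1)] that(2) T_def by blast
      have "Pad {a, b} k \<notin> e'" for k using that unfolding D_eq T_def by auto
      then show "e' \<inter> T \<subseteq> {Core a, Core b}" unfolding Tsplit by auto
    qed
    have colg: "c (mrg g x) = col x" if "e' \<in> D" "e' \<noteq> T" "x \<in> e'" "x \<in> T \<or> c (g x) = col x" for g e' x
    proof (cases "x \<in> T")
      case True
      then have "x = Core a \<or> x = Core b" using eT[OF that(1,2)] that(3) by blast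
      then show ?thesis using True col(1)[OF a(1,2)] col(2) \<sigma>(2) uv(4) a(2) by (auto simp: mrg_def g0_def)
    next
      case False
      then show ?thesis using that(4) by (simp add: mrg_def)
    qed
    have "contains_copy (Hypergraph V E) (Hypergraph X D)"
    proof (rule embed_by_counting[where T = T and \<phi> = g0 and \<beta> = \<beta> and \<Omega> = \<Omega> and Bad = Bad])
      show "T \<subseteq> X" using D_sub[OF TD] .
      show "g0 ` T \<subseteq> V" using g0T E[OF e(1)] by simp
      show "\<Omega> \<subseteq> PiE (X - T) (\<lambda>_. V)" unfolding \<Omega>_def by (rule PiE_mono) auto
      show "Bad e' \<subseteq> PiE (e' - T) (\<lambda>_. V)" for e' by (auto simp: Bad_def)
      show "real (card X) \<le> \<beta> * real (card V)" using nX by (simp add: n_def)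
      show "(\<lambda>x. if x \<in> T then g0 x else g x) ` e' \<in> E \<or> restrict g (e' - T) \<in> Bad e'"
        if g: "g \<in> \<Omega>" and e': "e' \<in> D" for g e'
      proof (cases "e' = T")
        case True
        then have "(\<lambda>x. if x \<in> T then g0 x else g x) ` e' = g0 ` T" by auto
        then show ?thesis using g0T e by simp
      next
        case False
        have eX: "e' \<subseteq> X" using D_sub[OF e'] .
        have gx: "g x \<in> V" "c (g x) = col x" if "x \<in> e'" "x \<notin> T" for x
          using g that eX by (auto simp: \<Omega>_def)
        have cc: "c (mrg g x) = col x" if "x \<in> e'" for x
          using colg[OF e' False that] gx that by blast
        have "inj_on (c \<circ> mrg g) e'"
          using col(4)[OF e' eT(2)[OF e' False]] cc by (simp cong: inj_on_cong)
        then have i: "inj_on (mrg g) e'" "inj_on c (mrg g ` e')"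
          by (auto dest: inj_on_imageI inj_on_imageI2)
        have "mrg g ` e' \<subseteq> V"
          using gx g0T E[OF e(1)] by (auto simp: mrg_def)
        then have rb: "mrg g ` e' \<in> rainbow r V c"
          using i card_D[OF e'] by (auto simp: rainbow_def card_image)
        show ?thesis
        proof (cases "mrg g ` e' \<in> E")
          case True
          then show ?thesis by (simp add: mrg_def[abs_def])
        next
          case nE: False
          have "mrg (restrict g (e' - T)) ` e' = mrg g ` e'"
            by (rule image_cong) (auto simp: mrg_def)
          then have "restrict g (e' - T) \<in> Bad e'"
            using nE rb False gx by (auto simp: Bad_def missing_def)
          then show ?thesis by blast
        qed
      qed
      show "real (card (Bad e')) \<le> \<beta> * real (card V) ^ card (e' - T)" if e': "e' \<in> D" for e'
      proof (cases "e' = T")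
        case True
        then show ?thesis using \<beta>0 by (simp add: Bad_def)
      next
        case False
        have cnt: "card (Bad e') \<le> card M"
          if M: "finite M" "\<And>g. g \<in> Bad e' \<Longrightarrow> mrg g ` e' \<in> M" for M
        proof (rule card_coloured_maps_le[where F = mrg and col = col and c = c])
          show "inj_on col e'" using col(4)[OF e' eT(2)[OF e' False]] .
          show "c (mrg g x) = col x" if "g \<in> Bad e'" "x \<in> e'" for g x
            using colg[OF e' False that(2)] that False by (auto simp: Bad_def)
          show "g = g'" if "g \<in> Bad e'" "g' \<in> Bad e'" "\<And>x. x \<in> e' \<Longrightarrow> mrg g x = mrg g' x" for g g'
          proof (rule PiE_ext[of g "e' - T" "\<lambda>_. V" g'])
            show "g x = g' x" if "x \<in> e' - T" for x
              using \<open>\<And>x. x \<in> e' \<Longrightarrow> mrg g x = mrg g' x\<close>[of x] that by (simp add: mrg_def)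
          qed (use that False in \<open>auto simp: Bad_def\<close>)
        qed (use M in auto)
        have mm: "mrg g ` e' \<in> missing V E c" if "g \<in> Bad e'" for g
          using that False by (auto simp: Bad_def)
        have cardT: "card (e' - T) = r - card (e' \<inter> T)"
          using card_D[OF e'] finite_D_edge[OF e'] by (metis Diff_Int_distrib2 Diff_Int2 card_Diff_subset_Int finite_Int)
        \<comment> \<open>An edge disjoint from \<open>T\<close> is controlled by the total number
          of missing sets; one through \<open>a\<close> or \<open>b\<close> needs the missing degree
          of \<open>u\<close> or \<open>v\<close>, since one of its vertices is already
          fixed.\<close>
        consider "e' \<inter> T = {}" | "e' \<inter> T = {Core a}" | "e' \<inter> T = {Core b}"
          using eT[OF e' False] by blast
        then show ?thesis
        proof cases
          case 1
          then show ?thesis using cnt[OF fm mm] miss cardT by simp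
        next
          case 2
          then have "u \<in> mrg g ` e'" for g by (auto simp: mrg_def g0_def image_iff intro!: bexI[of _ "Core a"])
          then have "card (Bad e') \<le> card {e \<in> missing V E c. u \<in> e}"
            using fm mm by (intro cnt) auto
          then show ?thesis using du cardT 2 by simp
        next
          case 3
          then have "v \<in> mrg g ` e'" for g using a(2)
            by (auto simp: mrg_def g0_def image_iff intro!: bexI[of _ "Core b"])
          then have "card (Bad e') \<le> card {e \<in> missing V E c. v \<in> e}"
            using fm mm by (intro cnt) auto
          then show ?thesis using dv cardT 3 by simp
        qed
      qed
      show "real (card D + card X * card X + card X) * (\<beta> * real (card V) ^ card (X - T)) < real (card \<Omega>)"
      proof -
        have "card \<Omega> = (\<Prod>x\<in>X - T. card {y\<in>V. c y = col x})"
          unfolding \<Omega>_def using finite_X by (simp add: card_PiE)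
        then have "real (card \<Omega>) = (\<Prod>x\<in>X - T. real (card {y\<in>V. c y = col x}))" by simp
        also have "\<dots> \<ge> (\<Prod>x\<in>X - T. real n / (2 * real m))"
          using parts col(3) by (intro prod_mono) (auto simp: n_def)
        finally have "real (card \<Omega>) \<ge> \<kappa> * real n ^ card (X - T)"
          by (simp add: \<kappa>_def power_divide)
        moreover have "events * (\<beta> * real n ^ card (X - T)) = \<kappa> * real n ^ card (X - T) / 2"
          using events_pos by (simp add: \<beta>_def)
        moreover have "\<kappa> * real n ^ card (X - T) > 0" using \<kappa>0 n1 by simp
        ultimately show ?thesis unfolding events_def n_def by linarith
      qed
    qed (use finite_X finite_D V D_sub g0inj \<beta>0 in auto)
    then show False using free by (simp add: HH_eq)
  qed
qed

end

lemma pigeonhole_UN: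
  fixes \<beta> :: real
  assumes "finite K" "A \<subseteq> (\<Union>k\<in>K. B k)" "\<And>k. k \<in> K \<Longrightarrow> finite (B k)" "real (card K) * \<beta> \<le> real (card A)"
    and "K \<noteq> {}"
  shows "\<exists>k\<in>K. \<beta> \<le> real (card (B k))"
proof (rule ccontr)
  assume "\<not> ?thesis"
  then have lt: "\<And>k. k \<in> K \<Longrightarrow> real (card (B k)) < \<beta>" by auto
  have "card A \<le> card (\<Union>k\<in>K. B k)" using assms by (intro card_mono) auto
  also have "\<dots> \<le> (\<Sum>k\<in>K. card (B k))" using assms(1) by (rule card_UN_le)
  finally have "real (card A) \<le> (\<Sum>k\<in>K. real (card (B k)))" by (simp flip: of_nat_sum)
  also have "\<dots> < (\<Sum>k\<in>K. \<beta>)" using assms lt by (intro sum_strict_mono) auto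
  finally show False using assms(4) by simp
qed

context extension_host
begin

text \<open>Otherwise \<open>b\<close> is placed on \<open>v\<close>. The edges of the extension through \<open>b\<close> partition part of the
  remaining vertices into blocks, and the maps that send these edges to edges through \<open>v\<close> form a
  product over the blocks of positive density.\<close>

lemma vertex_avoids_colour:
  assumes \<beta>0: "\<beta> > 0"
  shows "\<exists>\<gamma>>0. \<exists>n0. \<forall>V E c v. dense \<gamma> V E c \<and> n0 \<le> card V \<and> v \<in> V \<and> \<not> contains_copy (Hypergraph V E) HH \<and>
     \<beta> * real (card V) ^ (r - 1) \<le> real (card {e\<in>E. v \<in> e \<and> inj_on c (e - {v})}) \<longrightarrow>
     (\<exists>i<m. real (card {e\<in>E. v \<in> e \<and> (\<exists>w\<in>e - {v}. c w = i)}) < \<beta> * real (card V) ^ (r - 1))"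
proof -
  obtain a where a: "a \<in> Cv" "a \<noteq> b" "a \<notin> R" using exists_a by blast
  have m0: "m > 0" using r2 mr by simp
  \<comment> \<open>A common lower bound for the densities of the three kinds of blocks: the block
    of \<open>R\<close> (one of 2^m colour sets is selected by pigeonhole), a core vertex with the
    padding of its pair with \<open>b\<close> (density \<beta>), and a single vertex of prescribed
    colour. As \<kappa>0 \<le> 1 and there are at most \<open>card X\<close> blocks, its power
    \<kappa> bounds the product.\<close>
  define \<kappa>0 where "\<kappa>0 = min (\<beta> / 2 ^ m) (1 / (2 * real m))"
  have \<kappa>0: "\<kappa>0 > 0" "\<kappa>0 \<le> 1" "\<kappa>0 \<le> \<beta>" "\<kappa>0 \<le> \<beta> / 2 ^ m" "\<kappa>0 \<le> 1 / (2 * real m)"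
  proof -
    show "\<kappa>0 > 0" using \<beta>0 m0 by (simp add: \<kappa>0_def)
    show *: "\<kappa>0 \<le> \<beta> / 2 ^ m" "\<kappa>0 \<le> 1 / (2 * real m)" by (simp_all add: \<kappa>0_def)
    have "\<beta> / 2 ^ m \<le> \<beta> / 1" using \<beta>0 by (intro divide_left_mono) auto
    then show "\<kappa>0 \<le> \<beta>" using * by simp
    have "1 / (2 * real m) \<le> 1" using m0 by simp
    then show "\<kappa>0 \<le> 1" using * by simp
  qed
  define \<kappa> where "\<kappa> = \<kappa>0 ^ card X"
  have \<kappa>pos: "\<kappa> > 0" using \<kappa>0 by (simp add: \<kappa>_def)
  define \<gamma> where "\<gamma> = \<kappa> / (2 * events)"
  have \<gamma>0: "\<gamma> > 0" using \<kappa>pos events_pos by (simp add: \<gamma>_def)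
  define n0 where "n0 = nat \<lceil>real (card X) / \<gamma>\<rceil> + 1"
  \<comment> \<open>If no edge of \<open>F\<close> contains \<open>b\<close>, then \<open>b\<close>
    forms uncovered pairs with the vertices of \<open>R\<close> too, and these must be treated like
    all others.\<close>
  define R' where "R' = (if \<exists>f\<in>edges F. insert b R = Old ` f then R else {})"
  have R'R: "R' \<subseteq> R" by (auto simp: R'_def)
  have R'sub: "R' \<subseteq> Cv - {b}" using R(1) R'R by blast
  have cardR': "card R' = r - 1" if "R' \<noteq> {}" using that R(2) by (auto simp: R'_def split: if_splits)
  have b_edge: "Old ` f = insert b R'" "R' = R" if "f \<in> edges F" "b \<in> Old ` f" for f
    using bR[OF that] that by (auto simp: R'_def)
  have bx_UP: "{b, x} \<in> UP" if "x \<in> Cv" "x \<noteq> b" "x \<notin> R'" for x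
    unfolding UP_iff using that b b_edge(1) by blast
  have UP_b: "x \<notin> R'" if "{b, x} \<in> UP" for x
    using that UP_covered by (auto simp: R'_def split: if_splits)
  define other where "other P = (THE y. y \<in> P \<and> y \<noteq> b)" for P :: "'a core_vertex set"
  have other: "other {b, x} = x" if "x \<noteq> b" for x
    using that unfolding other_def by (intro the_equality) auto
  have UP_bE: "\<exists>x. P = {b, x} \<and> x \<in> Cv \<and> x \<noteq> b \<and> x \<notin> R'" if PU: "P \<in> UP" and bP: "b \<in> P" for P
  proof -
    from PU obtain u v where uv: "P = {u, v}" "u \<in> Cv" "v \<in> Cv" "u \<noteq> v" unfolding UP_iff by blast
    then obtain x where x: "P = {b, x}" "x \<in> Cv" "x \<noteq> b" using bP by blast
    then show ?thesis using UP_b PU by blast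
  qed
  define T :: "'a ext_vertex set" where "T = {Core b}"
  define I where "I = X - T"
  have fI: "finite I" using finite_X by (simp add: I_def)
  \<comment> \<open>A block is named by one of its vertices, except that \<open>R'\<close> gets the
    name \<open>Core b\<close>, which is free because \<open>b\<close> itself is already placed. A
    core vertex outside \<open>R'\<close> forms a block with the padding of its pair with
    \<open>b\<close>; every other padding vertex is a block of its own.\<close>
  define blk where "blk x = (case x of Core y \<Rightarrow> if y \<in> R' then Core b else Core y
      | Pad P k \<Rightarrow> if b \<in> P then Core (other P) else Pad P k)" for x
  define B where "B k = {x\<in>I. blk x = k}" for k
  have B_R: "B (Core b) = Core ` R'"
  proof (intro set_eqI iffI)
    fix x assume "x \<in> B (Core b)"
    then have x: "x \<in> X" "x \<noteq> Core b" "blk x = Core b" by (auto simp: B_def I_def T_def)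
    show "x \<in> Core ` R'"
    proof (cases x)
      case (Core y)
      then show ?thesis using x by (auto simp: blk_def split: if_splits)
    next
      case (Pad P k)
      then have "P \<in> UP" "b \<in> P" "other P = b" using x by (auto simp: X_eq blk_def split: if_splits)
      then show ?thesis using UP_bE[of P] other by metis
    qed
  qed (use R'sub in \<open>auto simp: B_def I_def T_def blk_def X_eq\<close>)
  have B_x: "B (Core x) = insert (Core x) (Pad {b, x} ` {..<r - 2})"
    if x: "x \<in> Cv" "x \<noteq> b" "x \<notin> R'" for x
  proof (intro set_eqI iffI)
    fix y assume "y \<in> B (Core x)"
    then have y: "y \<in> X" "y \<noteq> Core b" "blk y = Core x" by (auto simp: B_def I_def T_def)
    show "y \<in> insert (Core x) (Pad {b, x} ` {..<r - 2})"
    proof (cases y)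
      case (Core z)
      then show ?thesis using y x by (auto simp: blk_def split: if_splits)
    next
      case (Pad P k)
      then have P: "P \<in> UP" "b \<in> P" "other P = x" "k < r - 2" using y by (auto simp: X_eq blk_def split: if_splits)
      then have "P = {b, x}" using UP_bE[of P] other by metis
      then show ?thesis using Pad P by auto
    qed
  next
    fix y assume "y \<in> insert (Core x) (Pad {b, x} ` {..<r - 2})"
    then show "y \<in> B (Core x)"
      using x bx_UP[OF x] other[OF x(2)] by (auto simp: B_def I_def T_def blk_def X_eq)
  qed
  have B_P: "B (Pad P k) = {Pad P k}" if "Pad P k \<in> I" "b \<notin> P" for P k
  proof (intro set_eqI iffI)
    fix y assume "y \<in> B (Pad P k)"
    then show "y \<in> {Pad P k}" by (cases y) (auto simp: B_def blk_def split: if_splits)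
  qed (use that in \<open>auto simp: B_def blk_def\<close>)
  have card_Bx: "card (B (Core x)) = r - 1" if x: "x \<in> Cv" "x \<noteq> b" "x \<notin> R'" for x
  proof -
    have "card (Pad {b, x} ` {..<r - 2} :: 'a ext_vertex set) = r - 2" by (simp add: card_image inj_on_def)
    then show ?thesis unfolding B_x[OF x] using r2 by (subst card_insert_disjoint) auto
  qed
  have keys: "k \<in> blk ` I \<Longrightarrow> (k = Core b \<and> R' \<noteq> {}) \<or> (\<exists>x. k = Core x \<and> x \<in> Cv \<and> x \<noteq> b \<and> x \<notin> R') \<or>
      (\<exists>P j. k = Pad P j \<and> Pad P j \<in> I \<and> b \<notin> P)" for k
  proof (erule imageE)
    fix y assume y: "k = blk y" "y \<in> I"
    show ?thesis
    proof (cases y)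
      case (Core z)
      then show ?thesis using y by (auto simp: blk_def I_def T_def X_eq)
    next
      case (Pad P j)
      then have "P \<in> UP" using y by (auto simp: I_def X_eq)
      show ?thesis
      proof (cases "b \<in> P")
        case True
        then obtain x where "P = {b, x}" "x \<in> Cv" "x \<noteq> b" "x \<notin> R'" using UP_bE[OF \<open>P \<in> UP\<close>] by blast
        then show ?thesis using y Pad other[of x] by (simp add: blk_def)
      next
        case False
        then show ?thesis using y Pad by (simp add: blk_def)
      qed
    qed
  qed
  show ?thesis
  proof (rule exI[of _ \<gamma>], rule conjI[OF \<gamma>0], rule exI[of _ n0], intro allI impI, elim conjE)
    fix V E c v
    assume dense: "dense \<gamma> V E c" and n0: "n0 \<le> card V" and v: "v \<in> V"
      and free: "\<not> contains_copy (Hypergraph V E) HH"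
      and link: "\<beta> * real (card V) ^ (r - 1) \<le> real (card {e\<in>E. v \<in> e \<and> inj_on c (e - {v})})"
    show "\<exists>i<m. real (card {e\<in>E. v \<in> e \<and> (\<exists>w\<in>e - {v}. c w = i)}) < \<beta> * real (card V) ^ (r - 1)"
    proof (rule ccontr)
      assume "\<not> ?thesis"
      then have hit: "\<beta> * real (card V) ^ (r - 1) \<le> real (card {e\<in>E. v \<in> e \<and> (\<exists>w\<in>e - {v}. c w = i)})"
        if "i < m" for i using that by (meson not_le)
      have V: "finite V" and E: "\<And>e. e \<in> E \<Longrightarrow> e \<subseteq> V \<and> card e = r" and cm: "\<And>x. x \<in> V \<Longrightarrow> c x < m"
        and parts: "\<And>i. i < m \<Longrightarrow> real (card V) / (2 * real m) \<le> real (card {x\<in>V. c x = i})"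
        and miss: "real (card (missing V E c)) \<le> \<gamma> * real (card V) ^ r"
        using dense by (auto simp: dense_def)
      have fm: "finite (missing V E c)" using V by (simp add: missing_def)
      have fE: "finite E"
      proof -
        have "E \<subseteq> Pow V" using E by auto
        then show ?thesis using V by (meson finite_Pow_iff finite_subset)
      qed
      define n where "n = card V"
      have n1: "n \<ge> 1" using n0 by (simp add: n0_def n_def)
      have nX: "real (card X) \<le> \<gamma> * real n"
      proof -
        have "real (card X) / \<gamma> \<le> real n" using n0 unfolding n0_def n_def by linarith
        then show ?thesis using \<gamma>0 by (simp add: divide_le_eq mult.commute)
      qed
      define Lk where "Lk J = {e\<in>E. v \<in> e \<and> inj_on c (e - {v}) \<and> c ` (e - {v}) = J}" for J
      \<comment> \<open>The most frequent colour set among the rainbow link sets of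
        \<open>v\<close>.\<close>
      obtain J where J: "J \<subseteq> {..<m}" "\<beta> / 2 ^ m * real n ^ (r - 1) \<le> real (card (Lk J))"
      proof -
        have "\<exists>J\<in>Pow {..<m}. \<beta> / 2 ^ m * real n ^ (r - 1) \<le> real (card (Lk J))"
        proof (rule pigeonhole_UN[where A = "{e\<in>E. v \<in> e \<and> inj_on c (e - {v})}"])
          show "{e\<in>E. v \<in> e \<and> inj_on c (e - {v})} \<subseteq> (\<Union>J\<in>Pow {..<m}. Lk J)"
            using E cm by (fastforce simp: Lk_def)
          show "finite (Lk J)" for J using fE by (simp add: Lk_def)
          show "real (card (Pow {..<m})) * (\<beta> / 2 ^ m * real n ^ (r - 1))
              \<le> real (card {e\<in>E. v \<in> e \<and> inj_on c (e - {v})})"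
            using link by (simp add: card_Pow n_def)
        qed auto
        then show ?thesis using that by blast
      qed
      have cardJ: "card J = r - 1"
      proof -
        have "\<beta> / 2 ^ m * real n ^ (r - 1) > 0" using \<beta>0 n1 by simp
        then have "card (Lk J) > 0" using J(2) by linarith
        then obtain e where "e \<in> Lk J" by (metis card_gt_0_iff all_not_in_conv)
        then have e: "e \<in> E" "v \<in> e" "inj_on c (e - {v})" "c ` (e - {v}) = J" by (auto simp: Lk_def)
        then have "finite e" using E V finite_subset by blast
        then show ?thesis using e E[OF e(1)] card_image[OF e(3)] by simp
      qed
      \<comment> \<open>\<open>R\<close> receives the colours \<open>J\<close>, so that an edge of
        \<open>F\<close> through \<open>b\<close> can be placed on a link set counted in
        \<open>Lk J\<close> with all colours respected.\<close>
      obtain \<sigma> where \<sigma>: "bij_betw \<sigma> (Cv - {b}) {..<m}" "\<sigma> ` R = J"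
      proof -
        have fR: "finite R" using R(1) finite_Cv finite_subset by auto
        have fJ: "finite J" using J(1) finite_subset by auto
        obtain s1 where s1: "bij_betw s1 R J"
          using finite_same_card_bij[OF fR fJ] R(2) cardJ by auto
        have "card (Cv - {b} - R) = card ({..<m} - J)"
          using R J(1) fR fJ cardJ card_Cv_b by (simp add: card_Diff_subset)
        then obtain s2 where s2: "bij_betw s2 (Cv - {b} - R) ({..<m} - J)"
          using finite_same_card_bij[of "Cv - {b} - R" "{..<m} - J"] finite_Cv by auto
        define s where "s x = (if x \<in> R then s1 x else s2 x)" for x
        have "bij_betw s R J"
          using s1 by (rule bij_betw_cong[THEN iffD1, rotated]) (auto simp: s_def)
        moreover have "bij_betw s (Cv - {b} - R) ({..<m} - J)"
          using s2 by (rule bij_betw_cong[THEN iffD1, rotated]) (auto simp: s_def)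
        ultimately have "bij_betw s (R \<union> (Cv - {b} - R)) (J \<union> ({..<m} - J))"
          by (rule bij_betw_combine) auto
        moreover have "R \<union> (Cv - {b} - R) = Cv - {b}" "J \<union> ({..<m} - J) = {..<m}" using R J(1) by auto
        moreover have "s ` R = J" using \<open>bij_betw s R J\<close> by (simp add: bij_betw_def)
        ultimately show ?thesis using that by metis
      qed
      obtain col where col: "\<And>x. x \<in> Cv \<Longrightarrow> x \<noteq> b \<Longrightarrow> col (Core x) = \<sigma> x" "col (Core b) = \<sigma> a"
        "\<And>x. x \<in> X \<Longrightarrow> col x < m"
        "\<And>e. e \<in> D \<Longrightarrow> \<not> (Core a \<in> e \<and> Core b \<in> e) \<Longrightarrow> inj_on col e"
        using ex_colouring[OF a \<sigma>(1)] by blast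
      \<comment> \<open>In a block attached to \<open>b\<close> only core vertices must respect the
        colouring: the padding of a pair with \<open>b\<close> lies in no other edge. Hence link
        sets hitting the colour of the core vertex suffice, whatever their remaining
        colours.\<close>
      define \<Lambda> where "\<Lambda> k = (case k of
          Core x \<Rightarrow> {h \<in> PiE (B k) (\<lambda>_. V). (\<forall>y\<in>B k \<inter> range Core. c (h y) = col y) \<and> insert v (h ` B k) \<in> E}
        | Pad P j \<Rightarrow> {h \<in> PiE (B k) (\<lambda>_. V). \<forall>y\<in>B k. c (h y) = col y})" for k
      have \<Lambda>sub: "\<Lambda> k \<subseteq> PiE (B k) (\<lambda>_. V)" for k by (cases k) (auto simp: \<Lambda>_def)
      have fB: "finite (B k)" for k using fI by (simp add: B_def)
      have fin_link: "finite (e - {v})" "e - {v} \<subseteq> V" "card (e - {v}) = r - 1" "insert v (e - {v}) = e"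
        if "e \<in> E" "v \<in> e" for e
        using that E[OF that(1)] V finite_subset by auto
      have inj_link: "inj_on (\<lambda>e. e - {v}) {e\<in>E. v \<in> e \<and> Q e}" for Q
        by (rule inj_onI) (metis (no_types, lifting) insert_Diff mem_Collect_eq)
      have \<Lambda>_ge: "\<kappa>0 * real n ^ card (B k) \<le> real (card (\<Lambda> k))" if kI: "k \<in> blk ` I" for k
      proof -
        consider "k = Core b" "R' \<noteq> {}" | x where "k = Core x" "x \<in> Cv" "x \<noteq> b" "x \<notin> R'"
          | P j where "k = Pad P j" "Pad P j \<in> I" "b \<notin> P"
          using keys[OF kI] by blast
        then show ?thesis
        proof cases
          case 1
          have RR: "R' = R" using 1(2) by (auto simp: R'_def split: if_splits)
          have "card ((\<lambda>e. e - {v}) ` Lk J) \<le> card (\<Lambda> k)"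
          proof (rule card_maps_onto_ge[where B = "B k" and V = V])
            fix s assume "s \<in> (\<lambda>e. e - {v}) ` Lk J"
            then obtain e where e: "e \<in> E" "v \<in> e" "inj_on c (e - {v})" "c ` (e - {v}) = J" "s = e - {v}"
              by (auto simp: Lk_def)
            have "bij_betw (the_inv_into s c) J s"
              using e by (metis bij_betw_the_inv_into inj_on_imp_bij_betw)
            moreover have "bij_betw col (B k) J"
            proof -
              have "bij_betw \<sigma> R J" using \<sigma> R(1) by (metis bij_betw_subset)
              moreover have "bij_betw (\<lambda>x. case x of Core y \<Rightarrow> y | Pad P j \<Rightarrow> b) (B k) R"
                unfolding 1 B_R RR by (auto simp: bij_betw_def inj_on_def image_image)
              ultimately have "bij_betw (\<sigma> \<circ> (\<lambda>x. case x of Core y \<Rightarrow> y | Pad P j \<Rightarrow> b)) (B k) J"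
                by (rule bij_betw_trans[rotated])
              then show ?thesis
                by (rule bij_betw_cong[THEN iffD1, rotated]) (use R(1) col(1) in \<open>force simp: 1 B_R RR\<close>)
            qed
            ultimately have bij: "bij_betw (the_inv_into s c \<circ> col) (B k) s" by (rule bij_betw_trans[rotated])
            define h where "h = restrict (the_inv_into s c \<circ> col) (B k)"
            have hB: "h ` B k = s" using bij by (simp add: h_def bij_betw_def)
            have "c (h y) = col y" if "y \<in> B k" for y
            proof -
              have "col y \<in> c ` s" using \<open>bij_betw col (B k) J\<close> that e by (auto simp: bij_betw_def)
              then show ?thesis using f_the_inv_into_f[of c s "col y"] e that by (simp add: h_def)
            qed
            moreover have "h y \<in> V" if "y \<in> B k" for y
              using hB fin_link(2)[OF e(1,2)] e(5) that by blast
            moreover have "h \<in> extensional (B k)" by (simp add: h_def)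
            ultimately have "h \<in> PiE (B k) (\<lambda>_. V)" "\<forall>y\<in>B k. c (h y) = col y" by (auto simp: PiE_def)
            then have "h \<in> \<Lambda> k" using hB e fin_link[OF e(1,2)] 1 by (simp add: \<Lambda>_def)
            then show "\<exists>h\<in>\<Lambda> k. h ` B k = s" using hB by blast
          qed (use fB V \<Lambda>sub in auto)
          moreover have "card ((\<lambda>e. e - {v}) ` Lk J) = card (Lk J)"
            using inj_link unfolding Lk_def by (rule card_image)
          ultimately have "real (card (Lk J)) \<le> real (card (\<Lambda> k))" by simp
          moreover have "card (B k) = r - 1" unfolding 1 B_R using cardR'[OF 1(2)]
            by (simp add: card_image inj_on_def)
          moreover have "\<kappa>0 * real n ^ (r - 1) \<le> \<beta> / 2 ^ m * real n ^ (r - 1)"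
            using \<kappa>0(4) by (rule mult_right_mono) simp
          ultimately show ?thesis using J(2) by simp
        next
          case 2
          define i where "i = col (Core x)"
          have im: "i < m" using col(3) 2(2) by (simp add: i_def X_eq)
          let ?L = "{e\<in>E. v \<in> e \<and> (\<exists>w\<in>e - {v}. c w = i)}"
          have Bk: "B k = insert (Core x) (Pad {b, x} ` {..<r - 2})" using B_x 2 by simp
          have "card ((\<lambda>e. e - {v}) ` ?L) \<le> card (\<Lambda> k)"
          proof (rule card_maps_onto_ge[where B = "B k" and V = V])
            fix s assume "s \<in> (\<lambda>e. e - {v}) ` ?L"
            then obtain e w where e: "e \<in> E" "v \<in> e" "s = e - {v}" "w \<in> s" "c w = i" by auto
            have "card (s - {w}) = r - 2" "finite (s - {w})"
              using fin_link[OF e(1,2)] e by auto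
            moreover have "card (Pad {b, x} ` {..<r - 2} :: 'a ext_vertex set) = r - 2"
              by (simp add: card_image inj_on_def)
            ultimately obtain h0 where h0: "bij_betw h0 (Pad {b, x} ` {..<r - 2}) (s - {w})"
              using finite_same_card_bij[of "Pad {b, x} ` {..<r - 2}" "s - {w}"] by auto
            define h where "h = restrict (\<lambda>y. if y = Core x then w else h0 y) (B k)"
            have hB: "h ` B k = s"
            proof -
              have "h ` B k = insert w (h0 ` (Pad {b, x} ` {..<r - 2}))"
                unfolding h_def image_restrict_eq Bk by (auto simp: image_image)
              also have "\<dots> = s" using h0 e(4) by (auto simp: bij_betw_def)
              finally show ?thesis .
            qed
            have "h y \<in> V" if "y \<in> B k" for y
              using hB fin_link(2)[OF e(1,2)] e(3) that by blast
            moreover have "h \<in> extensional (B k)" by (simp add: h_def)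
            ultimately have "h \<in> PiE (B k) (\<lambda>_. V)" by (auto simp: PiE_def)
            moreover have "c (h y) = col y" if "y \<in> B k \<inter> range Core" for y
              using that e(5) by (auto simp: h_def Bk i_def)
            ultimately have "h \<in> \<Lambda> k" using hB e fin_link[OF e(1,2)] 2 by (simp add: \<Lambda>_def)
            then show "\<exists>h\<in>\<Lambda> k. h ` B k = s" using hB by blast
          qed (use fB V \<Lambda>sub in auto)
          moreover have "card ((\<lambda>e. e - {v}) ` ?L) = card ?L"
            using inj_link by (rule card_image)
          ultimately have "real (card ?L) \<le> real (card (\<Lambda> k))" by simp
          moreover have "card (B k) = r - 1" using card_Bx 2 by simp
          moreover have "\<kappa>0 * real n ^ (r - 1) \<le> \<beta> * real n ^ (r - 1)"
            using \<kappa>0(3) by (rule mult_right_mono) simp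
          ultimately show ?thesis using hit[OF im] by (simp add: n_def)
        next
          case 3
          have Bk: "B k = {Pad P j}" using B_P 3 by simp
          have "\<Lambda> k = PiE (B k) (\<lambda>y. {z\<in>V. c z = col y})"
            unfolding 3 \<Lambda>_def by (auto simp: PiE_def Pi_def)
          then have "card (\<Lambda> k) = card {z\<in>V. c z = col (Pad P j)}" by (simp add: Bk card_PiE)
          moreover have "col (Pad P j) < m" using col(3) 3 by (simp add: I_def)
          ultimately have "real n / (2 * real m) \<le> real (card (\<Lambda> k))" using parts by (simp add: n_def)
          moreover have "\<kappa>0 * real n \<le> 1 / (2 * real m) * real n"
            using \<kappa>0(5) by (rule mult_right_mono) simp
          ultimately show ?thesis by (simp add: Bk)
        qed
      qed
      define \<Omega> where "\<Omega> = {g \<in> PiE I (\<lambda>_. V). \<forall>k\<in>blk ` I. restrict g (B k) \<in> \<Lambda> k}"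
      have \<Omega>_ge: "\<kappa> * real n ^ card I \<le> real (card \<Omega>)"
      proof -
        have "(\<Prod>k\<in>blk ` I. card (\<Lambda> k)) \<le> card \<Omega>"
          unfolding \<Omega>_def B_def by (rule card_blocks_ge) (use fI V \<Lambda>sub in \<open>auto simp: B_def\<close>)
        then have "(\<Prod>k\<in>blk ` I. real (card (\<Lambda> k))) \<le> real (card \<Omega>)" by (simp flip: of_nat_prod)
        moreover have "(\<Prod>k\<in>blk ` I. \<kappa>0 * real n ^ card (B k)) \<le> (\<Prod>k\<in>blk ` I. real (card (\<Lambda> k)))"
          using \<Lambda>_ge \<kappa>0(1) by (intro prod_mono) auto
        moreover have "(\<Prod>k\<in>blk ` I. \<kappa>0 * real n ^ card (B k)) = \<kappa>0 ^ card (blk ` I) * real n ^ card I"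
        proof -
          have "(\<Sum>k\<in>blk ` I. card (B k)) = card I"
            unfolding B_def using fI by (intro sum_card_fibres) auto
          then show ?thesis by (simp add: prod.distrib flip: power_sum)
        qed
        moreover have "\<kappa> \<le> \<kappa>0 ^ card (blk ` I)"
        proof -
          have "card (blk ` I) \<le> card I" using fI by (rule card_image_le)
          also have "\<dots> \<le> card X" unfolding I_def using finite_X by (intro card_mono) auto
          finally show ?thesis unfolding \<kappa>_def using \<kappa>0 by (intro power_decreasing) auto
        qed
        then have "\<kappa> * real n ^ card I \<le> \<kappa>0 ^ card (blk ` I) * real n ^ card I"
          by (rule mult_right_mono) simp
        ultimately show ?thesis by linarith
      qed
      \<comment> \<open>Edges through \<open>b\<close> never fail, because \<Lambda> sends their
        blocks to link sets of \<open>v\<close>.\<close>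
      define Bad where "Bad e = (if Core b \<in> e then {} else
        {g \<in> PiE (e - T) (\<lambda>_. V). (\<forall>x\<in>e. c (g x) = col x) \<and> g ` e \<in> missing V E c})" for e
      have "contains_copy (Hypergraph V E) (Hypergraph X D)"
      proof (rule embed_by_counting[where T = T and \<phi> = "\<lambda>_. v" and \<beta> = \<gamma> and \<Omega> = \<Omega> and Bad = Bad])
        show "T \<subseteq> X" using b by (simp add: T_def X_eq)
        show "(\<lambda>_. v) ` T \<subseteq> V" using v by auto
        show "\<Omega> \<subseteq> PiE (X - T) (\<lambda>_. V)" by (auto simp: \<Omega>_def I_def)
        show "Bad e \<subseteq> PiE (e - T) (\<lambda>_. V)" for e by (auto simp: Bad_def)
        show "real (card X) \<le> \<gamma> * real (card V)" using nX by (simp add: n_def)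
        show "(\<lambda>x. if x \<in> T then v else g x) ` e \<in> E \<or> restrict g (e - T) \<in> Bad e"
          if g: "g \<in> \<Omega>" and e: "e \<in> D" for g e
        proof -
          let ?f = "\<lambda>x. if x \<in> T then v else g x"
          have gB: "restrict g (B k) \<in> \<Lambda> k" if "k \<in> blk ` I" for k
            using g that by (auto simp: \<Omega>_def)
          have core: "insert v (g ` B (Core x)) \<in> E" if "Core x \<in> blk ` I" for x
            using gB[OF that] by (simp add: \<Lambda>_def)
          have c_core: "c (g (Core x)) = col (Core x)" if "Core x \<in> I" for x
          proof -
            obtain y where y: "blk (Core x) = Core y" by (cases "x \<in> R'") (simp_all add: blk_def)
            have "Core x \<in> B (Core y)" using that y by (simp add: B_def)
            moreover have "Core y \<in> blk ` I" using that y by (metis imageI)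
            ultimately show ?thesis using gB[of "Core y"] by (auto simp: \<Lambda>_def)
          qed
          have c_pad: "c (g (Pad P k)) = col (Pad P k)" if "Pad P k \<in> I" "b \<notin> P" for P k
          proof -
            have "blk (Pad P k) = Pad P k" using that by (simp add: blk_def)
            then have "Pad P k \<in> blk ` I" using that(1) by (metis imageI)
            then show ?thesis using gB[of "Pad P k"] B_P[OF that] by (simp add: \<Lambda>_def)
          qed
          show ?thesis
          proof (cases "Core b \<in> e")
            case True
            have "?f ` e \<in> E"
              using e
            proof (cases rule: D_cases)
              case (1 f)
              then have f: "b \<in> Old ` f" using True by auto
              have "R' = R" using b_edge[OF 1(1) f] by simp
              then have "R' \<noteq> {}" using R(2) r2 by auto
              then obtain y where y: "y \<in> R'" by blast
              then have "Core y \<in> I" using R'sub by (auto simp: I_def T_def X_eq)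
              moreover have "blk (Core y) = Core b" using y by (simp add: blk_def)
              ultimately have "Core b \<in> blk ` I" by (metis imageI)
              then have "insert v (g ` Core ` R') \<in> E" using core B_R by metis
              moreover have "?f ` e = insert v (g ` Core ` R')"
                unfolding 1 b_edge(1)[OF 1(1) f] T_def using R'sub by (auto simp: image_image)
              ultimately show ?thesis by simp
            next
              case (2 P)
              then have "b \<in> P" using True by simp
              then obtain x where x: "P = {b, x}" "x \<in> Cv" "x \<noteq> b" "x \<notin> R'" using UP_bE[OF 2(1)] by blast
              then have "Core x \<in> I" by (auto simp: I_def T_def X_eq)
              moreover have "blk (Core x) = Core x" using x by (simp add: blk_def)
              ultimately have "Core x \<in> blk ` I" by (metis imageI)
              then have "insert v (g ` B (Core x)) \<in> E" by (rule core)
              moreover have "?f ` e = insert v (g ` B (Core x))"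
                unfolding 2 B_x[OF x(2-4)] T_def x(1) pair_edge_def using x(3) by (auto simp: image_image)
              ultimately show ?thesis by simp
            qed
            then show ?thesis by simp
          next
            case False
            then have eT: "e - T = e" by (auto simp: T_def)
            have eI: "e \<subseteq> I" using D_sub[OF e] eT by (auto simp: I_def)
            have cc: "c (g x) = col x" if "x \<in> e" for x
            proof (cases x)
              case (Core y)
              then show ?thesis using c_core eI that by auto
            next
              case (Pad P k)
              from e have "b \<notin> P"
              proof (cases rule: D_cases)
                case (1 f)
                then show ?thesis using that Pad by auto
              next
                case (2 Q)
                then have "Q = P" using that Pad by simp
                then show ?thesis using False 2 by simp
              qed
              then show ?thesis using c_pad eI that Pad by auto
            qed
            have gV: "g ` e \<subseteq> V" using g eI by (auto simp: \<Omega>_def)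
            have "inj_on (c \<circ> g) e"
              using col(4)[OF e] False cc by (simp cong: inj_on_cong)
            then have "inj_on g e" "inj_on c (g ` e)"
              by (auto dest: inj_on_imageI inj_on_imageI2)
            then have rb: "g ` e \<in> rainbow r V c"
              using gV card_D[OF e] by (auto simp: rainbow_def card_image)
            have fe: "?f ` e = g ` e" using False by (intro image_cong) (auto simp: T_def)
            show ?thesis
            proof (cases "g ` e \<in> E")
              case True
              then show ?thesis using fe by simp
            next
              case nE: False
              have "restrict g e ` e = g ` e" by simp
              then have "restrict g (e - T) \<in> Bad e"
                using nE rb False cc gV unfolding Bad_def eT missing_def by auto
              then show ?thesis by blast
            qed
          qed
        qed
        show "real (card (Bad e)) \<le> \<gamma> * real (card V) ^ card (e - T)" if e: "e \<in> D" for e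
        proof (cases "Core b \<in> e")
          case True
          then show ?thesis using \<gamma>0 by (simp add: Bad_def)
        next
          case False
          then have eT: "e - T = e" by (auto simp: T_def)
          have "card (Bad e) \<le> card (missing V E c)"
          proof (rule card_coloured_maps_le[where F = "\<lambda>g. g" and col = col and c = c])
            show "inj_on col e" using col(4)[OF e] False by simp
            show "g = g'" if "g \<in> Bad e" "g' \<in> Bad e" "\<And>x. x \<in> e \<Longrightarrow> g x = g' x" for g g'
              by (rule PiE_ext[of g e "\<lambda>_. V" g']) (use that False eT in \<open>auto simp: Bad_def\<close>)
          qed (use fm False in \<open>auto simp: Bad_def\<close>)
          then show ?thesis using miss card_D[OF e] eT by simp
        qed
        show "real (card D + card X * card X + card X) * (\<gamma> * real (card V) ^ card (X - T)) < real (card \<Omega>)"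
        proof -
          have "events * (\<gamma> * real n ^ card I) = \<kappa> * real n ^ card I / 2"
            using events_pos by (simp add: \<gamma>_def)
          moreover have "\<kappa> * real n ^ card I > 0" using \<kappa>pos n1 by simp
          ultimately show ?thesis using \<Omega>_ge unfolding events_def n_def I_def by linarith
        qed
        show "inj_on (\<lambda>_. v) T" by (simp add: T_def)
        show "0 \<le> \<gamma>" using \<gamma>0 by simp
      qed (use finite_X finite_D V D_sub in auto)
      then show False using free by (simp add: HH_eq)
    qed
  qed
qed

end

section \<open>Vertices of large degree\<close>

lemma sum_degrees:
  assumes "finite V" "finite E" "\<And>e. e \<in> E \<Longrightarrow> e \<subseteq> V \<and> card e = r"
  shows "(\<Sum>v\<in>V. card {e\<in>E. v \<in> e}) = r * card E"
proof -
  have "(\<Sum>v\<in>V. card {e\<in>E. v \<in> e}) = (\<Sum>v\<in>V. \<Sum>e\<in>E. if v \<in> e then 1 else 0)"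
    using assms(2) by (intro sum.cong) (auto simp: sum.If_cases Int_def)
  also have "\<dots> = (\<Sum>e\<in>E. \<Sum>v\<in>V. if v \<in> e then 1 else 0)" by (rule sum.swap)
  also have "\<dots> = (\<Sum>e\<in>E. card e)"
  proof (rule sum.cong[OF refl])
    fix e assume "e \<in> E"
    then have "V \<inter> {v. v \<in> e} = e" using assms(3) by auto
    then show "(\<Sum>v\<in>V. if v \<in> e then 1 else 0) = card e"
      using assms(1) by (simp add: sum.If_cases)
  qed
  also have "\<dots> = r * card E" using assms(3) by simp
  finally show ?thesis .
qed

lemma card_edges_hitting_le:
  assumes "finite V" "finite Z" "\<And>e. e \<in> E \<Longrightarrow> e \<subseteq> V \<and> card e = r"
  shows "card {e\<in>E. e \<inter> Z \<noteq> {}} \<le> card Z * card V ^ (r - 1)"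
proof -
  have "card {e\<in>E. e \<inter> Z \<noteq> {}} \<le> card (\<Union>z\<in>Z. {e. e \<subseteq> V \<and> card e = r \<and> {z} \<subseteq> e})"
    using assms by (intro card_mono) auto
  also have "\<dots> \<le> (\<Sum>z\<in>Z. card {e. e \<subseteq> V \<and> card e = r \<and> {z} \<subseteq> e})"
    using assms(2) by (rule card_UN_le)
  also have "\<dots> \<le> (\<Sum>z\<in>Z. card V ^ (r - 1))"
  proof (rule sum_mono)
    fix z
    show "card {e. e \<subseteq> V \<and> card e = r \<and> {z} \<subseteq> e} \<le> card V ^ (r - 1)"
      using card_supersets_le[OF assms(1), of "{z}" r] by simp
  qed
  finally show ?thesis by simp
qed

lemma card_edges_at_hitting_le:
  assumes "finite V" "finite Z" "v \<notin> Z" "\<And>e. e \<in> E \<Longrightarrow> e \<subseteq> V \<and> card e = r"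
  shows "card {e\<in>E. v \<in> e \<and> e \<inter> Z \<noteq> {}} \<le> card Z * card V ^ (r - 2)"
proof -
  have "card {e\<in>E. v \<in> e \<and> e \<inter> Z \<noteq> {}} \<le> card (\<Union>z\<in>Z. {e. e \<subseteq> V \<and> card e = r \<and> {v, z} \<subseteq> e})"
    using assms by (intro card_mono) auto
  also have "\<dots> \<le> (\<Sum>z\<in>Z. card {e. e \<subseteq> V \<and> card e = r \<and> {v, z} \<subseteq> e})"
    using assms(2) by (rule card_UN_le)
  also have "\<dots> \<le> (\<Sum>z\<in>Z. card V ^ (r - 2))"
  proof (rule sum_mono)
    fix z assume "z \<in> Z"
    then have "v \<noteq> z" using assms(3) by blast
    then have "card {v, z} = 2" by simp
    then show "card {e. e \<subseteq> V \<and> card e = r \<and> {v, z} \<subseteq> e} \<le> card V ^ (r - 2)"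
      using card_supersets_le[OF assms(1), of "{v, z}" r] by simp
  qed
  finally show ?thesis by simp
qed

lemma binomial_degree:
  fixes m r :: nat
  assumes "r > 0" "m > 0"
  shows "real r * (real (m choose r) / real m ^ r) = real (m - 1 choose (r - 1)) / real m ^ (r - 1)"
proof -
  obtain k where k: "r = Suc k" using assms by (cases r) auto
  have "r * (m choose r) = m * (m - 1 choose (r - 1))" using binomial_absorption[of k m] k by simp
  then have "real r * real (m choose r) = real m * real (m - 1 choose (r - 1))" by (metis of_nat_mult)
  then show ?thesis using assms(2) k by (simp add: field_simps)
qed

text \<open>Contraposition of \<open>esym_stability\<close> for the relative part sizes: a part that
  is off by \<eta> costs a factor 1 + \<open>s\<close>.\<close>

lemma parts_balanced:
  assumes "r \<ge> 2" "m \<ge> r" "\<eta> > 0"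
  shows "\<exists>\<gamma>>0. \<forall>V (c :: 'v \<Rightarrow> nat). finite V \<and> V \<noteq> {} \<and> (\<forall>x\<in>V. c x < m) \<and>
     (real (m choose r) / real m ^ r - \<gamma>) * real (card V) ^ r \<le> real (card (rainbow r V c)) \<longrightarrow>
     (\<forall>i<m. \<bar>real (card {x\<in>V. c x = i}) - real (card V) / real m\<bar> \<le> \<eta> * real (card V))"
proof -
  define A where "A = real (m choose r) / real m ^ r"
  define s where "s = \<eta>\<^sup>2 / 16"
  \<comment> \<open>Half of the critical loss: then (A - \<gamma>) (1 + s) = A + A s / 2, which
    exceeds A.\<close>
  define \<gamma> where "\<gamma> = A * s / (2 * (1 + s))"
  have A0: "A > 0" using assms by (simp add: A_def)
  have s0: "s > 0" using assms by (simp add: s_def)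
  have \<gamma>0: "\<gamma> > 0" using A0 s0 by (simp add: \<gamma>_def)
  have \<gamma>s: "\<gamma> * (1 + s) = A * s / 2" using s0 by (simp add: \<gamma>_def field_simps)
  show ?thesis
    unfolding A_def[symmetric]
  proof (rule exI[of _ \<gamma>], rule conjI[OF \<gamma>0], intro allI impI, elim conjE, rule ccontr)
    fix V and c :: "'v \<Rightarrow> nat" and i
    assume V: "finite V" "V \<noteq> {}" and c: "\<forall>x\<in>V. c x < m" and i: "i < m"
      and large: "(A - \<gamma>) * real (card V) ^ r \<le> real (card (rainbow r V c))"
      and far: "\<not> \<bar>real (card {x\<in>V. c x = i}) - real (card V) / real m\<bar> \<le> \<eta> * real (card V)"
    define n where "n = real (card V)"
    have n0: "n > 0" using V by (simp add: n_def card_gt_0_iff)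
    define x where "x i = real (card {x\<in>V. c x = i}) / n" for i
    have cV: "c ` V \<subseteq> {..<m}" using c by auto
    have "(\<Sum>i<m. real (card {x\<in>V. c x = i})) = n"
      using sum_card_fibres[OF V(1) finite_lessThan cV] by (simp add: n_def flip: of_nat_sum)
    then have sx: "sum x {..<m} = 1" using n0 by (simp add: x_def flip: sum_divide_distrib)
    have "real (card {x\<in>V. c x = i}) - real (card V) / real m = n * (x i - 1 / real m)"
      using n0 by (simp add: x_def n_def right_diff_distrib)
    then have "n * \<bar>x i - 1 / real m\<bar> > \<eta> * n" using far n0 by (simp add: abs_mult n_def)
    then have "\<bar>x i - 1 / real m\<bar> > \<eta>" using n0 by (simp add: mult.commute)
    then have "esym r {..<m} x * (1 + s) \<le> A"
      unfolding s_def A_def using assms i sx n0 by (intro esym_stability[where k = i]) (auto simp: x_def)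
    moreover have "n ^ r * esym r {..<m} x = real (card (rainbow r V c))"
      using n0 by (simp add: x_def card_rainbow[OF V(1) finite_lessThan cV] flip: esym_scale)
    then have "n ^ r * (A - \<gamma>) \<le> n ^ r * esym r {..<m} x" using large by (simp add: n_def mult.commute)
    then have "A - \<gamma> \<le> esym r {..<m} x" using n0 by simp
    then have "(A - \<gamma>) * (1 + s) \<le> esym r {..<m} x * (1 + s)" using s0 by (intro mult_right_mono) auto
    ultimately have "(A - \<gamma>) * (1 + s) \<le> A" by linarith
    then have "A * s \<le> A * s / 2" using \<gamma>s by (simp add: algebra_simps)
    then show False using A0 s0 by simp
  qed
qed

text \<open>Outside one of \<open>m\<close> nearly balanced parts there remains a fraction of at
  most 1 - 1/m + \<eta> of the vertices, spread over m - 1 colours. For \<eta> = 0 the Maclaurin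
  bound for their rainbow k-sets is the degree density of the balanced graph; continuity does the
  rest.\<close>

lemma missing_colour_bound:
  assumes "m \<ge> 2" "\<epsilon> > 0" "\<delta> > 0"
  shows "\<exists>\<eta>>0. \<eta> \<le> \<delta> \<and>
    real (m - 1 choose k) * ((1 - 1 / real m + \<eta>) / real (m - 1)) ^ k \<le> real (m - 1 choose k) / real m ^ k + \<epsilon>"
proof -
  let ?f = "\<lambda>\<eta>::real. real (m - 1 choose k) * ((1 - 1 / real m + \<eta>) / real (m - 1)) ^ k"
  have m1: "real (m - 1) = real m - 1" using assms by (simp add: of_nat_diff)
  have "(1 - 1 / real m) / real (m - 1) = 1 / real m"
    using assms m1 by (simp add: field_simps)
  then have f0: "?f 0 = real (m - 1 choose k) / real m ^ k"
    by (simp add: power_divide)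
  have "isCont ?f 0" by (intro continuous_intros) (use assms in auto)
  then have "?f \<midarrow>0\<rightarrow> ?f 0" by (simp only: isCont_def)
  from LIM_D[OF this assms(2)]
  obtain d where d: "d > 0" "\<And>x. x \<noteq> 0 \<Longrightarrow> \<bar>x - 0\<bar> < d \<Longrightarrow> \<bar>?f x - ?f 0\<bar> < \<epsilon>"
    unfolding real_norm_def by blast
  define \<eta> where "\<eta> = min \<delta> (d / 2)"
  have "\<eta> > 0" "\<eta> \<le> \<delta>" "\<bar>\<eta> - 0\<bar> < d" using d assms by (auto simp: \<eta>_def)
  moreover from this have "\<bar>?f \<eta> - ?f 0\<bar> < \<epsilon>" by (intro d(2)) auto
  then have "?f \<eta> \<le> real (m - 1 choose k) / real m ^ k + \<epsilon>" unfolding f0 by linarith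
  ultimately show ?thesis by blast
qed

context extension_host
begin

text \<open>\<open>A\<close> times n^r and \<open>A'\<close> times n^(r-1) are the leading terms of
  the number of edges and of the degrees in the Turan graph.\<close>

definition A :: real where "A = real (m choose r) / real m ^ r"
definition A' :: real where "A' = real (m - 1 choose (r - 1)) / real m ^ (r - 1)"

lemma A_pos: "A > 0" and A'_pos: "A' > 0"
  using mr r2 by (auto simp: A_def A'_def)

lemma A'_eq: "A' = real r * A"
  using binomial_degree[of r m] mr r2 by (simp add: A_def A'_def)

lemma card_rainbow_A:
  assumes "finite V" "\<And>x. x \<in> V \<Longrightarrow> c x < m"
  shows "real (card (rainbow r V c)) \<le> A * real (card V) ^ r"
proof -
  have "0 \<in> {..<m}" using mr r2 by simp
  then have "c ` V \<subseteq> {..<m}" "{..<m} \<noteq> {}" using assms(2) by auto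
  then show ?thesis
    using card_rainbow_le[of V "{..<m}" c r] assms(1) by (simp add: A_def power_divide)
qed

text \<open>Few vertices lie in many missing sets. Such a vertex, if its degree is large, has few
  edges meeting some colour and is moved to that part. Its edges then nearly exhaust the rainbow
  sets avoiding the colour, so few sets are missing at it any more, and
  \<open>no_monochromatic_edge\<close> applies to all pairs of large-degree vertices. Vertices of
  low degree are tolerated but nothing is claimed about edges through them, which is the form that
  survives symmetrization.\<close>

lemma large_degree_multipartite:
  "\<exists>\<gamma>>0. \<exists>n0. \<forall>V (E :: nat set set) c. finite V \<and> (\<forall>e\<in>E. e \<subseteq> V \<and> card e = r) \<and> n0 \<le> card V \<and> (\<forall>x\<in>V. c x < m) \<and>
     (A - \<gamma>) * real (card V) ^ r \<le> real (card (rainbow r V c \<inter> E)) \<and> \<not> contains_copy (Hypergraph V E) HH \<longrightarrow>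
     (\<exists>c'. (\<forall>x\<in>V. c' x < m) \<and>
       (\<forall>e\<in>E. (\<forall>v\<in>e. (A' - \<gamma>) * real (card V) ^ (r - 1) \<le> real (card {e\<in>E. v \<in> e})) \<longrightarrow> inj_on c' e))"
proof -
  have m2: "m \<ge> 2" using mr r2 by simp
  from no_monochromatic_edge obtain \<beta> n\<beta> where \<beta>0: "\<beta> > 0" and mono0: "\<forall>V E c u v. dense \<beta> V E c \<and> n\<beta> \<le> card V \<and>
      u \<in> V \<and> v \<in> V \<and> u \<noteq> v \<and> c u = c v \<and>
      real (card {e \<in> missing V E c. u \<in> e}) \<le> \<beta> * real (card V) ^ (r - 1) \<and>
      real (card {e \<in> missing V E c. v \<in> e}) \<le> \<beta> * real (card V) ^ (r - 1) \<and>
      \<not> contains_copy (Hypergraph V E) HH \<longrightarrow> (\<forall>e\<in>E. \<not> (u \<in> e \<and> v \<in> e))"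
    by (elim exE conjE)
  have mono: "\<forall>e\<in>E. \<not> (u \<in> e \<and> v \<in> e)" if "dense \<beta> V E c" "n\<beta> \<le> card V" "u \<in> V" "v \<in> V"
      "u \<noteq> v" "c u = c v" "real (card {e \<in> missing V E c. u \<in> e}) \<le> \<beta> * real (card V) ^ (r - 1)"
      "real (card {e \<in> missing V E c. v \<in> e}) \<le> \<beta> * real (card V) ^ (r - 1)"
      "\<not> contains_copy (Hypergraph V E) HH" for V E c u v
    by (rule mono0[THEN spec[of _ V], THEN spec[of _ E], THEN spec[of _ c], THEN spec[of _ u], THEN spec[of _ v], THEN mp]) (intro conjI that)
  \<comment> \<open>The allowance \<beta> for missing degrees is split: one half is the threshold
    for exceptional vertices, and the rest absorbs the errors of the recolouring.\<close>
  define \<beta>1 where "\<beta>1 = \<beta> / 2"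
  define \<beta>2 where "\<beta>2 = min (\<beta> / 8) (A' / 4)"
  have \<beta>12: "\<beta>1 > 0" "\<beta>2 > 0" "\<beta>2 \<le> \<beta> / 8" "\<beta>2 \<le> A' / 4"
    using \<beta>0 A'_pos by (auto simp: \<beta>1_def \<beta>2_def)
  from vertex_avoids_colour[OF \<beta>12(2)] obtain \<gamma>2 n2 where \<gamma>2: "\<gamma>2 > 0" and
    avoid0: "\<forall>V E c v. dense \<gamma>2 V E c \<and> n2 \<le> card V \<and> v \<in> V \<and> \<not> contains_copy (Hypergraph V E) HH \<and>
      \<beta>2 * real (card V) ^ (r - 1) \<le> real (card {e\<in>E. v \<in> e \<and> inj_on c (e - {v})}) \<longrightarrow>
      (\<exists>i<m. real (card {e\<in>E. v \<in> e \<and> (\<exists>w\<in>e - {v}. c w = i)}) < \<beta>2 * real (card V) ^ (r - 1))"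
    by (elim exE conjE)
  have avoid: "\<exists>i<m. real (card {e\<in>E. v \<in> e \<and> (\<exists>w\<in>e - {v}. c w = i)}) < \<beta>2 * real (card V) ^ (r - 1)"
    if "dense \<gamma>2 V E c" "n2 \<le> card V" "v \<in> V" "\<not> contains_copy (Hypergraph V E) HH"
      "\<beta>2 * real (card V) ^ (r - 1) \<le> real (card {e\<in>E. v \<in> e \<and> inj_on c (e - {v})})" for V E c v
    by (rule avoid0[THEN spec[of _ V], THEN spec[of _ E], THEN spec[of _ c], THEN spec[of _ v], THEN mp]) (intro conjI that)
  obtain \<eta> where \<eta>: "\<eta> > 0" "\<eta> \<le> 1 / (4 * real m)"
    "real (m - 1 choose (r - 1)) * ((1 - 1 / real m + \<eta>) / real (m - 1)) ^ (r - 1) \<le> A' + \<beta> / 8"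
    using missing_colour_bound[OF m2, of "\<beta> / 8" "1 / (4 * real m)" "r - 1"] \<beta>0 m2 unfolding A'_def by auto
  define \<zeta> where "\<zeta> = min (\<beta> / 8) (min (A' / 8) (1 / (4 * real m)))"
  have \<zeta>: "\<zeta> > 0" "\<zeta> \<le> \<beta> / 8" "\<zeta> \<le> A' / 8" "\<zeta> \<le> 1 / (4 * real m)"
    using \<beta>0 A'_pos m2 by (auto simp: \<zeta>_def)
  from parts_balanced[OF r2 mr \<eta>(1), where 'v = nat, folded A_def]
  obtain \<gamma>p where \<gamma>p: "\<gamma>p > 0" and parts0: "\<forall>V (c :: nat \<Rightarrow> nat). finite V \<and> V \<noteq> {} \<and> (\<forall>x\<in>V. c x < m) \<and>
     (A - \<gamma>p) * real (card V) ^ r \<le> real (card (rainbow r V c)) \<longrightarrow>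
     (\<forall>i<m. \<bar>real (card {x\<in>V. c x = i}) - real (card V) / real m\<bar> \<le> \<eta> * real (card V))"
    by (elim exE conjE)
  have parts: "\<bar>real (card {x\<in>V. c x = i}) - real (card V) / real m\<bar> \<le> \<eta> * real (card V)"
    if "finite V" "V \<noteq> {}" "\<forall>x\<in>V. c x < m" "(A - \<gamma>p) * real (card V) ^ r \<le> real (card (rainbow r V c))" "i < m"
    for V and c :: "nat \<Rightarrow> nat" and i
    by (rule parts0[THEN spec[of _ V], THEN spec[of _ c], THEN mp, THEN spec[of _ i], THEN mp]) (intro conjI that)+
  \<comment> \<open>The last term gives r \<gamma> n^r \<le> \<zeta> n \<beta>1 n^(r-1), which
    bounds the number of exceptional vertices by \<zeta> n.\<close>
  define \<gamma> where "\<gamma> = min (min \<gamma>p \<gamma>2) (min (\<beta> / 8) (min (A' / 8) (\<beta>1 * \<zeta> / real r)))"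
  have \<gamma>: "\<gamma> > 0" "\<gamma> \<le> \<gamma>p" "\<gamma> \<le> \<gamma>2" "\<gamma> \<le> \<beta> / 8" "\<gamma> \<le> A' / 8" "\<gamma> \<le> \<beta>1 * \<zeta> / real r"
  proof -
    show "\<gamma> > 0" using \<gamma>p \<gamma>2 \<beta>0 A'_pos \<beta>12 \<zeta> r2 by (simp add: \<gamma>_def)
  qed (unfold \<gamma>_def, linarith+)
  define n0 where "n0 = max (max n\<beta> n2) 1"
  show ?thesis
  proof (rule exI[of _ \<gamma>], rule conjI[OF \<gamma>(1)], rule exI[of _ n0], intro allI impI, elim conjE)
    fix V and E :: "nat set set" and c
    assume V: "finite V" and E: "\<forall>e\<in>E. e \<subseteq> V \<and> card e = r" and n0: "n0 \<le> card V" and c: "\<forall>x\<in>V. c x < m"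
      and large: "(A - \<gamma>) * real (card V) ^ r \<le> real (card (rainbow r V c \<inter> E))"
      and free: "\<not> contains_copy (Hypergraph V E) HH"
    define n where "n = real (card V)"
    have n1: "n \<ge> 1" using n0 by (simp add: n0_def n_def)
    have Vne: "V \<noteq> {}" using n1 by (auto simp: n_def)
    define N where "N = n ^ (r - 1)"
    have N0: "N > 0" using n1 by (simp add: N_def)
    have nN: "n * N = n ^ r" using r2 by (simp add: N_def flip: power_Suc)
    have fE: "finite E"
    proof -
      have "E \<subseteq> Pow V" using E by auto
      then show ?thesis using V by (meson finite_Pow_iff finite_subset)
    qed
    have N2: "n * n ^ (r - 2) = N"
      using r2 by (simp add: N_def Suc_diff_Suc numeral_2_eq_2 flip: power_Suc)
    let ?rb = "rainbow r V c"
    let ?M = "missing V E c"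
    have frb: "finite ?rb" using V by simp
    have fM: "finite ?M" using V by (simp add: missing_def)
    have cardM: "real (card ?M) \<le> \<gamma> * n ^ r"
    proof -
      have "card ?rb = card ?M + card (?rb \<inter> E)"
        unfolding missing_def using frb by (metis add.commute card_Int_Diff)
      moreover have "real (card ?rb) \<le> A * n ^ r"
        unfolding n_def using c by (intro card_rainbow_A V) auto
      ultimately show ?thesis using large by (simp add: n_def algebra_simps)
    qed
    have ME: "e \<subseteq> V \<and> card e = r" if "e \<in> ?M" for e
      using that by (auto simp: missing_def rainbow_def)
    have sizes: "\<bar>real (card {x\<in>V. c x = i}) - n / real m\<bar> \<le> \<eta> * n" if "i < m" for i
      unfolding n_def
    proof (rule parts[OF V Vne c _ that])
      have "(A - \<gamma>p) * n ^ r \<le> (A - \<gamma>) * n ^ r" using \<gamma>(2) n1 by (intro mult_right_mono) auto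
      also have "\<dots> \<le> real (card (?rb \<inter> E))" using large by (simp add: n_def)
      also have "\<dots> \<le> real (card ?rb)" using frb by (simp add: card_mono)
      finally show "(A - \<gamma>p) * real (card V) ^ r \<le> real (card ?rb)" by (simp add: n_def)
    qed
    have sizes_ge: "real (card {x\<in>V. c x = i}) \<ge> n / real m - \<eta> * n" if "i < m" for i
      using sizes[OF that] by linarith
    have \<eta>n: "\<eta> * n \<le> n / (4 * real m)" using mult_right_mono[OF \<eta>(2), of n] n1 by simp
    have \<zeta>n: "\<zeta> * n \<le> n / (4 * real m)" using mult_right_mono[OF \<zeta>(4), of n] n1 by simp
    have nm: "n / real m - n / (4 * real m) - n / (4 * real m) = n / (2 * real m)"
      using m2 by (simp add: field_simps)
    have nm0: "n / (4 * real m) \<ge> 0" using n1 by simp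
    have dense: "dense \<delta> V E c" if "\<gamma> \<le> \<delta>" for \<delta>
      unfolding dense_def
    proof (intro conjI allI impI)
      show "real (card V) / (2 * real m) \<le> real (card {x\<in>V. c x = i})" if "i < m" for i
        using sizes_ge[OF that] \<eta>n nm nm0 unfolding n_def by linarith
      have "\<gamma> * n ^ r \<le> \<delta> * n ^ r" using that n1 by (intro mult_right_mono) auto
      then show "real (card ?M) \<le> \<delta> * real (card V) ^ r" using cardM by (simp add: n_def)
    qed (use V E c in auto)
    \<comment> \<open>The exceptional vertices; double counting the missing sets shows that they are
      few.\<close>
    define Z where "Z = {w\<in>V. \<beta>1 * N < real (card {e\<in>?M. w \<in> e})}"
    have ZV: "Z \<subseteq> V" by (auto simp: Z_def)
    have fZ: "finite Z" using V ZV finite_subset by blast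
    have cardZ: "real (card Z) \<le> \<zeta> * n"
    proof -
      have "real (card Z) * (\<beta>1 * N) = (\<Sum>w\<in>Z. \<beta>1 * N)" by simp
      also have "\<dots> \<le> (\<Sum>w\<in>Z. real (card {e\<in>?M. w \<in> e}))"
        by (intro sum_mono) (auto simp: Z_def)
      also have "\<dots> \<le> (\<Sum>w\<in>V. real (card {e\<in>?M. w \<in> e}))"
        using V ZV by (intro sum_mono2) auto
      also have "\<dots> = real r * real (card ?M)"
        using sum_degrees[OF V fM ME] by (metis of_nat_mult of_nat_sum)
      also have "\<dots> \<le> real r * (\<gamma> * n ^ r)" using cardM by (intro mult_left_mono) auto
      also have "\<dots> \<le> real r * ((\<beta>1 * \<zeta> / real r) * n ^ r)"
        using \<gamma>(6) n1 by (intro mult_left_mono mult_right_mono) auto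
      also have "\<dots> = (\<zeta> * n) * (\<beta>1 * N)" using r2 nN by simp
      finally show ?thesis using \<beta>12(1) N0 by simp
    qed
    have hitZ: "real (card {e\<in>H. v \<in> e \<and> e \<inter> (Z - {v}) \<noteq> {}}) \<le> \<zeta> * N"
      if H: "\<And>e. e \<in> H \<Longrightarrow> e \<subseteq> V \<and> card e = r" for H v
    proof -
      have "card {e\<in>H. v \<in> e \<and> e \<inter> (Z - {v}) \<noteq> {}} \<le> card (Z - {v}) * card V ^ (r - 2)"
        using H V fZ by (intro card_edges_at_hitting_le) auto
      also have "\<dots> \<le> card Z * card V ^ (r - 2)"
        using fZ by (intro mult_right_mono card_mono) auto
      finally have "real (card {e\<in>H. v \<in> e \<and> e \<inter> (Z - {v}) \<noteq> {}}) \<le> real (card Z) * n ^ (r - 2)"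
        unfolding n_def of_nat_power[symmetric] of_nat_mult[symmetric] of_nat_le_iff .
      also have "\<dots> \<le> (\<zeta> * n) * n ^ (r - 2)" using cardZ n1 by (intro mult_right_mono) auto
      also have "\<dots> = \<zeta> * N" using N2 by simp
      finally show ?thesis .
    qed
    have good: "c u \<noteq> c v" if "e \<in> E" "u \<in> e" "v \<in> e" "u \<noteq> v" "u \<notin> Z" "v \<notin> Z" for e u v
    proof
      assume eq: "c u = c v"
      have uvV: "u \<in> V" "v \<in> V" using that E by auto
      have "\<beta>1 * N \<le> \<beta> * N" using \<beta>0 N0 by (simp add: \<beta>1_def)
      then have d: "real (card {e\<in>?M. w \<in> e}) \<le> \<beta> * real (card V) ^ (r - 1)" if "w \<in> V" "w \<notin> Z" for w
        using that unfolding Z_def by (auto simp: N_def n_def)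
      have "\<forall>e\<in>E. \<not> (u \<in> e \<and> v \<in> e)"
      proof (rule mono[OF dense _ uvV that(4) eq d d free])
        show "\<gamma> \<le> \<beta>" using \<gamma>(4) \<beta>0 by simp
      qed (use n0 uvV that in \<open>auto simp: n0_def\<close>)
      then show False using that by blast
    qed
    define U where "U = {v\<in>V. (A' - \<gamma>) * N \<le> real (card {e\<in>E. v \<in> e})}"
    \<comment> \<open>Edges at \<open>v\<close> with no other exceptional vertex. Apart from
      \<open>v\<close> they are rainbow, and a vertex of large degree keeps almost all its
      edges.\<close>
    define cln where "cln v = {e\<in>E. v \<in> e \<and> e \<inter> (Z - {v}) = {}}" for v
    have cln_inj: "inj_on c (e - {v})" if "e \<in> cln v" for e v
    proof (rule inj_onI, rule ccontr)
      fix x y assume "x \<in> e - {v}" "y \<in> e - {v}" "c x = c y" "x \<noteq> y"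
      then show False using good[of e x y] that by (auto simp: cln_def)
    qed
    have cln_ge: "(A' - \<gamma> - \<zeta>) * N \<le> real (card (cln v))" if "v \<in> U" for v
    proof -
      have "card {e\<in>E. v \<in> e} = card (cln v \<union> {e\<in>E. v \<in> e \<and> e \<inter> (Z - {v}) \<noteq> {}})"
        by (rule arg_cong[where f = card]) (auto simp: cln_def)
      also have "\<dots> \<le> card (cln v) + card {e\<in>E. v \<in> e \<and> e \<inter> (Z - {v}) \<noteq> {}}" by (rule card_Un_le)
      finally have "real (card {e\<in>E. v \<in> e}) \<le> real (card (cln v)) + \<zeta> * N"
        using hitZ[of E v] E by fastforce
      then show ?thesis using that by (simp add: U_def algebra_simps)
    qed
    have "\<exists>i<m. real (card {e\<in>E. v \<in> e \<and> (\<exists>w\<in>e - {v}. c w = i)}) < \<beta>2 * N" if "v \<in> U" for v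
      unfolding N_def n_def
    proof (rule avoid[OF dense[OF \<gamma>(3)] _ _ free])
      show "v \<in> V" using that by (simp add: U_def)
      have "\<beta>2 \<le> A' - \<gamma> - \<zeta>" using \<beta>12(4) \<gamma>(5) \<zeta>(3) A'_pos by linarith
      then have "\<beta>2 * N \<le> (A' - \<gamma> - \<zeta>) * N" using N0 by (intro mult_right_mono) auto
      also have "\<dots> \<le> real (card (cln v))" using cln_ge[OF that] .
      also have "\<dots> \<le> real (card {e\<in>E. v \<in> e \<and> inj_on c (e - {v})})"
        unfolding of_nat_le_iff using fE cln_inj by (intro card_mono) (auto simp: cln_def)
      finally show "\<beta>2 * real (card V) ^ (r - 1) \<le> real (card {e\<in>E. v \<in> e \<and> inj_on c (e - {v})})"
        by (simp add: N_def n_def)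
    qed (use n0 in \<open>simp add: n0_def\<close>)
    then have "\<forall>v\<in>U. \<exists>i. i < m \<and> real (card {e\<in>E. v \<in> e \<and> (\<exists>w\<in>e - {v}. c w = i)}) < \<beta>2 * N"
      by blast
    from bchoice[OF this] obtain i where i: "\<And>v. v \<in> U \<Longrightarrow> i v < m"
      "\<And>v. v \<in> U \<Longrightarrow> real (card {e\<in>E. v \<in> e \<and> (\<exists>w\<in>e - {v}. c w = i v)}) < \<beta>2 * N"
      by blast
    \<comment> \<open>Only exceptional vertices of large degree are recoloured. All colours outside
      \<open>Z\<close> stay, so that few new missing sets arise in total.\<close>
    define c' where "c' v = (if v \<in> Z \<inter> U then i v else c v)" for v
    have c'm: "\<forall>x\<in>V. c' x < m" using c i(1) by (auto simp: c'_def)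
    have c'Z: "c' v = c v" if "v \<notin> Z" for v using that by (simp add: c'_def)
    let ?M' = "missing V E c'"
    have fM': "finite ?M'" using V by (simp add: missing_def)
    have M'E: "e \<subseteq> V \<and> card e = r" if "e \<in> ?M'" for e
      using that by (auto simp: missing_def rainbow_def)
    have M'M: "e \<in> ?M" if "e \<in> ?M'" "e \<inter> Z = {}" for e
    proof -
      have "inj_on c' e = inj_on c e" using c'Z that(2) by (intro inj_on_cong) auto
      then show ?thesis using that(1) by (auto simp: missing_def rainbow_def)
    qed
    have dense': "dense \<beta> V E c'"
      unfolding dense_def
    proof (intro conjI allI impI)
      show "real (card V) / (2 * real m) \<le> real (card {x\<in>V. c' x = j})" if "j < m" for j
      proof -
        have "{x\<in>V. c x = j} \<subseteq> {x\<in>V. c' x = j} \<union> Z" using c'Z by auto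
        then have "card {x\<in>V. c x = j} \<le> card ({x\<in>V. c' x = j} \<union> Z)"
          using V fZ by (intro card_mono) auto
        also have "\<dots> \<le> card {x\<in>V. c' x = j} + card Z" by (rule card_Un_le)
        finally have "real (card {x\<in>V. c x = j}) \<le> real (card {x\<in>V. c' x = j}) + real (card Z)"
          by (simp flip: of_nat_add)
        then show ?thesis using sizes_ge[OF that] \<eta>n \<zeta>n nm cardZ unfolding n_def by linarith
      qed
      have "card ?M' \<le> card (?M \<union> {e\<in>?M'. e \<inter> Z \<noteq> {}})"
        using M'M fM fM' by (intro card_mono) auto
      also have "\<dots> \<le> card ?M + card {e\<in>?M'. e \<inter> Z \<noteq> {}}" by (rule card_Un_le)
      also have "\<dots> \<le> card ?M + card Z * card V ^ (r - 1)"
        using card_edges_hitting_le[OF V fZ M'E] by simp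
      finally have "card ?M' \<le> card ?M + card Z * card V ^ (r - 1)" .
      then have "real (card ?M') \<le> real (card ?M) + real (card Z) * N"
        unfolding N_def n_def of_nat_power[symmetric] of_nat_mult[symmetric] of_nat_add[symmetric] of_nat_le_iff .
      also have "\<dots> \<le> \<gamma> * n ^ r + \<zeta> * n * N"
        using cardM cardZ N0 by (intro add_mono mult_right_mono) auto
      also have "\<dots> = (\<gamma> + \<zeta>) * n ^ r" using nN by (simp add: algebra_simps)
      also have "\<dots> \<le> \<beta> * n ^ r" using \<gamma>(4) \<zeta>(2) \<beta>0 n1 by (intro mult_right_mono) auto
      finally show "real (card ?M') \<le> \<beta> * real (card V) ^ r" by (simp add: n_def)
    qed (use V E c'm in auto)
    have deg': "real (card {e\<in>?M'. u \<in> e}) \<le> \<beta> * real (card V) ^ (r - 1)" if u: "u \<in> U" for u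
    proof -
      have uV: "u \<in> V" using u by (simp add: U_def)
      let ?H = "{e\<in>?M'. u \<in> e \<and> e \<inter> (Z - {u}) \<noteq> {}}"
      have H: "real (card ?H) \<le> \<zeta> * N" using hitZ M'E by blast
      define W where "W = {e\<in>?M'. u \<in> e \<and> e \<inter> (Z - {u}) = {}}"
      have "card {e\<in>?M'. u \<in> e} \<le> card (W \<union> ?H)"
        using fM' by (intro card_mono) (auto simp: W_def)
      also have "\<dots> \<le> card W + card ?H" by (rule card_Un_le)
      finally have split: "real (card {e\<in>?M'. u \<in> e}) \<le> real (card W) + \<zeta> * N"
        using H by linarith
      have "real (card W) \<le> \<beta> / 2 * N"
      proof (cases "u \<in> Z")
        case False
        then have "W \<subseteq> {e\<in>?M. u \<in> e}" using M'M by (auto simp: W_def)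
        then have "card W \<le> card {e\<in>?M. u \<in> e}" using fM by (intro card_mono) auto
        moreover have "real (card {e\<in>?M. u \<in> e}) \<le> \<beta>1 * N" using False uV by (simp add: Z_def not_less)
        ultimately show ?thesis by (simp add: \<beta>1_def)
      next
        case True
        then have c'u: "c' u = i u" using u by (simp add: c'_def)
        define Y where "Y = V - {x\<in>V. c x = i u}"
        \<comment> \<open>Deleting \<open>u\<close> sends both the missing sets \<open>W\<close> and
          the edges \<open>E1\<close> at \<open>u\<close> injectively into \<open>Q\<close>, with
          disjoint images. \<open>Q\<close> has little more than \<open>A'\<close> n^(r-1) members
          and \<open>E1\<close> little less, so almost no room is left for \<open>W\<close>.\<close>
        define Q where "Q = rainbow (r - 1) Y c"
        have fY: "finite Y" using V by (simp add: Y_def)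
        have cardQ: "real (card Q) \<le> (A' + \<beta> / 8) * N"
        proof -
          have "c ` Y \<subseteq> {..<m} - {i u}" using c by (auto simp: Y_def)
          moreover have cI: "card ({..<m} - {i u}) = m - 1" using i(1)[OF u] by simp
          moreover have "{..<m} - {i u} \<noteq> {}" using cI m2 by (intro notI) simp
          ultimately have Q1: "real (card Q) \<le> real (m - 1 choose (r - 1)) * (real (card Y) / real (m - 1)) ^ (r - 1)"
            unfolding Q_def using card_rainbow_le[OF fY, of "{..<m} - {i u}" c "r - 1"] by simp
          have "real (card Y) \<le> (1 - 1 / real m + \<eta>) * n"
          proof -
            have "card Y = card V - card {x\<in>V. c x = i u}"
              unfolding Y_def using V by (intro card_Diff_subset) auto
            moreover have "card {x\<in>V. c x = i u} \<le> card V" using V by (intro card_mono) auto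
            ultimately have "real (card Y) = n - real (card {x\<in>V. c x = i u})" by (simp add: n_def of_nat_diff)
            then show ?thesis using sizes_ge[OF i(1)[OF u]] by (simp add: algebra_simps)
          qed
          then have "(real (card Y) / real (m - 1)) ^ (r - 1) \<le> ((1 - 1 / real m + \<eta>) * n / real (m - 1)) ^ (r - 1)"
            by (intro power_mono divide_right_mono) auto
          then have "real (m - 1 choose (r - 1)) * (real (card Y) / real (m - 1)) ^ (r - 1) \<le>
              real (m - 1 choose (r - 1)) * ((1 - 1 / real m + \<eta>) * n / real (m - 1)) ^ (r - 1)"
            by (intro mult_left_mono) auto
          also have "\<dots> = (real (m - 1 choose (r - 1)) * ((1 - 1 / real m + \<eta>) / real (m - 1)) ^ (r - 1)) * N"
            by (simp add: N_def power_mult_distrib power_divide)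
          also have "\<dots> \<le> (A' + \<beta> / 8) * N" using \<eta>(3) N0 by (intro mult_right_mono) auto
          finally show ?thesis using Q1 by linarith
        qed
        define E1 where "E1 = {e\<in>cln u. \<forall>w\<in>e - {u}. c w \<noteq> i u}"
        have fE1: "finite E1" using fE by (simp add: E1_def cln_def)
        have E1_ge: "(A' - \<gamma> - \<zeta> - \<beta>2) * N \<le> real (card E1)"
        proof -
          have "cln u \<subseteq> E1 \<union> {e\<in>E. u \<in> e \<and> (\<exists>w\<in>e - {u}. c w = i u)}" by (auto simp: E1_def cln_def)
          then have "card (cln u) \<le> card (E1 \<union> {e\<in>E. u \<in> e \<and> (\<exists>w\<in>e - {u}. c w = i u)})"
            using fE fE1 by (intro card_mono) auto
          also have "\<dots> \<le> card E1 + card {e\<in>E. u \<in> e \<and> (\<exists>w\<in>e - {u}. c w = i u)}" by (rule card_Un_le)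
          finally have "real (card (cln u)) \<le> real (card E1) + \<beta>2 * N" using i(2)[OF u] by linarith
          then show ?thesis using cln_ge[OF u] by (simp add: algebra_simps)
        qed
        have inj: "inj_on (\<lambda>e. e - {u}) (W \<union> E1)"
        proof (rule inj_onI)
          fix e f assume ef: "e \<in> W \<union> E1" "f \<in> W \<union> E1" "e - {u} = f - {u}"
          then have "u \<in> e" "u \<in> f" by (auto simp: W_def E1_def cln_def)
          then show "e = f" using ef(3) by (metis insert_Diff)
        qed
        have inQ: "e - {u} \<in> Q" if "e \<subseteq> V" "card e = r" "u \<in> e" "inj_on c (e - {u})" "\<And>w. w \<in> e - {u} \<Longrightarrow> c w \<noteq> i u" for e
        proof -
          have "finite e" using that(1) V finite_subset by blast
          then show ?thesis using that by (auto simp: Q_def rainbow_def Y_def)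
        qed
        have "(\<lambda>e. e - {u}) ` (W \<union> E1) \<subseteq> Q"
        proof clarify
          fix e assume "e \<in> W \<union> E1"
          then show "e - {u} \<in> Q"
          proof
            assume W: "e \<in> W"
            then have e: "inj_on c' e" "u \<in> e" "e \<inter> (Z - {u}) = {}" by (auto simp: W_def missing_def rainbow_def)
            have cc: "c' w = c w" if "w \<in> e - {u}" for w using e(3) that by (intro c'Z) auto
            show ?thesis
            proof (rule inQ)
              have "inj_on c' (e - {u})" using e(1) by (rule inj_on_subset) auto
              then show "inj_on c (e - {u})" using inj_on_cong[of "e - {u}" c' c] cc by blast
              show "c w \<noteq> i u" if "w \<in> e - {u}" for w
                using cc[OF that] c'u e(1,2) that by (metis DiffD1 DiffD2 inj_onD singletonI)
            qed (use W e M'E in \<open>auto simp: W_def\<close>)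
          next
            assume "e \<in> E1"
            then show ?thesis using E cln_inj[of e u] by (intro inQ) (auto simp: E1_def cln_def)
          qed
        qed
        then have "card (W \<union> E1) \<le> card Q"
          using inj fY by (metis card_inj_on_le Q_def finite_rainbow)
        moreover have "card (W \<union> E1) = card W + card E1"
        proof (rule card_Un_disjoint)
          show "finite W" using fM' by (simp add: W_def)
          show "W \<inter> E1 = {}" by (auto simp: W_def E1_def cln_def missing_def)
        qed (fact fE1)
        ultimately have "real (card W) + real (card E1) \<le> real (card Q)" by (simp flip: of_nat_add)
        then have "real (card W) \<le> (A' + \<beta> / 8) * N - (A' - \<gamma> - \<zeta> - \<beta>2) * N" using cardQ E1_ge by linarith
        \<comment> \<open>Each of the four errors was chosen to be at most \<beta> / 8.\<close>
        also have "\<dots> = (\<beta> / 8 + \<gamma> + \<zeta> + \<beta>2) * N" by (simp add: algebra_simps)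
        also have "\<dots> \<le> \<beta> / 2 * N" using \<gamma>(4) \<zeta>(2) \<beta>12(3) N0 by (intro mult_right_mono) auto
        finally show ?thesis .
      qed
      moreover have "\<zeta> * N \<le> \<beta> / 8 * N" using \<zeta>(2) N0 by (intro mult_right_mono) auto
      moreover have "\<beta> / 2 * N + \<beta> / 8 * N \<le> \<beta> * N" using \<beta>0 N0 by (simp add: field_simps)
      ultimately show ?thesis using split by (simp add: N_def n_def)
    qed
    have "inj_on c' e" if e: "e \<in> E" "\<forall>v\<in>e. (A' - \<gamma>) * real (card V) ^ (r - 1) \<le> real (card {e\<in>E. v \<in> e})" for e
    proof (rule inj_onI, rule ccontr)
      fix u v assume uv: "u \<in> e" "v \<in> e" "c' u = c' v" "u \<noteq> v"
      have eU: "u \<in> U" "v \<in> U" using uv(1,2) e E by (auto simp: U_def N_def n_def)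
      then have "u \<in> V" "v \<in> V" by (auto simp: U_def)
      moreover have "n\<beta> \<le> card V" using n0 by (simp add: n0_def)
      ultimately have "\<forall>e\<in>E. \<not> (u \<in> e \<and> v \<in> e)"
        using mono[OF dense' _ _ _ uv(4,3) deg' deg' free] eU by blast
      then show False using e uv by blast
    qed
    then show "\<exists>c'. (\<forall>x\<in>V. c' x < m) \<and>
       (\<forall>e\<in>E. (\<forall>v\<in>e. (A' - \<gamma>) * real (card V) ^ (r - 1) \<le> real (card {e\<in>E. v \<in> e})) \<longrightarrow> inj_on c' e)"
      using c'm by blast
  qed
qed

end

section \<open>Cores and cleaning\<close>

context extension_host
begin

text \<open>Says that the graph itself satisfies the core condition of \<open>core_family\<close>,
  which avoids quantifying over subgraphs.\<close>

definition has_core :: "nat set \<Rightarrow> nat set set \<Rightarrow> bool" where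
  "has_core V E \<longleftrightarrow> (\<exists>C\<subseteq>V. card C = m + 1 \<and> contains_copy (induced (Hypergraph V E) C) F \<and>
     (\<forall>u\<in>C. \<forall>v\<in>C. u \<noteq> v \<longrightarrow> (\<exists>e\<in>E. u \<in> e \<and> v \<in> e)))"

text \<open>An injective copy carries a core to a core, so a graph containing a member of the family
  has a core itself.\<close>

lemma family_free_core_family:
  assumes "r_graph r (Hypergraph V E)"
  shows "family_free (core_family r F (m + 1)) (Hypergraph V E) \<longleftrightarrow> \<not> has_core V E"
proof
  assume free: "family_free (core_family r F (m + 1)) (Hypergraph V E)"
  show "\<not> has_core V E"
  proof
    assume "has_core V E"
    then have "Hypergraph V E \<in> core_family r F (m + 1)"
      using assms unfolding has_core_def core_family_def covered_def by auto
    moreover have "contains_copy (Hypergraph V E) (Hypergraph V E)"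
      unfolding contains_copy_def by (intro exI[of _ "\<lambda>x. x"]) auto
    ultimately show False using free by (auto simp: family_free_def)
  qed
next
  assume nc: "\<not> has_core V E"
  show "family_free (core_family r F (m + 1)) (Hypergraph V E)"
    unfolding family_free_def
  proof (intro ballI notI)
    fix K assume K: "K \<in> core_family r F (m + 1)" and "contains_copy (Hypergraph V E) K"
    then obtain g where g: "inj_on g (verts K)" "g ` verts K \<subseteq> V" "\<And>e. e \<in> edges K \<Longrightarrow> g ` e \<in> E"
      by (auto simp: contains_copy_def)
    obtain C where C: "C \<subseteq> verts K" "card C = m + 1" "contains_copy (induced K C) F"
      and cov: "\<And>u v. u \<in> C \<Longrightarrow> v \<in> C \<Longrightarrow> u \<noteq> v \<Longrightarrow> covered K u v"
      using K by (auto simp: core_family_def)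
    from C(3) obtain f where f: "inj_on f (verts F)" "f ` verts F \<subseteq> C"
      "\<And>e. e \<in> edges F \<Longrightarrow> f ` e \<in> edges K \<and> f ` e \<subseteq> C"
      by (auto simp: contains_copy_def induced_def)
    have "has_core V E"
      unfolding has_core_def
    proof (intro exI[of _ "g ` C"] conjI ballI impI)
      show "g ` C \<subseteq> V" using C g by blast
      show "card (g ` C) = m + 1" using C g by (metis card_image inj_on_subset)
      show "contains_copy (induced (Hypergraph V E) (g ` C)) F"
        unfolding contains_copy_def induced_def
      proof (intro exI[of _ "g \<circ> f"] conjI ballI)
        show "inj_on (g \<circ> f) (verts F)" using f g C by (meson comp_inj_on inj_on_subset order_trans)
        show "(g \<circ> f) ` verts F \<subseteq> verts (Hypergraph (g ` C) {e \<in> edges (Hypergraph V E). e \<subseteq> g ` C})"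
          using f(2) by auto
        show "(g \<circ> f) ` e \<in> edges (Hypergraph (g ` C) {e \<in> edges (Hypergraph V E). e \<subseteq> g ` C})"
          if "e \<in> edges F" for e
          using f(3)[OF that] g(3) by (auto simp flip: image_image)
      qed
      show "\<exists>e\<in>E. u \<in> e \<and> v \<in> e" if "u \<in> g ` C" "v \<in> g ` C" "u \<noteq> v" for u v
      proof -
        from that obtain x y where xy: "x \<in> C" "y \<in> C" "u = g x" "v = g y" "x \<noteq> y" by blast
        then obtain e where "e \<in> edges K" "x \<in> e" "y \<in> e" using cov[of x y] by (auto simp: covered_def)
        then show ?thesis using g(3)[of e] xy by blast
      qed
    qed
    then show False using nc by blast
  qed
qed

text \<open>A copy of \<open>F\<close> in the core extends to a labelling of the whole core: the
  \<open>New\<close> vertices are sent to the core vertices that the copy leaves free.\<close>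

lemma has_coreE:
  assumes "finite V" "has_core V E"
  obtains \<phi> where "inj_on \<phi> Cv" "\<phi> ` Cv \<subseteq> V" "\<And>f. f \<in> edges F \<Longrightarrow> \<phi> ` Old ` f \<in> E"
    "\<And>x y. x \<in> Cv \<Longrightarrow> y \<in> Cv \<Longrightarrow> x \<noteq> y \<Longrightarrow> \<exists>e\<in>E. \<phi> x \<in> e \<and> \<phi> y \<in> e"
proof -
  obtain C where C: "C \<subseteq> V" "card C = m + 1" "contains_copy (induced (Hypergraph V E) C) F"
    and cov: "\<And>u v. u \<in> C \<Longrightarrow> v \<in> C \<Longrightarrow> u \<noteq> v \<Longrightarrow> \<exists>e\<in>E. u \<in> e \<and> v \<in> e"
    using assms(2) by (auto simp: has_core_def)
  from C(3) obtain f where f: "inj_on f (verts F)" "f ` verts F \<subseteq> C"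
    "\<And>e. e \<in> edges F \<Longrightarrow> f ` e \<in> E"
    by (auto simp: contains_copy_def induced_def)
  have fC: "finite C" using C assms(1) finite_subset by blast
  have "card (C - f ` verts F) = m + 1 - card (verts F)"
    using f C finite_F by (simp add: card_Diff_subset card_image)
  moreover have "card {card (verts F)<..m + 1} = m + 1 - card (verts F)" by simp
  ultimately obtain h where h: "bij_betw h {card (verts F)<..m + 1} (C - f ` verts F)"
    using finite_same_card_bij[of "{card (verts F)<..m + 1}" "C - f ` verts F"] fC by auto
  define \<phi> where "\<phi> x = (case x of Old y \<Rightarrow> f y | New k \<Rightarrow> h k)" for x
  have hC: "h k \<in> C - f ` verts F" if "k \<in> {card (verts F)<..m + 1}" for k
    using bij_betwE[OF h] that by blast
  have hinj: "inj_on h {card (verts F)<..m + 1}" using h by (simp add: bij_betw_def)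
  have CvE: "(\<exists>y\<in>verts F. x = Old y) \<or> (\<exists>k\<in>{card (verts F)<..m + 1}. x = New k)" if "x \<in> Cv" for x
    using that by (auto simp: Cv_def core_vertices_def)
  have \<phi>C: "\<phi> x \<in> C" if "x \<in> Cv" for x
    using CvE[OF that] f(2) hC by (auto simp: \<phi>_def)
  have inj: "inj_on \<phi> Cv"
  proof (rule inj_onI)
    fix x y assume xy: "x \<in> Cv" "y \<in> Cv" "\<phi> x = \<phi> y"
    show "x = y"
      using CvE[OF xy(1)] CvE[OF xy(2)]
    proof (elim disjE bexE)
      fix p q assume "p \<in> verts F" "q \<in> verts F" "x = Old p" "y = Old q"
      then show ?thesis using xy(3) f(1) by (auto simp: \<phi>_def inj_on_def)
    next
      fix p q assume "p \<in> {card (verts F)<..m + 1}" "q \<in> {card (verts F)<..m + 1}" "x = New p" "y = New q"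
      then show ?thesis using xy(3) hinj by (auto simp: \<phi>_def inj_on_def)
    next
      fix p q assume a: "p \<in> verts F" "q \<in> {card (verts F)<..m + 1}" "x = Old p" "y = New q"
      have "h q \<noteq> f p" using hC[OF a(2)] a(1) by blast
      then show ?thesis using xy(3) a by (simp add: \<phi>_def)
    next
      fix p q assume a: "q \<in> verts F" "p \<in> {card (verts F)<..m + 1}" "x = New p" "y = Old q"
      have "h p \<noteq> f q" using hC[OF a(2)] a(1) by blast
      then show ?thesis using xy(3) a by (simp add: \<phi>_def)
    qed
  qed
  show ?thesis
  proof
    show "inj_on \<phi> Cv" by fact
    show "\<phi> ` Cv \<subseteq> V" using \<phi>C C by blast
    show "\<phi> ` Old ` e \<in> E" if "e \<in> edges F" for e
      using f(3)[OF that] by (simp add: \<phi>_def image_image)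
    show "\<exists>e\<in>E. \<phi> x \<in> e \<and> \<phi> y \<in> e" if "x \<in> Cv" "y \<in> Cv" "x \<noteq> y" for x y
      using cov[OF \<phi>C[OF that(1)] \<phi>C[OF that(2)]] that inj by (auto dest: inj_onD)
  qed
qed

text \<open>The extension has a core: its padded edges cover exactly the pairs that \<open>F\<close>
  leaves uncovered.\<close>

lemma core_free_extension_free:
  assumes "\<not> has_core V E"
  shows "\<not> contains_copy (Hypergraph V E) HH"
proof
  assume "contains_copy (Hypergraph V E) HH"
  then obtain f where f: "inj_on f X" "f ` X \<subseteq> V" "\<And>e. e \<in> D \<Longrightarrow> f ` e \<in> E"
    by (auto simp: contains_copy_def X_def D_def)
  have cX: "Core ` Cv \<subseteq> X" by (auto simp: X_eq)
  define C where "C = f ` Core ` Cv"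
  have inj: "inj_on (\<lambda>x. f (Core x)) Cv"
    using f(1) cX by (auto simp: inj_on_def)
  have OF: "Old x \<in> Cv" if "x \<in> verts F" for x using that by (auto simp: Cv_def core_vertices_def)
  have "has_core V E"
    unfolding has_core_def
  proof (intro exI[of _ C] conjI ballI impI)
    show "C \<subseteq> V" using f(2) cX by (auto simp: C_def)
    show "card C = m + 1" using inj card_Cv by (simp add: C_def image_image card_image)
    show "contains_copy (induced (Hypergraph V E) C) F"
      unfolding contains_copy_def induced_def
    proof (intro exI[of _ "\<lambda>x. f (Core (Old x))"] conjI ballI)
      show "inj_on (\<lambda>x. f (Core (Old x))) (verts F)"
        using inj OF by (auto simp: inj_on_def)
      show "(\<lambda>x. f (Core (Old x))) ` verts F \<subseteq> verts (Hypergraph C {e \<in> edges (Hypergraph V E). e \<subseteq> C})"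
        using OF by (auto simp: C_def)
      fix e assume e: "e \<in> edges F"
      have "Core ` Old ` e \<in> D" using e by (auto simp: D_eq)
      then have "f ` Core ` Old ` e \<in> E" by (rule f(3))
      moreover have "f ` Core ` Old ` e \<subseteq> C" using Old_edge_sub[OF e] by (auto simp: C_def)
      ultimately show "(\<lambda>x. f (Core (Old x))) ` e \<in> edges (Hypergraph C {e \<in> edges (Hypergraph V E). e \<subseteq> C})"
        by (simp add: image_image)
    qed
    fix u v assume uv: "u \<in> C" "v \<in> C" "u \<noteq> v"
    then obtain x y where xy: "x \<in> Cv" "y \<in> Cv" "u = f (Core x)" "v = f (Core y)" "x \<noteq> y"
      by (auto simp: C_def)
    show "\<exists>e\<in>E. u \<in> e \<and> v \<in> e"
    proof (cases "{x, y} \<in> UP")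
      case True
      then have "f ` pair_edge {x, y} \<in> E" by (intro f(3)) (auto simp: D_eq)
      moreover have "u \<in> f ` pair_edge {x, y}" "v \<in> f ` pair_edge {x, y}" using xy by auto
      ultimately show ?thesis by blast
    next
      case False
      then obtain g where g: "g \<in> edges F" "x \<in> Old ` g" "y \<in> Old ` g"
        unfolding UP_iff using xy by blast
      then have "f ` Core ` Old ` g \<in> E" by (intro f(3)) (auto simp: D_eq)
      moreover have "u \<in> f ` Core ` Old ` g" "v \<in> f ` Core ` Old ` g" using xy g by auto
      ultimately show ?thesis by (intro bexI[of _ "f ` Core ` Old ` g"] conjI)
    qed
  qed
  then show False using assms by blast
qed

text \<open>An upper bound for the number of vertices occupied while padded edges are chosen
  greedily: the core, and \<open>r\<close> vertices for each uncovered pair.\<close>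

definition room :: nat where "room = m + 1 + card UP * r"

text \<open>The codegree exceeds \<open>room * card V ^ (r - 3)\<close>, which bounds the number of edges through the
  pair that meet a given set of \<open>room\<close> further vertices; both sides are multiplied by \<open>card V\<close>
  because \<open>r - 3\<close> would be truncated for \<open>r = 2\<close>.\<close>

definition robust :: "nat set \<Rightarrow> nat set set \<Rightarrow> nat \<Rightarrow> nat \<Rightarrow> bool" where
  "robust V E u v \<longleftrightarrow> room * card V ^ (r - 2) < card {e\<in>E. u \<in> e \<and> v \<in> e} * card V"

lemma robust_edge:
  assumes "finite V" "\<And>e. e \<in> E \<Longrightarrow> e \<subseteq> V \<and> card e = r" "robust V E u v" "u \<noteq> v"
    and "finite W" "card W \<le> room" "u \<notin> W" "v \<notin> W"
  shows "\<exists>e\<in>E. u \<in> e \<and> v \<in> e \<and> e \<inter> W = {}"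
proof (rule ccontr)
  assume none: "\<not> ?thesis"
  let ?S = "\<lambda>w. {e. e \<subseteq> V \<and> card e = r \<and> {u, v, w} \<subseteq> e}"
  have each: "card (?S w) * card V \<le> card V ^ (r - 2)" if "w \<in> W" for w
  proof -
    have "u \<noteq> w" "v \<noteq> w" using assms(7,8) that by auto
    then have c3: "card {u, v, w} = 3" using assms(4) by simp
    show ?thesis
    proof (cases "r \<ge> 3")
      case True
      have "card (?S w) * card V \<le> card V ^ (r - 3) * card V"
        using card_supersets_le[OF assms(1), of "{u, v, w}" r] c3 by (intro mult_right_mono) auto
      also have "\<dots> = card V ^ (r - 2)"
      proof -
        have "r - 2 = Suc (r - 3)" using True by simp
        then show ?thesis by simp
      qed
      finally show ?thesis .
    next
      case False
      \<comment> \<open>For r = 2 no edge contains three distinct vertices.\<close>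
      have "?S w = {}"
      proof (rule ccontr)
        assume "?S w \<noteq> {}"
        then obtain e where e: "e \<subseteq> V" "card e = r" "{u, v, w} \<subseteq> e" by blast
        then have "card {u, v, w} \<le> card e" using assms(1) finite_subset by (intro card_mono) auto
        then show False using c3 e False by simp
      qed
      then show ?thesis by (simp only: card.empty)
    qed
  qed
  have "{e\<in>E. u \<in> e \<and> v \<in> e} \<subseteq> (\<Union>w\<in>W. ?S w)" using none assms(2) by fastforce
  then have "card {e\<in>E. u \<in> e \<and> v \<in> e} \<le> card (\<Union>w\<in>W. ?S w)"
    using assms(1,5) by (intro card_mono) auto
  also have "\<dots> \<le> (\<Sum>w\<in>W. card (?S w))" using assms(5) by (rule card_UN_le)
  finally have "card {e\<in>E. u \<in> e \<and> v \<in> e} * card V \<le> (\<Sum>w\<in>W. card (?S w) * card V)"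
    unfolding sum_distrib_right[symmetric] by (rule mult_right_mono) simp
  also have "\<dots> \<le> (\<Sum>w\<in>W. card V ^ (r - 2))" using each by (rule sum_mono)
  also have "\<dots> \<le> room * card V ^ (r - 2)" using assms(6) by simp
  finally show False using assms(3) by (simp add: robust_def)
qed

text \<open>The padded edges are chosen greedily, one uncovered pair after the other; robustness
  always leaves an edge through the pair that avoids the rest of the core and all edges chosen
  before.\<close>

lemma robust_extension:
  assumes V: "finite V" and E: "\<And>e. e \<in> E \<Longrightarrow> e \<subseteq> V \<and> card e = r"
    and \<phi>: "inj_on \<phi> Cv" "\<phi> ` Cv \<subseteq> V" "\<And>f. f \<in> edges F \<Longrightarrow> \<phi> ` Old ` f \<in> E"
    and rob: "\<And>x y. x \<in> Cv \<Longrightarrow> y \<in> Cv \<Longrightarrow> x \<noteq> y \<Longrightarrow> robust V E (\<phi> x) (\<phi> y)"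
  shows "contains_copy (Hypergraph V E) HH"
proof -
  have c\<phi>P: "card (\<phi> ` P) = 2" if "P \<in> UP" for P
    using UP_sub[OF that] UP_card[OF that] \<phi>(1) by (metis card_image inj_on_subset)
  have step: "\<exists>Ed. \<forall>P\<in>Q. Ed P \<in> E \<and> Ed P \<inter> \<phi> ` Cv = \<phi> ` P \<and>
      (\<forall>P'\<in>Q. P' \<noteq> P \<longrightarrow> (Ed P - \<phi> ` P) \<inter> (Ed P' - \<phi> ` P') = {})" if "Q \<subseteq> UP" for Q
    using finite_subset[OF that finite_UP] that
  proof (induction Q rule: finite_induct)
    case empty
    then show ?case by simp
  next
    case (insert P Q)
    then obtain Ed where Ed0: "\<forall>P\<in>Q. Ed P \<in> E \<and> Ed P \<inter> \<phi> ` Cv = \<phi> ` P \<and>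
      (\<forall>P'\<in>Q. P' \<noteq> P \<longrightarrow> (Ed P - \<phi> ` P) \<inter> (Ed P' - \<phi> ` P') = {})"
      by auto
    have Ed: "\<And>P. P \<in> Q \<Longrightarrow> Ed P \<in> E" "\<And>P. P \<in> Q \<Longrightarrow> Ed P \<inter> \<phi> ` Cv = \<phi> ` P"
      "\<And>P P'. P \<in> Q \<Longrightarrow> P' \<in> Q \<Longrightarrow> P' \<noteq> P \<Longrightarrow> (Ed P - \<phi> ` P) \<inter> (Ed P' - \<phi> ` P') = {}"
      using Ed0 by blast+
    have P: "P \<in> UP" "Q \<subseteq> UP" using insert by auto
    obtain x y where xy: "P = {x, y}" "x \<in> Cv" "y \<in> Cv" "x \<noteq> y" using P(1) unfolding UP_iff by blast
    \<comment> \<open>Everything occupied so far except the two ends of the new pair.\<close>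
    define W where "W = (\<phi> ` Cv \<union> (\<Union>P'\<in>Q. Ed P')) - {\<phi> x, \<phi> y}"
    have fEd: "finite (Ed P')" if "P' \<in> Q" for P' using E[OF Ed(1)[OF that]] V finite_subset by blast
    have "card (\<Union>P'\<in>Q. Ed P') \<le> (\<Sum>P'\<in>Q. card (Ed P'))" using insert(1) by (rule card_UN_le)
    also have "\<dots> = card Q * r" using E[OF Ed(1)] by simp
    also have "\<dots> \<le> card UP * r" using P(2) finite_UP by (simp add: card_mono)
    finally have cU: "card (\<Union>P'\<in>Q. Ed P') \<le> card UP * r" .
    have "card W \<le> card (\<phi> ` Cv \<union> (\<Union>P'\<in>Q. Ed P'))"
      unfolding W_def using finite_Cv fEd insert(1) by (intro card_mono) auto
    also have "\<dots> \<le> card (\<phi> ` Cv) + card (\<Union>P'\<in>Q. Ed P')" by (rule card_Un_le)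
    also have "\<dots> \<le> room" using card_image_le[OF finite_Cv, of \<phi>] card_Cv cU by (simp add: room_def)
    finally have cW: "card W \<le> room" .
    have ne: "\<phi> x \<noteq> \<phi> y" using \<phi>(1) xy by (auto dest: inj_onD)
    obtain e where e: "e \<in> E" "\<phi> x \<in> e" "\<phi> y \<in> e" "e \<inter> W = {}"
      using robust_edge[OF V E rob[OF xy(2-4)] ne _ cW] finite_Cv fEd insert(1) by (auto simp: W_def)
    define Ed' where "Ed' = Ed(P := e)"
    have Ed'Q: "Ed' P' = Ed P'" if "P' \<in> Q" for P' using that insert(2) by (auto simp: Ed'_def)
    have Ed'P: "Ed' P = e" by (simp add: Ed'_def)
    have eC: "e \<inter> \<phi> ` Cv = \<phi> ` P" using e xy by (auto simp: W_def)
    have eQ: "(e - \<phi> ` P) \<inter> (Ed P' - \<phi> ` P') = {}" if "P' \<in> Q" for P'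
      using e(4) that xy(1) by (auto simp: W_def)
    show ?case
    proof (rule exI[of _ Ed'], intro ballI conjI impI)
      fix P1 assume P1: "P1 \<in> insert P Q"
      show "Ed' P1 \<in> E" using P1 Ed(1) e(1) Ed'Q Ed'P by (cases "P1 = P") simp_all
      show "Ed' P1 \<inter> \<phi> ` Cv = \<phi> ` P1" using P1 Ed(2) eC Ed'Q Ed'P by (cases "P1 = P") simp_all
      fix P2 assume P2: "P2 \<in> insert P Q" "P2 \<noteq> P1"
      consider "P1 = P" "P2 \<in> Q" | "P1 \<in> Q" "P2 = P" | "P1 \<in> Q" "P2 \<in> Q" using P1 P2 by blast
      then show "(Ed' P1 - \<phi> ` P1) \<inter> (Ed' P2 - \<phi> ` P2) = {}"
      proof cases
        case 1
        then show ?thesis using eQ[OF 1(2)] Ed'Q Ed'P by simp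
      next
        case 2
        then show ?thesis using eQ[OF 2(1)] Ed'Q Ed'P by (simp add: Int_commute)
      next
        case 3
        then show ?thesis using Ed(3)[OF 3 P2(2)] Ed'Q by simp
      qed
    qed
  qed
  from step[OF subset_refl] obtain Ed where Ed0: "\<forall>P\<in>UP. Ed P \<in> E \<and> Ed P \<inter> \<phi> ` Cv = \<phi> ` P \<and>
      (\<forall>P'\<in>UP. P' \<noteq> P \<longrightarrow> (Ed P - \<phi> ` P) \<inter> (Ed P' - \<phi> ` P') = {})" ..
  have Ed: "\<And>P. P \<in> UP \<Longrightarrow> Ed P \<in> E"
    "\<And>P. P \<in> UP \<Longrightarrow> Ed P \<inter> \<phi> ` Cv = \<phi> ` P"
    "\<And>P P'. P \<in> UP \<Longrightarrow> P' \<in> UP \<Longrightarrow> P' \<noteq> P \<Longrightarrow> (Ed P - \<phi> ` P) \<inter> (Ed P' - \<phi> ` P') = {}"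
    using Ed0 by blast+
  have "\<exists>h. bij_betw h {..<r - 2} (Ed P - \<phi> ` P)" if P: "P \<in> UP" for P
  proof -
    have fE: "finite (Ed P)" using E[OF Ed(1)[OF P]] V finite_subset by blast
    have "\<phi> ` P \<subseteq> Ed P" using Ed(2)[OF P] by blast
    then have "card (Ed P - \<phi> ` P) = r - 2"
      using E[OF Ed(1)[OF P]] c\<phi>P[OF P] fE by (simp add: card_Diff_subset finite_subset)
    then show ?thesis using finite_same_card_bij[of "{..<r - 2}" "Ed P - \<phi> ` P"] fE by auto
  qed
  then have "\<forall>P\<in>UP. \<exists>h. bij_betw h {..<r - 2} (Ed P - \<phi> ` P)" by blast
  from bchoice[OF this] obtain h where h: "\<And>P. P \<in> UP \<Longrightarrow> bij_betw (h P) {..<r - 2} (Ed P - \<phi> ` P)"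
    by blast
  define f where "f x = (case x of Core y \<Rightarrow> \<phi> y | Pad P k \<Rightarrow> h P k)" for x
  have hE: "h P k \<in> Ed P - \<phi> ` P" if "P \<in> UP" "k < r - 2" for P k
    using h[OF that(1)] that(2) by (auto simp: bij_betw_def)
  have hC: "h P k \<notin> \<phi> ` Cv" if "P \<in> UP" "k < r - 2" for P k
    using hE[OF that] Ed(2)[OF that(1)] by blast
  have XE: "(\<exists>y\<in>Cv. x = Core y) \<or> (\<exists>P\<in>UP. \<exists>k<r - 2. x = Pad P k)" if "x \<in> X" for x
    using that by (auto simp: X_eq)
  have f_pair: "f ` pair_edge P = Ed P" if P: "P \<in> UP" for P
  proof -
    have "f ` pair_edge P = \<phi> ` P \<union> h P ` {..<r - 2}"
      by (simp add: pair_edge_def image_Un image_image f_def)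
    also have "\<dots> = Ed P" using h[OF P] Ed(2)[OF P] by (auto simp: bij_betw_def)
    finally show ?thesis .
  qed
  have inj: "inj_on f X"
  proof (rule inj_onI)
    fix x y assume xy: "x \<in> X" "y \<in> X" "f x = f y"
    show "x = y"
      using XE[OF xy(1)] XE[OF xy(2)]
    proof (elim disjE bexE exE conjE)
      fix p q assume "p \<in> Cv" "q \<in> Cv" "x = Core p" "y = Core q"
      then show ?thesis using xy(3) \<phi>(1) by (auto simp: f_def dest: inj_onD)
    next
      fix p P k assume a: "p \<in> Cv" "x = Core p" "P \<in> UP" "k < r - 2" "y = Pad P k"
      have "h P k \<noteq> \<phi> p" using hC[OF a(3,4)] a(1) by blast
      then show ?thesis using xy(3) a by (simp add: f_def)
    next
      fix p P k assume a: "p \<in> Cv" "y = Core p" "P \<in> UP" "k < r - 2" "x = Pad P k"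
      have "h P k \<noteq> \<phi> p" using hC[OF a(3,4)] a(1) by blast
      then show ?thesis using xy(3) a by (simp add: f_def)
    next
      fix P k Q l assume a: "P \<in> UP" "k < r - 2" "x = Pad P k" "Q \<in> UP" "l < r - 2" "y = Pad Q l"
      have eq: "h P k = h Q l" using xy(3) a by (simp add: f_def)
      have "P = Q" using Ed(3)[OF a(1,4)] hE[OF a(1,2)] hE[OF a(4,5)] eq by auto
      moreover have "inj_on (h P) {..<r - 2}" using h[OF a(1)] by (simp add: bij_betw_def)
      ultimately show ?thesis using a eq by (auto dest: inj_onD)
    qed
  qed
  have img: "f ` X \<subseteq> V"
  proof
    fix z assume "z \<in> f ` X"
    then obtain x where x: "x \<in> X" "z = f x" by blast
    show "z \<in> V"
      using XE[OF x(1)]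
    proof (elim disjE bexE exE conjE)
      fix y assume "y \<in> Cv" "x = Core y"
      then show ?thesis using x \<phi>(2) by (auto simp: f_def)
    next
      fix P k assume a: "P \<in> UP" "k < r - 2" "x = Pad P k"
      then show ?thesis using x hE[OF a(1,2)] E[OF Ed(1)[OF a(1)]] by (auto simp: f_def)
    qed
  qed
  have "f ` e \<in> E" if "e \<in> D" for e
    using that
  proof (cases rule: D_cases)
    case (1 g)
    then show ?thesis using \<phi>(3)[OF 1(1)] by (simp add: f_def image_image)
  next
    case (2 P)
    then show ?thesis using f_pair Ed(1) by simp
  qed
  then have "contains_copy (Hypergraph V E) (Hypergraph X D)"
    unfolding contains_copy_def using inj img by auto
  then show ?thesis by (simp add: HH_eq)
qed

text \<open>All edges containing a pair that is not robust are deleted; each of at most n^2 such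
  pairs accounts for at most \<open>room\<close> times n^(r-3) edges. Robustness refers to the
  original graph, so a core of the cleaned graph has robust pairs there and is completed to the
  extension with original edges.\<close>

lemma cleaning:
  assumes V: "finite V" and E: "\<And>e. e \<in> E \<Longrightarrow> e \<subseteq> V \<and> card e = r"
    and free: "\<not> contains_copy (Hypergraph V E) HH"
  shows "\<exists>E'\<subseteq>E. \<not> has_core V E' \<and> card E \<le> card E' + room * card V ^ (r - 1)"
proof -
  define E' where "E' = {e\<in>E. \<forall>u\<in>e. \<forall>v\<in>e. u \<noteq> v \<longrightarrow> robust V E u v}"
  have fE: "finite E"
  proof -
    have "E \<subseteq> Pow V" using E by auto
    then show ?thesis using V by (meson finite_Pow_iff finite_subset)
  qed
  have "\<not> has_core V E'"
  proof
    assume "has_core V E'"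
    then obtain \<phi> where \<phi>: "inj_on \<phi> Cv" "\<phi> ` Cv \<subseteq> V" "\<And>f. f \<in> edges F \<Longrightarrow> \<phi> ` Old ` f \<in> E'"
      "\<And>x y. x \<in> Cv \<Longrightarrow> y \<in> Cv \<Longrightarrow> x \<noteq> y \<Longrightarrow> \<exists>e\<in>E'. \<phi> x \<in> e \<and> \<phi> y \<in> e"
      using has_coreE[OF V] by blast
    have "contains_copy (Hypergraph V E) HH"
    proof (rule robust_extension[OF V E \<phi>(1,2)])
      show "\<phi> ` Old ` f \<in> E" if "f \<in> edges F" for f using \<phi>(3)[OF that] by (simp add: E'_def)
      show "robust V E (\<phi> x) (\<phi> y)" if "x \<in> Cv" "y \<in> Cv" "x \<noteq> y" for x y
      proof -
        have "\<phi> x \<noteq> \<phi> y" using \<phi>(1) that by (auto dest: inj_onD)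
        then show ?thesis using \<phi>(4)[OF that] by (auto simp: E'_def)
      qed
    qed
    then show False using free by blast
  qed
  moreover have "card E \<le> card E' + room * card V ^ (r - 1)"
  proof (cases "V = {}")
    case True
    then have "E = {}" using E r2 by fastforce
    then show ?thesis by simp
  next
    case False
    define B where "B = {p \<in> V \<times> V. \<not> robust V E (fst p) (snd p)}"
    let ?S = "\<lambda>p. {e\<in>E. fst p \<in> e \<and> snd p \<in> e}"
    have fB: "finite B" using V by (simp add: B_def)
    have "E - E' \<subseteq> (\<Union>p\<in>B. ?S p)"
    proof
      fix e assume "e \<in> E - E'"
      then obtain u v where uv: "e \<in> E" "u \<in> e" "v \<in> e" "\<not> robust V E u v" by (auto simp: E'_def)
      then have "(u, v) \<in> B" using E[OF uv(1)] by (auto simp: B_def)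
      then show "e \<in> (\<Union>p\<in>B. ?S p)" using uv by force
    qed
    then have "card (E - E') \<le> card (\<Union>p\<in>B. ?S p)" using fB fE by (intro card_mono) auto
    also have "\<dots> \<le> (\<Sum>p\<in>B. card (?S p))" using fB by (rule card_UN_le)
    finally have "card (E - E') * card V \<le> (\<Sum>p\<in>B. card (?S p) * card V)"
      unfolding sum_distrib_right[symmetric] by (rule mult_right_mono) simp
    also have "\<dots> \<le> (\<Sum>p\<in>B. room * card V ^ (r - 2))"
      by (rule sum_mono) (auto simp: B_def robust_def)
    also have "\<dots> = card B * (room * card V ^ (r - 2))" by simp
    also have "\<dots> \<le> (card V * card V) * (room * card V ^ (r - 2))"
    proof (rule mult_right_mono)
      have "card B \<le> card (V \<times> V)" unfolding B_def using V by (intro card_mono) auto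
      then show "card B \<le> card V * card V" by (simp add: card_cartesian_product)
    qed simp
    also have "\<dots> = room * (card V * card V ^ (r - 2)) * card V" by simp
    also have "card V * card V ^ (r - 2) = card V ^ (r - 1)"
    proof -
      have "r - 1 = Suc (r - 2)" using r2 by simp
      then show ?thesis by simp
    qed
    finally have "card (E - E') * card V \<le> room * card V ^ (r - 1) * card V" .
    moreover have "card V > 0" using V False by (simp add: card_gt_0_iff)
    ultimately have "card (E - E') \<le> room * card V ^ (r - 1)" by simp
    moreover have "card E = card E' + card (E - E')"
    proof -
      have "E' \<subseteq> E" by (auto simp: E'_def)
      then show ?thesis using fE by (metis card_Diff_subset card_mono finite_subset le_add_diff_inverse)
    qed
    ultimately show ?thesis by simp
  qed
  ultimately show ?thesis by (intro exI[of _ E']) (auto simp: E'_def)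
qed

end

section \<open>Symmetrization\<close>

definition link :: "'v set set \<Rightarrow> 'v \<Rightarrow> 'v set set" where
  "link E x = (\<lambda>e. e - {x}) ` {e\<in>E. x \<in> e}"

text \<open>Zykov symmetrization: \<open>v\<close> gives up its own edges and becomes a twin of
  \<open>u\<close>.\<close>

definition clone :: "'v set set \<Rightarrow> 'v \<Rightarrow> 'v \<Rightarrow> 'v set set" where
  "clone E u v = {e\<in>E. v \<notin> e} \<union> (\<lambda>e. insert v (e - {u})) ` {e\<in>E. u \<in> e}"

lemma link_iff: "s \<in> link E x \<longleftrightarrow> x \<notin> s \<and> insert x s \<in> E"
proof
  assume "s \<in> link E x"
  then obtain e where "e \<in> E" "x \<in> e" "s = e - {x}" by (auto simp: link_def)
  then show "x \<notin> s \<and> insert x s \<in> E" by (simp add: insert_absorb)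
next
  assume "x \<notin> s \<and> insert x s \<in> E"
  then show "s \<in> link E x" unfolding link_def by (intro image_eqI[of _ _ "insert x s"]) auto
qed

text \<open>A vertex lies in no set of its own link. Hence every edge meets a class of twins at most
  once, and twin classes can serve as parts.\<close>

lemma link_eq_uncovered:
  assumes "link E x = link E y" "e \<in> E" "x \<in> e" "y \<in> e"
  shows "x = y"
proof (rule ccontr)
  assume "x \<noteq> y"
  have "e - {x} \<in> link E x" using assms by (auto simp: link_def)
  then have "y \<notin> e - {x}" unfolding assms(1) link_iff by simp
  then show False using assms(4) \<open>x \<noteq> y\<close> by simp
qed

context
  fixes E :: "'v set set" and u v :: 'v
  assumes uv: "u \<noteq> v" "\<And>e. e \<in> E \<Longrightarrow> \<not> (u \<in> e \<and> v \<in> e)"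
begin

lemma clone_avoiding: "{e \<in> clone E u v. v \<notin> e} = {e\<in>E. v \<notin> e}"
  by (auto simp: clone_def)

lemma clone_uniform:
  assumes "finite V" "u \<in> V" "v \<in> V" "\<And>e. e \<in> E \<Longrightarrow> e \<subseteq> V \<and> card e = r" "e \<in> clone E u v"
  shows "e \<subseteq> V \<and> card e = r"
proof (cases "e \<in> E")
  case True
  then show ?thesis using assms(4) by blast
next
  case False
  then obtain f where f: "f \<in> E" "u \<in> f" "e = insert v (f - {u})" using assms(5) by (auto simp: clone_def)
  have "finite f" using assms(1,4) f(1) finite_subset by blast
  moreover have "v \<notin> f" using uv(2)[OF f(1)] f(2) by blast
  ultimately have "card e = Suc (card (f - {u}))" using f(3) by simp
  then have "card e = card f" using card_Suc_Diff1[OF \<open>finite f\<close> f(2)] by simp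
  then show ?thesis using assms(3,4) f by auto
qed

lemma link_clone_v: "link (clone E u v) v = link E u"
proof (intro set_eqI iffI)
  fix s assume "s \<in> link (clone E u v) v"
  then have s: "v \<notin> s" "insert v s \<in> clone E u v" by (auto simp: link_iff)
  then obtain e where e: "e \<in> E" "u \<in> e" "insert v s = insert v (e - {u})" by (auto simp: clone_def)
  have "v \<notin> e" using uv(2)[OF e(1)] e(2) by blast
  then have "s = e - {u}" using e(3) s(1) by (metis Diff_iff insert_ident)
  then show "s \<in> link E u" using e by (auto simp: link_def)
next
  fix s assume "s \<in> link E u"
  then have s: "u \<notin> s" "insert u s \<in> E" by (auto simp: link_iff)
  then have "v \<notin> s" using uv(2)[OF s(2)] by blast
  moreover have "insert v s \<in> clone E u v"
    unfolding clone_def using s by (intro UnI2 image_eqI[of _ _ "insert u s"]) auto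
  ultimately show "s \<in> link (clone E u v) v" by (simp add: link_iff)
qed

text \<open>The new link of a vertex other than \<open>v\<close> is a function of its old link, so
  twins among these vertices remain twins.\<close>

lemma link_clone:
  assumes "x \<noteq> v"
  shows "link (clone E u v) x =
    {s \<in> link E x. v \<notin> s} \<union> (\<lambda>s. insert v (s - {u})) ` {s \<in> link E x. u \<in> s}" (is "?L = ?R")
proof (intro set_eqI iffI)
  fix s assume "s \<in> ?L"
  then have s: "x \<notin> s" "insert x s \<in> clone E u v" by (auto simp: link_iff)
  show "s \<in> ?R"
  proof (cases "v \<in> s")
    case False
    then have "insert x s \<in> E" using s(2) assms by (auto simp: clone_def)
    then show ?thesis using False s by (auto simp: link_iff)
  next
    case True
    then obtain e where e: "e \<in> E" "u \<in> e" "insert x s = insert v (e - {u})" using s(2) by (auto simp: clone_def)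
    have ve: "v \<notin> e" using uv(2)[OF e(1)] e(2) by blast
    have x: "x \<in> e" "x \<noteq> u" using e(3) assms by auto
    have "s = insert v ((e - {x}) - {u})" using e(3) s(1) ve assms by auto
    moreover have "e - {x} \<in> link E x" "u \<in> e - {x}" using e x by (auto simp: link_def)
    ultimately show ?thesis by blast
  qed
next
  fix s assume "s \<in> ?R"
  then consider "s \<in> link E x" "v \<notin> s" | t where "t \<in> link E x" "u \<in> t" "s = insert v (t - {u})" by blast
  then show "s \<in> ?L"
  proof cases
    case 1
    then show ?thesis using assms by (auto simp: link_iff clone_def)
  next
    case 2
    then have t: "x \<notin> t" "insert x t \<in> E" by (auto simp: link_iff)
    have "x \<noteq> u" using 2 t by auto
    then have "insert x s = insert v (insert x t - {u})" using 2 t assms by auto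
    then have "insert x s \<in> clone E u v" unfolding clone_def using 2 t by blast
    moreover have "x \<notin> s" using 2 t assms by auto
    ultimately show ?thesis by (simp add: link_iff)
  qed
qed

lemma link_clone_u: "link (clone E u v) u = link E u"
proof -
  have "v \<notin> s" "u \<notin> s" if "s \<in> link E u" for s
    using that uv(2)[of "insert u s"] by (auto simp: link_iff)
  then show ?thesis unfolding link_clone[OF uv(1)] by blast
qed

lemma card_clone:
  assumes "finite E"
  shows "card (clone E u v) + card {e\<in>E. v \<in> e} = card E + card {e\<in>E. u \<in> e}"
proof -
  let ?g = "\<lambda>e. insert v (e - {u})"
  have "inj_on ?g {e\<in>E. u \<in> e}"
  proof (rule inj_onI)
    fix e f assume ef: "e \<in> {e\<in>E. u \<in> e}" "f \<in> {e\<in>E. u \<in> e}" "?g e = ?g f"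
    then have "v \<notin> e" "v \<notin> f" using uv(2) by auto
    then have "e - {u} = f - {u}" using ef(3) by (metis Diff_iff insert_ident)
    then show "e = f" using ef(1,2) by (metis (no_types, lifting) insert_Diff mem_Collect_eq)
  qed
  then have "card (?g ` {e\<in>E. u \<in> e}) = card {e\<in>E. u \<in> e}" by (rule card_image)
  moreover have "card (clone E u v) = card {e\<in>E. v \<notin> e} + card (?g ` {e\<in>E. u \<in> e})"
    unfolding clone_def using assms by (intro card_Un_disjoint) auto
  moreover have "card E = card {e\<in>E. v \<notin> e} + card {e\<in>E. v \<in> e}"
  proof -
    have "card ({e\<in>E. v \<notin> e} \<union> {e\<in>E. v \<in> e}) = card {e\<in>E. v \<notin> e} + card {e\<in>E. v \<in> e}"
      using assms by (intro card_Un_disjoint) auto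
    moreover have "{e\<in>E. v \<notin> e} \<union> {e\<in>E. v \<in> e} = E" by auto
    ultimately show ?thesis by simp
  qed
  ultimately show ?thesis by simp
qed

end

section \<open>Twin pairs as a secondary potential\<close>

definition twins :: "('v \<Rightarrow> 'b) \<Rightarrow> 'v set \<Rightarrow> ('v \<times> 'v) set" where
  "twins g V = {p \<in> V \<times> V. g (fst p) = g (snd p)}"

text \<open>The pairs with first and those with second entry \<open>v\<close> overlap in the pair
  (v, v), hence the 1.\<close>

lemma card_twins_split:
  assumes "finite V" "v \<in> V"
  shows "card (twins g V) + 1 = card (twins g (V - {v})) + 2 * card {y\<in>V. g y = g v}"
proof -
  let ?C = "{y\<in>V. g y = g v}"
  let ?A = "twins g (V - {v})"
  have fA: "finite ?A" unfolding twins_def using assms(1) by simp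
  have "twins g V = ?A \<union> ({v} \<times> ?C \<union> (?C - {v}) \<times> {v})"
    using assms(2) by (auto simp: twins_def)
  moreover have "card (?A \<union> ({v} \<times> ?C \<union> (?C - {v}) \<times> {v})) = card ?A + card ({v} \<times> ?C \<union> (?C - {v}) \<times> {v})"
    using assms(1) fA by (intro card_Un_disjoint) (auto simp: twins_def)
  moreover have "card ({v} \<times> ?C \<union> (?C - {v}) \<times> {v}) = card ({v} \<times> ?C) + card ((?C - {v}) \<times> {v})"
    using assms(1) by (intro card_Un_disjoint) auto
  moreover have "card ({v} \<times> ?C) = card ?C" "card ((?C - {v}) \<times> {v}) = card ?C - 1"
    using assms by (simp_all add: card_cartesian_product)
  moreover have "card ?C \<ge> 1" using assms by (auto simp: Suc_le_eq card_gt_0_iff)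
  ultimately show ?thesis by simp
qed

lemma card_twins_le: "finite V \<Longrightarrow> card (twins g V) \<le> card V * card V"
proof -
  assume V: "finite V"
  then have "card (twins g V) \<le> card (V \<times> V)" unfolding twins_def by (intro card_mono) auto
  then show ?thesis by (simp add: card_cartesian_product)
qed

text \<open>Twin pairs avoiding \<open>v\<close> survive, and \<open>v\<close> moves from its class
  to that of \<open>u\<close>, which was at least as large and now also contains
  \<open>v\<close>.\<close>

lemma card_twins_clone:
  assumes "finite V" "u \<in> V" "v \<in> V" "u \<noteq> v" "\<And>e. e \<in> E \<Longrightarrow> \<not> (u \<in> e \<and> v \<in> e)"
    and "link E u \<noteq> link E v" "card {y\<in>V. link E y = link E v} \<le> card {y\<in>V. link E y = link E u}"
  shows "card (twins (link E) V) < card (twins (link (clone E u v)) V)"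
proof -
  let ?E' = "clone E u v"
  have eq: "link ?E' x = link ?E' y" if "x \<noteq> v" "y \<noteq> v" "link E x = link E y" for x y
    using link_clone[OF assms(4,5) that(1)] link_clone[OF assms(4,5) that(2)] that(3) by simp
  have "twins (link E) (V - {v}) \<subseteq> twins (link ?E') (V - {v})"
  proof
    fix p assume "p \<in> twins (link E) (V - {v})"
    then have p: "fst p \<in> V - {v}" "snd p \<in> V - {v}" "link E (fst p) = link E (snd p)"
      by (auto simp: twins_def)
    then have "link ?E' (fst p) = link ?E' (snd p)" by (intro eq) auto
    then show "p \<in> twins (link ?E') (V - {v})" using p unfolding twins_def by (simp add: mem_Times_iff)
  qed
  moreover have "finite (twins (link ?E') (V - {v}))" unfolding twins_def using assms(1) by simp
  ultimately have 1: "card (twins (link E) (V - {v})) \<le> card (twins (link ?E') (V - {v}))" by (intro card_mono)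
  have "insert v {y\<in>V. link E y = link E u} \<subseteq> {y\<in>V. link ?E' y = link ?E' v}"
  proof -
    have "link ?E' y = link ?E' v" if "y \<in> V" "link E y = link E u" for y
    proof -
      have "y \<noteq> v" using that assms(6) by auto
      then have "link ?E' y = link ?E' u" using eq[of y u] that assms(4) by simp
      then show ?thesis using link_clone_u[OF assms(4,5)] link_clone_v[OF assms(4,5)] by simp
    qed
    then show ?thesis using assms(3) by auto
  qed
  then have "card (insert v {y\<in>V. link E y = link E u}) \<le> card {y\<in>V. link ?E' y = link ?E' v}"
    using assms(1) by (intro card_mono) auto
  moreover have "card (insert v {y\<in>V. link E y = link E u}) = Suc (card {y\<in>V. link E y = link E u})"
    using assms(1,6) by (intro card_insert_disjoint) auto
  ultimately have 2: "card {y\<in>V. link E y = link E v} < card {y\<in>V. link ?E' y = link ?E' v}"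
    using assms(7) by simp
  show ?thesis
    using card_twins_split[OF assms(1,3), of "link E"] card_twins_split[OF assms(1,3), of "link ?E'"] 1 2
    by simp
qed

text \<open>Maclaurin's inequality once more; it supplies the boundedness that both suprema in the
  Lagrangian density need.\<close>

lemma lagrange_poly_le_1:
  assumes "r_graph r G" "verts G \<noteq> {}" "\<And>i. i \<in> verts G \<Longrightarrow> x i \<ge> 0" "sum x (verts G) = 1"
  shows "lagrange_poly r G x \<le> 1"
proof -
  let ?V = "verts G"
  have fV: "finite ?V" using assms(1) by (simp add: r_graph_def)
  have "(\<Sum>e\<in>edges G. \<Prod>i\<in>e. x i) \<le> esym r ?V x"
    unfolding esym_def using assms(1,3) fV
    by (intro sum_mono2) (auto simp: r_graph_def intro!: prod_nonneg)
  also have "\<dots> \<le> real (card ?V choose r) * (1 / real (card ?V)) ^ r"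
    using maclaurin_esym[OF fV assms(2), of x r] assms(3,4) by simp
  finally have "lagrange_poly r G x \<le> fact r * (real (card ?V choose r) * (1 / real (card ?V)) ^ r)"
    unfolding lagrange_poly_def by (intro mult_left_mono) auto
  also have "\<dots> = real ((card ?V choose r) * fact r) / real (card ?V) ^ r"
    by (simp add: power_divide)
  also have "\<dots> \<le> real (card ?V ^ r) / real (card ?V) ^ r"
    by (intro divide_right_mono) (simp_all only: of_nat_le_iff binomial_fact_pow, simp)
  also have "\<dots> = 1" using fV assms(2) by simp
  finally show ?thesis .
qed

lemma lagrange_poly_le_density:
  fixes G :: "nat hypergraph"
  assumes "r_graph r G" "verts G \<noteq> {}" "\<And>i. i \<in> verts G \<Longrightarrow> x i \<ge> 0" "sum x (verts G) = 1"
    and "\<not> contains_copy G F"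
  shows "lagrange_poly r G x \<le> lagrangian_density r F"
proof -
  let ?L = "\<lambda>G :: nat hypergraph. {lagrange_poly r G x | x. (\<forall>i\<in>verts G. x i \<ge> 0) \<and> (\<Sum>i\<in>verts G. x i) = 1}"
  have le1: "y \<le> 1" if "y \<in> ?L G" "r_graph r G" "verts G \<noteq> {}" for y and G :: "nat hypergraph"
    using that lagrange_poly_le_1[OF that(2,3)] by auto
  have L1: "lagrangian r G \<le> 1" if G: "r_graph r G" "verts G \<noteq> {}" for G :: "nat hypergraph"
  proof -
    obtain v where v: "v \<in> verts G" using G(2) by blast
    have "finite (verts G)" using G by (simp add: r_graph_def)
    then have "(\<Sum>i\<in>verts G. if i = v then 1 else 0 :: real) = 1" using v by simp
    then have "lagrange_poly r G (\<lambda>i. if i = v then 1 else 0) \<in> ?L G" by fastforce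
    then show ?thesis unfolding lagrangian_def using le1 G by (intro cSup_least) blast+
  qed
  have "lagrange_poly r G x \<le> lagrangian r G"
    unfolding lagrangian_def
  proof (rule cSup_upper)
    show "lagrange_poly r G x \<in> ?L G" using assms by blast
    show "bdd_above (?L G)" using le1 assms by (intro bdd_aboveI[of _ 1]) blast
  qed
  also have "\<dots> \<le> lagrangian_density r F"
    unfolding lagrangian_density_def
  proof (rule cSup_upper)
    show "lagrangian r G \<in> insert 0 {lagrangian r G | G :: nat hypergraph.
           r_graph r G \<and> verts G \<noteq> {} \<and> \<not> contains_copy G F}"
      using assms by blast
    show "bdd_above (insert 0 {lagrangian r G | G :: nat hypergraph.
           r_graph r G \<and> verts G \<noteq> {} \<and> \<not> contains_copy G F})"
      using L1 by (intro bdd_aboveI[of _ 1]) auto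
  qed
  finally show ?thesis .
qed

text \<open>Exchanging a single vertex of an edge for a twin yields an edge again; doing so
  repeatedly reaches the image under \<rho>.\<close>

lemma twin_image_edge:
  assumes "finite e" "e \<in> E" "\<And>x. x \<in> V \<Longrightarrow> \<rho> x \<in> V \<and> link E (\<rho> x) = link E x" "\<And>e. e \<in> E \<Longrightarrow> e \<subseteq> V"
    and "\<And>x. x \<in> V \<Longrightarrow> \<rho> (\<rho> x) = \<rho> x"
  shows "\<rho> ` e \<in> E"
  using assms(1,2)
proof (induction "card {x\<in>e. \<rho> x \<noteq> x}" arbitrary: e rule: less_induct)
  case less
  show ?case
  proof (cases "\<exists>x\<in>e. \<rho> x \<noteq> x")
    case False
    then have "\<rho> ` e = e" by force
    then show ?thesis using less by simp
  next
    case True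
    then obtain x where x: "x \<in> e" "\<rho> x \<noteq> x" by blast
    have xV: "x \<in> V" using x less assms(4) by blast
    define f where "f = insert (\<rho> x) (e - {x})"
    have "e - {x} \<in> link E x" using x less by (auto simp: link_def)
    then have "e - {x} \<in> link E (\<rho> x)" using assms(3)[OF xV] by simp
    then have fE: "f \<in> E" by (simp add: link_iff f_def)
    have \<rho>\<rho>: "\<rho> (\<rho> x) = \<rho> x" using assms(5)[OF xV] .
    have "{y\<in>f. \<rho> y \<noteq> y} \<subseteq> {y\<in>e. \<rho> y \<noteq> y} - {x}" using \<rho>\<rho> by (auto simp: f_def)
    moreover have "x \<in> {y\<in>e. \<rho> y \<noteq> y}" using x by simp
    ultimately have "{y\<in>f. \<rho> y \<noteq> y} \<subset> {y\<in>e. \<rho> y \<noteq> y}" by blast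
    then have "card {y\<in>f. \<rho> y \<noteq> y} < card {y\<in>e. \<rho> y \<noteq> y}" using less by (intro psubset_card_mono) auto
    moreover have "finite f" using less by (simp add: f_def)
    ultimately have "\<rho> ` f \<in> E" using less fE by blast
    moreover have "\<rho> ` f = \<rho> ` e" using \<rho>\<rho> x by (auto simp: f_def)
    ultimately show ?thesis by simp
  qed
qed

section \<open>Symmetrization of core-free graphs\<close>

context extension_host
begin

abbreviation "uniform V E \<equiv> (\<forall>e\<in>E. e \<subseteq> V \<and> card e = r)"

lemma uniform_finite:
  assumes "finite V" "uniform V E"
  shows "finite E"
proof -
  have "E \<subseteq> Pow V" using assms(2) by auto
  then show ?thesis using assms(1) by (meson finite_Pow_iff finite_subset)
qed

lemma has_core_mono:
  assumes "has_core V1 E1" "V1 \<subseteq> V" "E1 \<subseteq> E"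
  shows "has_core V E"
proof -
  obtain C where C: "C \<subseteq> V1" "card C = m + 1" "contains_copy (induced (Hypergraph V1 E1) C) F"
    "\<forall>u\<in>C. \<forall>v\<in>C. u \<noteq> v \<longrightarrow> (\<exists>e\<in>E1. u \<in> e \<and> v \<in> e)"
    using assms(1) by (auto simp: has_core_def)
  have "contains_copy (induced (Hypergraph V E) C) F"
    using C(3) assms(3) unfolding contains_copy_def induced_def by fastforce
  moreover have "C \<subseteq> V" using C(1) assms(2) by (rule order_trans)
  moreover have "\<forall>u\<in>C. \<forall>v\<in>C. u \<noteq> v \<longrightarrow> (\<exists>e\<in>E. u \<in> e \<and> v \<in> e)"
    using C(4) assms(3) by (meson subsetD)
  ultimately show ?thesis unfolding has_core_def using C(2) by (intro exI[of _ C] conjI)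
qed

text \<open>Folding \<open>v\<close> onto \<open>u\<close> maps new edges to old ones. It is
  injective on a core, because \<open>u\<close> and \<open>v\<close> stay uncovered and a core
  cannot contain both.\<close>

lemma has_core_clone:
  assumes uv: "u \<noteq> v" "u \<in> V" "\<And>e. e \<in> E \<Longrightarrow> \<not> (u \<in> e \<and> v \<in> e)"
    and core: "has_core V (clone E u v)"
  shows "has_core V E"
proof -
  obtain C where C: "C \<subseteq> V" "card C = m + 1" "contains_copy (induced (Hypergraph V (clone E u v)) C) F"
    and cov: "\<And>x y. x \<in> C \<Longrightarrow> y \<in> C \<Longrightarrow> x \<noteq> y \<Longrightarrow> \<exists>e\<in>clone E u v. x \<in> e \<and> y \<in> e"
    using core by (auto simp: has_core_def)
  define \<tau> where "\<tau> x = (if x = v then u else x)" for x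
  have \<tau>E: "\<tau> ` e \<in> E" if e: "e \<in> clone E u v" for e
  proof (cases "v \<in> e")
    case False
    then have "\<tau> ` e = e" "e \<in> E" using e by (auto simp: \<tau>_def clone_def image_iff)
    then show ?thesis by simp
  next
    case True
    then obtain f where f: "f \<in> E" "u \<in> f" "e = insert v (f - {u})" using e by (auto simp: clone_def)
    have "v \<notin> f" using uv(3)[OF f(1)] f(2) by blast
    then have "\<tau> ` e = f" unfolding f(3) using f(2) by (auto simp: \<tau>_def image_iff)
    then show ?thesis using f by simp
  qed
  have "\<not> (u \<in> C \<and> v \<in> C)"
  proof
    assume "u \<in> C \<and> v \<in> C"
    then obtain e where e: "e \<in> clone E u v" "u \<in> e" "v \<in> e" using cov[of u v] uv(1) by blast
    then show False using uv by (auto simp: clone_def)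
  qed
  then have inj: "inj_on \<tau> C" by (auto simp: inj_on_def \<tau>_def)
  from C(3) obtain f where f: "inj_on f (verts F)" "f ` verts F \<subseteq> C"
    "\<And>e. e \<in> edges F \<Longrightarrow> f ` e \<in> clone E u v \<and> f ` e \<subseteq> C"
    by (auto simp: contains_copy_def induced_def)
  show ?thesis
    unfolding has_core_def
  proof (intro exI[of _ "\<tau> ` C"] conjI ballI impI)
    show "\<tau> ` C \<subseteq> V" using C(1) uv(2) by (auto simp: \<tau>_def)
    show "card (\<tau> ` C) = m + 1" using inj C(2) by (simp add: card_image)
    show "contains_copy (induced (Hypergraph V E) (\<tau> ` C)) F"
      unfolding contains_copy_def induced_def
    proof (intro exI[of _ "\<tau> \<circ> f"] conjI ballI)
      show "inj_on (\<tau> \<circ> f) (verts F)" using f inj by (meson comp_inj_on inj_on_subset)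
      show "(\<tau> \<circ> f) ` verts F \<subseteq> verts (Hypergraph (\<tau> ` C) {e \<in> edges (Hypergraph V E). e \<subseteq> \<tau> ` C})"
        using f(2) by auto
      show "(\<tau> \<circ> f) ` e \<in> edges (Hypergraph (\<tau> ` C) {e \<in> edges (Hypergraph V E). e \<subseteq> \<tau> ` C})"
        if "e \<in> edges F" for e
        using f(3)[OF that] \<tau>E[of "f ` e"] by (auto simp flip: image_image)
    qed
    fix p q assume "p \<in> \<tau> ` C" "q \<in> \<tau> ` C" "p \<noteq> q"
    then obtain x y where xy: "x \<in> C" "y \<in> C" "p = \<tau> x" "q = \<tau> y" "x \<noteq> y" by blast
    then obtain e where "e \<in> clone E u v" "x \<in> e" "y \<in> e" using cov[of x y] by blast
    then show "\<exists>e\<in>E. p \<in> e \<and> q \<in> e" using \<tau>E[of e] xy by blast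
  qed
qed

definition symmetric_graph :: "nat set \<Rightarrow> nat set set \<Rightarrow> bool" where
  "symmetric_graph V E \<longleftrightarrow>
    (\<forall>u\<in>V. \<forall>v\<in>V. u \<noteq> v \<and> (\<forall>e\<in>E. \<not> (u \<in> e \<and> v \<in> e)) \<longrightarrow> link E u = link E v)"

text \<open>Replacing a vertex by a clone of an uncovered one of larger degree (or, in case of a tie,
  with more twins) increases the number of edges (or the number of twin pairs). Only one vertex
  changes in each step, which is what allows a partition to be pulled back.\<close>

lemma symmetrization_induct [consumes 3, case_names symmetric step]:
  assumes "finite V" "uniform V E" "\<not> has_core V E"
    and base: "\<And>E. uniform V E \<Longrightarrow> \<not> has_core V E \<Longrightarrow> symmetric_graph V E \<Longrightarrow> P E"
    and step: "\<And>E E' v. uniform V E \<Longrightarrow> \<not> has_core V E \<Longrightarrow> uniform V E' \<Longrightarrow> \<not> has_core V E' \<Longrightarrow> v \<in> V \<Longrightarrow>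
      {e\<in>E. v \<notin> e} = {e\<in>E'. v \<notin> e} \<Longrightarrow> card E \<le> card E' \<Longrightarrow> P E' \<Longrightarrow> P E"
  shows "P E"
proof -
  \<comment> \<open>\<open>q\<close> exceeds every possible number of twin pairs, so
    \<open>pot\<close> compares edge numbers first and twin pairs second. It is bounded on
    \<open>V\<close>, and the induction runs on the distance to the bound.\<close>
  define q where "q = card V * card V + 1"
  define pot where "pot E = card E * q + card (twins (link E) V)" for E
  have potb: "pot E \<le> 2 ^ card V * q + q" if "uniform V E" for E
  proof -
    have "E \<subseteq> Pow V" using that by auto
    then have "card E \<le> 2 ^ card V" using assms(1) by (metis card_Pow card_mono finite_Pow_iff)
    then have "card E * q \<le> 2 ^ card V * q" by (rule mult_right_mono) simp
    moreover have "card (twins (link E) V) \<le> q" using card_twins_le[OF assms(1), of "link E"] by (simp add: q_def)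
    ultimately show ?thesis unfolding pot_def by (rule add_mono)
  qed
  show ?thesis
    using assms(2,3)
  proof (induction "2 ^ card V * q + q - pot E" arbitrary: E rule: less_induct)
    case less
    have fE: "finite E" using uniform_finite[OF assms(1)] less by blast
    show ?case
    proof (cases "symmetric_graph V E")
      case True
      then show ?thesis using base less by blast
    next
      case False
      define d where "d x = card {e\<in>E. x \<in> e}" for x
      define k where "k x = card {y\<in>V. link E y = link E x}" for x
      obtain u0 v0 where uv0: "u0 \<in> V" "v0 \<in> V" "u0 \<noteq> v0" "\<forall>e\<in>E. \<not> (u0 \<in> e \<and> v0 \<in> e)" "link E u0 \<noteq> link E v0"
        using False unfolding symmetric_graph_def by blast
      obtain u v where uv: "u \<in> V" "v \<in> V" "u \<noteq> v" "\<And>e. e \<in> E \<Longrightarrow> \<not> (u \<in> e \<and> v \<in> e)" "link E u \<noteq> link E v"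
        and gt: "d v < d u \<or> d v = d u \<and> k v \<le> k u"
      proof (cases "d v0 < d u0 \<or> d v0 = d u0 \<and> k v0 \<le> k u0")
        case True
        then show ?thesis using that[of u0 v0] uv0 by blast
      next
        case False
        then have "d u0 < d v0 \<or> d u0 = d v0 \<and> k u0 \<le> k v0" by linarith
        then show ?thesis using that[of v0 u0] uv0 by (metis (no_types))
      qed
      let ?E' = "clone E u v"
      have un': "uniform V ?E'" using clone_uniform[OF uv(3,4) assms(1) uv(1,2)] less by blast
      have nc': "\<not> has_core V ?E'" using has_core_clone[OF uv(3,1,4)] less by blast
      have cc: "card ?E' + d v = card E + d u" using card_clone[OF uv(3,4) fE] by (simp add: d_def)
      have tw: "card (twins (link E) V) < q" for E :: "nat set set"
        using card_twins_le[OF assms(1), of "link E"] by (simp add: q_def)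
      have "pot E < pot ?E'"
      proof (cases "d v < d u")
        case True
        then have "card ?E' \<ge> Suc (card E)" using cc by simp
        then have "Suc (card E) * q \<le> card ?E' * q" by (rule mult_right_mono) simp
        then show ?thesis using tw[of E] by (simp add: pot_def)
      next
        case False
        then have "d v = d u" "k v \<le> k u" using gt by auto
        then show ?thesis
          using card_twins_clone[OF assms(1) uv] cc by (simp add: pot_def k_def)
      qed
      then have "2 ^ card V * q + q - pot ?E' < 2 ^ card V * q + q - pot E"
        using potb[OF un'] by linarith
      then have "P ?E'" using less(1) un' nc' by blast
      moreover have "card E \<le> card ?E'" using cc gt by linarith
      ultimately show ?thesis
        using step[of E ?E' v] less un' nc' uv(2) clone_avoiding[OF uv(3,4)] by blast
    qed
  qed
qed

text \<open>If there are at most \<open>m\<close> twin classes, they are the parts. Otherwise one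
  representative per class spans an \<open>F\<close>-free graph, and all edges lie in its blow-up by
  the class sizes, so their number is controlled by a value of its Lagrange polynomial.\<close>

lemma symmetric_cases:
  assumes V: "finite V" and E: "uniform V E" and nc: "\<not> has_core V E" and sym: "symmetric_graph V E"
  shows "(\<exists>c. (\<forall>x\<in>V. c x < m) \<and> (\<forall>e\<in>E. inj_on c e)) \<or>
    fact r * real (card E) \<le> lagrangian_density r F * real (card V) ^ r"
proof (cases "card (link E ` V) \<le> m")
  case True
  then have "card (link E ` V) \<le> card {..<m}" by simp
  then obtain \<iota> where \<iota>: "inj_on \<iota> (link E ` V)" "\<iota> ` link E ` V \<subseteq> {..<m}"
    using inj_on_iff_card_le[of "link E ` V" "{..<m}"] V by auto
  have "inj_on (\<iota> \<circ> link E) e" if e: "e \<in> E" for e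
  proof (rule inj_onI)
    fix x y assume xy: "x \<in> e" "y \<in> e" "(\<iota> \<circ> link E) x = (\<iota> \<circ> link E) y"
    have "x \<in> V" "y \<in> V" using xy e E by auto
    then have "link E x = link E y" using xy(3) \<iota>(1) by (auto dest: inj_onD)
    then show "x = y" using link_eq_uncovered[of E x y e] e xy by blast
  qed
  then show ?thesis using \<iota>(2) by (intro disjI1 exI[of _ "\<iota> \<circ> link E"]) auto
next
  case False
  define \<rho> where "\<rho> x = inv_into V (link E) (link E x)" for x
  have \<rho>: "\<rho> x \<in> V" "link E (\<rho> x) = link E x" if "x \<in> V" for x
    using that by (auto simp: \<rho>_def inv_into_into f_inv_into_f)
  have \<rho>\<rho>: "\<rho> (\<rho> x) = \<rho> x" if "x \<in> V" for x using \<rho>(2)[OF that] by (simp add: \<rho>_def)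
  define T where "T = \<rho> ` V"
  have TV: "T \<subseteq> V" using \<rho> by (auto simp: T_def)
  have fT: "finite T" using V by (simp add: T_def)
  have T_inj: "x = y" if "x \<in> T" "y \<in> T" "link E x = link E y" for x y
  proof -
    have "\<rho> x = x" "\<rho> y = y" using that \<rho>\<rho> by (auto simp: T_def)
    then show ?thesis using that(3) by (metis \<rho>_def)
  qed
  have "link E ` V \<subseteq> link E ` T"
  proof
    fix l assume "l \<in> link E ` V"
    then obtain y where "y \<in> V" "l = link E (\<rho> y)" using \<rho>(2) by force
    then show "l \<in> link E ` T" by (auto simp: T_def)
  qed
  then have "card (link E ` V) \<le> card (link E ` T)" using fT by (intro card_mono) auto
  also have "\<dots> \<le> card T" using fT by (rule card_image_le)
  finally have cT: "card T \<ge> m + 1" using False by simp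
  define G where "G = Hypergraph T {e\<in>E. e \<subseteq> T}"
  have G: "r_graph r G" using E fT by (auto simp: r_graph_def G_def)
  have Tne: "T \<noteq> {}" using cT by auto
  \<comment> \<open>By symmetry representatives of different classes are covered, so a copy of
    \<open>F\<close> among them, filled up to m + 1 representatives, would be a core.\<close>
  have free: "\<not> contains_copy G F"
  proof
    assume "contains_copy G F"
    then obtain f where f: "inj_on f (verts F)" "f ` verts F \<subseteq> T" "\<And>e. e \<in> edges F \<Longrightarrow> f ` e \<in> E \<and> f ` e \<subseteq> T"
      by (auto simp: contains_copy_def G_def)
    have cf: "card (f ` verts F) = card (verts F)" using f(1) by (rule card_image)
    have "m + 1 - card (verts F) \<le> card (T - f ` verts F)"
      using cT cf f(2) finite_F by (simp add: card_Diff_subset)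
    then obtain S where S: "S \<subseteq> T - f ` verts F" "card S = m + 1 - card (verts F)" "finite S"
      using obtain_subset_with_card_n by metis
    define C where "C = f ` verts F \<union> S"
    have "has_core V E"
      unfolding has_core_def
    proof (intro exI[of _ C] conjI ballI impI)
      have CT: "C \<subseteq> T" using f(2) S(1) by (auto simp: C_def)
      then show "C \<subseteq> V" using TV by blast
      have "card C = card (f ` verts F) + card S"
        unfolding C_def using S finite_F by (intro card_Un_disjoint) auto
      then show "card C = m + 1" using S cf cF by simp
      show "contains_copy (induced (Hypergraph V E) C) F"
        unfolding contains_copy_def induced_def
      proof (intro exI[of _ f] conjI ballI)
        show "f ` verts F \<subseteq> verts (Hypergraph C {e \<in> edges (Hypergraph V E). e \<subseteq> C})"
          by (simp add: C_def)
        show "f ` e \<in> edges (Hypergraph C {e \<in> edges (Hypergraph V E). e \<subseteq> C})" if "e \<in> edges F" for e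
          using f(3)[OF that] image_mono[OF edge_F(1)[OF that], of f] by (auto simp: C_def)
      qed (fact f(1))
      show "\<exists>e\<in>E. u \<in> e \<and> v \<in> e" if uv: "u \<in> C" "v \<in> C" "u \<noteq> v" for u v
      proof (rule ccontr)
        assume "\<not> ?thesis"
        moreover have "u \<in> V" "v \<in> V" using uv CT TV by auto
        ultimately have "link E u = link E v" using sym uv(3) unfolding symmetric_graph_def by blast
        then show False using T_inj uv CT by blast
      qed
    qed
    then show False using nc by blast
  qed
  define n where "n = real (card V)"
  have n0: "n > 0" using Tne TV V by (auto simp: n_def card_gt_0_iff)
  \<comment> \<open>The weight of a representative is the share of its class in
    \<open>V\<close>.\<close>
  define x where "x i = real (card {y\<in>V. \<rho> y = i}) / n" for i
  have sx: "sum x T = 1"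
  proof -
    have "(\<Sum>i\<in>T. card {y\<in>V. \<rho> y = i}) = card V"
      using V fT by (intro sum_card_fibres) (auto simp: T_def)
    then have "(\<Sum>i\<in>T. real (card {y\<in>V. \<rho> y = i})) = n" by (simp add: n_def flip: of_nat_sum)
    then show ?thesis using n0 by (simp add: x_def flip: sum_divide_distrib)
  qed
  have "lagrange_poly r G x \<le> lagrangian_density r F"
    using G Tne sx free n0 by (intro lagrange_poly_le_density) (auto simp: G_def x_def)
  then have lp: "fact r * (\<Sum>e\<in>{e\<in>E. e \<subseteq> T}. \<Prod>i\<in>e. x i) \<le> lagrangian_density r F"
    by (simp add: lagrange_poly_def G_def)
  have fE: "finite E" using uniform_finite[OF V E] .
  \<comment> \<open>Every edge is a transversal of the classes over the edge formed by its
    representatives.\<close>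
  have "E \<subseteq> (\<Union>e0\<in>{e\<in>E. e \<subseteq> T}. {e. e \<subseteq> V \<and> inj_on \<rho> e \<and> \<rho> ` e = e0})"
  proof
    fix e assume e: "e \<in> E"
    have eV: "e \<subseteq> V" using e E by blast
    have "inj_on \<rho> e"
    proof (rule inj_onI)
      fix a b assume ab: "a \<in> e" "b \<in> e" "\<rho> a = \<rho> b"
      then have "link E a = link E b" using \<rho>(2) eV by (metis subsetD)
      then show "a = b" using link_eq_uncovered[of E a b e] e ab by blast
    qed
    moreover have "\<rho> ` e \<in> E"
    proof (rule twin_image_edge[where V = V])
      show "finite e" using eV V finite_subset by blast
    qed (use e E \<rho> \<rho>\<rho> in auto)
    moreover have "\<rho> ` e \<subseteq> T" using eV by (auto simp: T_def)
    ultimately show "e \<in> (\<Union>e0\<in>{e\<in>E. e \<subseteq> T}. {e. e \<subseteq> V \<and> inj_on \<rho> e \<and> \<rho> ` e = e0})" using eV by blast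
  qed
  then have "card E \<le> card (\<Union>e0\<in>{e\<in>E. e \<subseteq> T}. {e. e \<subseteq> V \<and> inj_on \<rho> e \<and> \<rho> ` e = e0})"
    using fE V by (intro card_mono) auto
  also have "\<dots> \<le> (\<Sum>e0\<in>{e\<in>E. e \<subseteq> T}. card {e. e \<subseteq> V \<and> inj_on \<rho> e \<and> \<rho> ` e = e0})"
    using fE by (intro card_UN_le) auto
  also have "\<dots> = (\<Sum>e0\<in>{e\<in>E. e \<subseteq> T}. \<Prod>i\<in>e0. card {y\<in>V. \<rho> y = i})"
    using V fT finite_subset by (intro sum.cong card_transversals) auto
  finally have "real (card E) \<le> (\<Sum>e0\<in>{e\<in>E. e \<subseteq> T}. \<Prod>i\<in>e0. real (card {y\<in>V. \<rho> y = i}))"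
    by (simp flip: of_nat_prod of_nat_sum)
  also have "\<dots> = (\<Sum>e0\<in>{e\<in>E. e \<subseteq> T}. n ^ r * (\<Prod>i\<in>e0. x i))"
  proof (rule sum.cong[OF refl])
    fix e0 assume "e0 \<in> {e\<in>E. e \<subseteq> T}"
    then have c: "card e0 = r" using E by auto
    have "(\<Prod>i\<in>e0. real (card {y\<in>V. \<rho> y = i})) = (\<Prod>i\<in>e0. n * x i)" using n0 by (simp add: x_def)
    also have "\<dots> = n ^ r * (\<Prod>i\<in>e0. x i)" using c by (simp add: prod.distrib)
    finally show "(\<Prod>i\<in>e0. real (card {y\<in>V. \<rho> y = i})) = n ^ r * (\<Prod>i\<in>e0. x i)" .
  qed
  also have "\<dots> = n ^ r * (\<Sum>e0\<in>{e\<in>E. e \<subseteq> T}. \<Prod>i\<in>e0. x i)" by (simp add: sum_distrib_left)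
  finally have "fact r * real (card E) \<le> fact r * (n ^ r * (\<Sum>e0\<in>{e\<in>E. e \<subseteq> T}. \<Prod>i\<in>e0. x i))"
    by (rule mult_left_mono) simp
  also have "\<dots> = (fact r * (\<Sum>e0\<in>{e\<in>E. e \<subseteq> T}. \<Prod>i\<in>e0. x i)) * n ^ r" by simp
  also have "\<dots> \<le> lagrangian_density r F * n ^ r" using lp n0 by (intro mult_right_mono) auto
  finally show ?thesis by (simp add: n_def)
qed

end

section \<open>Stability\<close>

text \<open>A second-order counterpart to Bernoulli's inequality, with a crude but sufficient
  quadratic coefficient; it measures the effect on n^r of removing a fraction t of the
  vertices.\<close>

lemma one_minus_power_le:
  fixes t :: real
  assumes "0 \<le> t" "t \<le> 1"
  shows "(1 - t) ^ k \<le> 1 - real k * t + (real k)\<^sup>2 * t\<^sup>2"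
proof (induction k)
  case 0
  then show ?case by simp
next
  case (Suc k)
  have "(1 - t) ^ Suc k \<le> (1 - real k * t + (real k)\<^sup>2 * t\<^sup>2) * (1 - t)"
    using mult_right_mono[OF Suc, of "1 - t"] assms by (simp add: mult.commute)
  also have "\<dots> = 1 - real (Suc k) * t + (real k + (real k)\<^sup>2) * t\<^sup>2 - (real k)\<^sup>2 * t ^ 3"
    by (simp add: algebra_simps power2_eq_square power3_eq_cube)
  also have "\<dots> \<le> 1 - real (Suc k) * t + (real (Suc k))\<^sup>2 * t\<^sup>2"
  proof -
    have "(real k + (real k)\<^sup>2) * t\<^sup>2 \<le> (real (Suc k))\<^sup>2 * t\<^sup>2"
      by (intro mult_right_mono) (simp_all add: power2_eq_square algebra_simps)
    moreover have "(real k)\<^sup>2 * t ^ 3 \<ge> 0" using assms by simp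
    ultimately show ?thesis by linarith
  qed
  finally show ?case .
qed

lemma falling_factorial_binomial: "falling_factorial m r = fact r * real (m choose r)"
proof -
  have "real (m choose r) = (\<Prod>i = 0..<r. real m - real i) / fact r"
    by (simp add: binomial_gbinomial gbinomial_prod_rev)
  then show ?thesis by (simp add: falling_factorial_def atLeast0LessThan)
qed

context extension_host
begin

lemma density_A: "falling_factorial m r / real m ^ r = fact r * A"
  by (simp add: falling_factorial_binomial A_def)

text \<open>Symmetrization never loses edges, so it suffices to check symmetric graphs, where both
  alternatives give the bound.\<close>

lemma core_free_bound:
  assumes dens: "lagrangian_density r F \<le> fact r * A"
    and V: "finite V" and E: "uniform V E" "\<not> has_core V E"
  shows "real (card E) \<le> A * real (card V) ^ r"
  using V E
proof (induction rule: symmetrization_induct)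
  case (symmetric E)
  from symmetric_cases[OF V symmetric]
  show ?case
  proof (elim disjE exE conjE)
    fix c :: "nat \<Rightarrow> nat"
    assume c: "\<forall>x\<in>V. c x < m" "\<forall>e\<in>E. inj_on c e"
    then have "E \<subseteq> rainbow r V c" using symmetric(1) by (auto simp: rainbow_def)
    then have "card E \<le> card (rainbow r V c)" using V by (intro card_mono) auto
    then show ?thesis using card_rainbow_A[OF V, of c] c(1) by simp
  next
    assume "fact r * real (card E) \<le> lagrangian_density r F * real (card V) ^ r"
    also have "\<dots> \<le> fact r * A * real (card V) ^ r" using dens by (intro mult_right_mono) auto
    finally have "fact r * real (card E) \<le> fact r * (A * real (card V) ^ r)" by (simp only: mult.assoc)
    then show ?thesis by (rule mult_left_le_imp_le) simp
  qed
next
  case (step E E' v)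
  then show ?case by simp
qed

lemma power_split: "real n * real n ^ (r - 1) = real n ^ r"
  using r2 by (simp flip: power_Suc)

lemma card_avoiding_ge:
  assumes "finite V" "uniform V E" "Z \<subseteq> V"
  shows "real (card E) \<le> real (card {e\<in>E. e \<inter> Z = {}}) + real (card Z) * real (card V) ^ (r - 1)"
proof -
  have un: "\<And>e. e \<in> E \<Longrightarrow> e \<subseteq> V \<and> card e = r" using assms(2) by blast
  have "card E = card ({e\<in>E. e \<inter> Z = {}} \<union> {e\<in>E. e \<inter> Z \<noteq> {}})"
    by (rule arg_cong[where f = card]) auto
  also have "\<dots> \<le> card {e\<in>E. e \<inter> Z = {}} + card {e\<in>E. e \<inter> Z \<noteq> {}}" by (rule card_Un_le)
  also have "\<dots> \<le> card {e\<in>E. e \<inter> Z = {}} + card Z * card V ^ (r - 1)"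
    using card_edges_hitting_le[OF assms(1) finite_subset[OF assms(3,1)] un] by (rule add_left_mono)
  finally show ?thesis
    unfolding of_nat_power[symmetric] of_nat_mult[symmetric] of_nat_add[symmetric] of_nat_le_iff .
qed

lemma card_rainbow_edges_ge:
  assumes V: "finite V" and E: "uniform V E" and Z: "Z \<subseteq> V" "real (card Z) \<le> \<zeta> * real (card V)"
    and inj: "\<And>e. e \<in> E \<Longrightarrow> e \<inter> Z = {} \<Longrightarrow> inj_on c e"
    and large: "(A - \<delta>) * real (card V) ^ r \<le> real (card E)"
  shows "(A - \<delta> - \<zeta>) * real (card V) ^ r \<le> real (card (rainbow r V c \<inter> E))"
proof -
  have "{e\<in>E. e \<inter> Z = {}} \<subseteq> rainbow r V c \<inter> E" using E inj by (auto simp: rainbow_def)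
  then have "card {e\<in>E. e \<inter> Z = {}} \<le> card (rainbow r V c \<inter> E)" using V by (intro card_mono) auto
  moreover have "real (card Z) * real (card V) ^ (r - 1) \<le> \<zeta> * real (card V) * real (card V) ^ (r - 1)"
    using Z by (intro mult_right_mono) auto
  moreover have "\<zeta> * real (card V) * real (card V) ^ (r - 1) = \<zeta> * real (card V) ^ r"
    unfolding mult.assoc power_split ..
  moreover have "(A - \<delta> - \<zeta>) * real (card V) ^ r = (A - \<delta>) * real (card V) ^ r - \<zeta> * real (card V) ^ r"
    by (simp add: algebra_simps)
  ultimately show ?thesis using card_avoiding_ge[OF V E Z(1)] large by linarith
qed

text \<open>Removing t n vertices of low degree loses at most t (A' - \<gamma>) n^r edges, while the
  bound for the remaining core-free graph drops by about t A' n^r. The difference t \<gamma> beats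
  the quadratic error B t^2 for suitable t and contradicts the edge count.\<close>

lemma few_low_degree:
  assumes dens: "lagrangian_density r F \<le> fact r * A" and "\<gamma> > 0" "\<zeta> > 0"
  shows "\<exists>\<delta>>0. \<exists>n1. \<forall>V E. finite V \<and> uniform V E \<and> \<not> has_core V E \<and> n1 \<le> card V \<and>
     (A - \<delta>) * real (card V) ^ r \<le> real (card E) \<longrightarrow>
     real (card {v\<in>V. real (card {e\<in>E. v \<in> e}) < (A' - \<gamma>) * real (card V) ^ (r - 1)}) \<le> \<zeta> * real (card V)"
proof -
  define B where "B = A * (real r)\<^sup>2"
  have B0: "B > 0" using A_pos r2 by (simp add: B_def)
  \<comment> \<open>For t between \<zeta>0 and 2 \<zeta>0 this makes B t \<le> \<gamma> / 2, so a
    gain of at least \<zeta>0 \<gamma> / 2 remains, twice the value of \<delta>.\<close>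
  define \<zeta>0 where "\<zeta>0 = min \<zeta> (\<gamma> / (4 * B))"
  have \<zeta>0: "\<zeta>0 > 0" "\<zeta>0 \<le> \<zeta>" "\<zeta>0 \<le> \<gamma> / (4 * B)" using assms B0 by (auto simp: \<zeta>0_def)
  define \<delta> where "\<delta> = \<gamma> * \<zeta>0 / 4"
  have \<delta>0: "\<delta> > 0" using assms \<zeta>0 by (simp add: \<delta>_def)
  define n1 where "n1 = nat \<lceil>1 / \<zeta>0\<rceil> + 1"
  show ?thesis
  proof (rule exI[of _ \<delta>], rule conjI[OF \<delta>0], rule exI[of _ n1], intro allI impI, elim conjE, rule ccontr)
    fix V E
    assume V: "finite V" and E: "uniform V E" and nc: "\<not> has_core V E" and n1: "n1 \<le> card V"
      and large: "(A - \<delta>) * real (card V) ^ r \<le> real (card E)"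
    let ?Z = "{v\<in>V. real (card {e\<in>E. v \<in> e}) < (A' - \<gamma>) * real (card V) ^ (r - 1)}"
    assume "\<not> real (card ?Z) \<le> \<zeta> * real (card V)"
    then have Zl: "real (card ?Z) > \<zeta> * real (card V)" by simp
    define n where "n = real (card V)"
    have n1': "n \<ge> 1" using n1 by (simp add: n1_def n_def)
    have n\<zeta>: "1 \<le> \<zeta>0 * n"
    proof -
      have "1 / \<zeta>0 \<le> n" using n1 unfolding n1_def n_def by linarith
      then show ?thesis using \<zeta>0(1) by (simp add: divide_le_eq mult.commute)
    qed
    have "\<zeta>0 * n \<le> \<zeta> * n" using \<zeta>0(2) n1' by (intro mult_right_mono) auto
    then have "\<zeta>0 * n \<le> real (card ?Z)" using Zl unfolding n_def by linarith
    \<comment> \<open>The whole low-degree set might be too large for the quadratic estimate; only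
      about \<zeta>0 n of its vertices are removed.\<close>
    then have "nat \<lceil>\<zeta>0 * n\<rceil> \<le> card ?Z" by (simp only: nat_ceiling_le_eq)
    from obtain_subset_with_card_n[OF this]
    obtain Z where Z: "Z \<subseteq> ?Z" "card Z = nat \<lceil>\<zeta>0 * n\<rceil>" "finite Z" .
    have ZV: "Z \<subseteq> V" using Z(1) by blast
    define t where "t = real (card Z) / n"
    have z: "real (card Z) = t * n" using n1' by (simp add: t_def)
    have t_ge: "\<zeta>0 \<le> t"
    proof -
      have "\<zeta>0 * n \<le> real (card Z)" unfolding Z(2) by (rule real_nat_ceiling_ge)
      then show ?thesis unfolding z using n1' by simp
    qed
    have t_le: "t \<le> 2 * \<zeta>0"
    proof -
      have "real (card Z) \<le> \<zeta>0 * n + 1" unfolding Z(2) using n\<zeta> by linarith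
      then have "t * n \<le> 2 * \<zeta>0 * n" unfolding z using n\<zeta> by linarith
      then show ?thesis using n1' by simp
    qed
    have t1: "t \<le> 1"
    proof -
      have "real (card Z) \<le> n" unfolding n_def using card_mono[OF V ZV] by simp
      then show ?thesis using n1' by (simp add: t_def)
    qed
    have t0: "0 < t" using t_ge \<zeta>0(1) by simp
    define E0 where "E0 = {e\<in>E. e \<inter> Z = {}}"
    have "real (card E0) \<le> A * real (card (V - Z)) ^ r"
    proof (rule core_free_bound[OF dens])
      show "finite (V - Z)" using V by simp
      show "uniform (V - Z) E0" using E by (auto simp: E0_def)
      show "\<not> has_core (V - Z) E0" using nc has_core_mono[of "V - Z" E0 V E] by (auto simp: E0_def)
    qed
    also have "real (card (V - Z)) = (1 - t) * n"
    proof -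
      have "card (V - Z) = card V - card Z" using Z(3) ZV by (rule card_Diff_subset)
      then have "real (card (V - Z)) = n - real (card Z)" using card_mono[OF V ZV] by (simp add: n_def of_nat_diff)
      then show ?thesis by (simp add: z algebra_simps)
    qed
    also have "A * ((1 - t) * n) ^ r = A * (1 - t) ^ r * n ^ r" by (simp add: power_mult_distrib)
    also have "\<dots> \<le> A * (1 - real r * t + (real r)\<^sup>2 * t\<^sup>2) * n ^ r"
      using one_minus_power_le[of t r] t0 t1 A_pos n1' by (intro mult_right_mono mult_left_mono) auto
    finally have e0: "real (card E0) \<le> A * (1 - real r * t + (real r)\<^sup>2 * t\<^sup>2) * n ^ r" .
    have fE: "finite E" using uniform_finite[OF V E] .
    have "card E \<le> card (E0 \<union> (\<Union>v\<in>Z. {e\<in>E. v \<in> e}))"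
      using fE Z(3) by (intro card_mono) (auto simp: E0_def)
    also have "\<dots> \<le> card E0 + card (\<Union>v\<in>Z. {e\<in>E. v \<in> e})" by (rule card_Un_le)
    also have "\<dots> \<le> card E0 + (\<Sum>v\<in>Z. card {e\<in>E. v \<in> e})" using Z(3) by (intro add_left_mono card_UN_le)
    finally have "real (card E) \<le> real (card E0) + (\<Sum>v\<in>Z. real (card {e\<in>E. v \<in> e}))"
      by (simp flip: of_nat_sum of_nat_add)
    also have "(\<Sum>v\<in>Z. real (card {e\<in>E. v \<in> e})) \<le> (\<Sum>v\<in>Z. (A' - \<gamma>) * n ^ (r - 1))"
      using Z(1) by (intro sum_mono) (auto simp: n_def less_imp_le)
    also have "\<dots> = t * (A' - \<gamma>) * (n * n ^ (r - 1))" by (simp add: z)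
    also have "n * n ^ (r - 1) = n ^ r" using power_split[of "card V"] by (simp add: n_def)
    finally have "real (card E) \<le> A * (1 - real r * t + (real r)\<^sup>2 * t\<^sup>2) * n ^ r + t * (A' - \<gamma>) * n ^ r"
      using e0 by simp
    then have "(A - \<delta>) * n ^ r \<le> (A * (1 - real r * t + (real r)\<^sup>2 * t\<^sup>2) + t * (A' - \<gamma>)) * n ^ r"
      using large by (simp add: n_def algebra_simps)
    then have "A - \<delta> \<le> A * (1 - real r * t + (real r)\<^sup>2 * t\<^sup>2) + t * (A' - \<gamma>)" using n1' by simp
    also have "\<dots> = A + t * (B * t - \<gamma>)"
      by (simp add: A'_eq B_def algebra_simps power2_eq_square)
    finally have "t * (\<gamma> - B * t) \<le> \<delta>" by (simp add: algebra_simps)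
    moreover have "B * t \<le> \<gamma> / 2"
    proof -
      have "B * t \<le> B * (2 * (\<gamma> / (4 * B)))" using t_le \<zeta>0(3) B0 by (intro mult_left_mono) auto
      then show ?thesis using B0 by simp
    qed
    then have "\<zeta>0 * (\<gamma> / 2) \<le> t * (\<gamma> - B * t)" using t_ge \<zeta>0 assms by (intro mult_mono) auto
    ultimately have "\<zeta>0 * (\<gamma> / 2) \<le> \<delta>" by linarith
    then have "\<gamma> * \<zeta>0 \<le> 0" by (simp add: \<delta>_def field_simps)
    moreover have "\<gamma> * \<zeta>0 > 0" using assms(2) \<zeta>0(1) by simp
    ultimately show False by linarith
  qed
qed

text \<open>The common outcome of the two hypotheses on the density. Everything after the two lemmas
  that establish it depends on the density only through this statement.\<close>

definition near_partition :: bool where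
  "near_partition \<longleftrightarrow> (\<forall>\<gamma>>0. \<exists>\<delta>>0. \<exists>n1. \<forall>V E. finite V \<and> uniform V E \<and> \<not> has_core V E \<and> n1 \<le> card V \<and>
     (A - \<delta>) * real (card V) ^ r \<le> real (card E) \<longrightarrow>
     (\<exists>c. (\<forall>x\<in>V. c x < m) \<and> (A - \<gamma>) * real (card V) ^ r \<le> real (card (rainbow r V c \<inter> E))))"

lemma near_partition_strict:
  assumes dens: "lagrangian_density r F < fact r * A"
  shows near_partition
  unfolding near_partition_def
proof (intro allI impI)
  fix \<gamma> :: real
  assume \<gamma>0: "\<gamma> > 0"
  from large_degree_multipartite obtain \<gamma>1 n0 where \<gamma>1: "\<gamma>1 > 0" and
    mainp: "\<forall>V (E :: nat set set) c. finite V \<and> uniform V E \<and> n0 \<le> card V \<and> (\<forall>x\<in>V. c x < m) \<and>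
     (A - \<gamma>1) * real (card V) ^ r \<le> real (card (rainbow r V c \<inter> E)) \<and> \<not> contains_copy (Hypergraph V E) HH \<longrightarrow>
     (\<exists>c'. (\<forall>x\<in>V. c' x < m) \<and>
       (\<forall>e\<in>E. (\<forall>v\<in>e. (A' - \<gamma>1) * real (card V) ^ (r - 1) \<le> real (card {e\<in>E. v \<in> e})) \<longrightarrow> inj_on c' e))"
    by (elim exE conjE)
  define \<gamma>2 where "\<gamma>2 = min \<gamma> \<gamma>1"
  have \<gamma>2: "\<gamma>2 > 0" "\<gamma>2 \<le> \<gamma>" "\<gamma>2 \<le> \<gamma>1" using \<gamma>0 \<gamma>1 by (auto simp: \<gamma>2_def)
  define \<zeta> where "\<zeta> = \<gamma>2 / 4"
  have \<zeta>0: "\<zeta> > 0" using \<gamma>2 by (simp add: \<zeta>_def)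
  from few_low_degree[OF less_imp_le[OF dens] \<gamma>1 \<zeta>0] obtain \<delta>0 n1 where \<delta>0: "\<delta>0 > 0" and
    low: "\<forall>V E. finite V \<and> uniform V E \<and> \<not> has_core V E \<and> n1 \<le> card V \<and>
     (A - \<delta>0) * real (card V) ^ r \<le> real (card E) \<longrightarrow>
     real (card {v\<in>V. real (card {e\<in>E. v \<in> e}) < (A' - \<gamma>1) * real (card V) ^ (r - 1)}) \<le> \<zeta> * real (card V)"
    by (elim exE conjE)
  define \<pi> where "\<pi> = lagrangian_density r F / fact r"
  have \<pi>A: "\<pi> < A" using dens by (simp add: \<pi>_def divide_less_eq mult.commute)
  \<comment> \<open>The term with \<pi> makes A - \<delta> larger than \<pi>, so dense symmetric
    graphs fall under the \<open>m\<close>-partite alternative.\<close>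
  define \<delta> where "\<delta> = min \<delta>0 (min ((A - \<pi>) / 2) (\<gamma>2 / 4))"
  have \<delta>: "\<delta> > 0" "\<delta> \<le> \<delta>0" "\<delta> \<le> (A - \<pi>) / 2" "\<delta> \<le> \<gamma>2 / 4" 
  proof -
    show "\<delta> > 0" using \<delta>0 \<pi>A \<gamma>2 by (simp add: \<delta>_def)
  qed (unfold \<delta>_def, linarith+)
  define N where "N = max (max n0 n1) (nat \<lceil>4 / \<gamma>2\<rceil> + 1)"
  show "\<exists>\<delta>>0. \<exists>n1. \<forall>V E. finite V \<and> uniform V E \<and> \<not> has_core V E \<and> n1 \<le> card V \<and>
     (A - \<delta>) * real (card V) ^ r \<le> real (card E) \<longrightarrow>
     (\<exists>c. (\<forall>x\<in>V. c x < m) \<and> (A - \<gamma>) * real (card V) ^ r \<le> real (card (rainbow r V c \<inter> E)))"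
  proof (rule exI[of _ \<delta>], rule conjI[OF \<delta>(1)], rule exI[of _ N], intro allI impI, elim conjE)
    fix V E
    assume V: "finite V" and E: "uniform V E" and nc: "\<not> has_core V E" and N: "N \<le> card V"
      and large: "(A - \<delta>) * real (card V) ^ r \<le> real (card E)"
    define n where "n = real (card V)"
    have n1: "n \<ge> 1" using N by (simp add: N_def n_def)
    \<comment> \<open>Pays for the one vertex that changes in a symmetrization step.\<close>
    have n\<gamma>: "1 \<le> \<gamma>2 / 4 * n"
    proof -
      have "4 / \<gamma>2 \<le> n" using N unfolding N_def n_def by linarith
      then show ?thesis using \<gamma>2(1) by (simp add: divide_le_eq mult.commute)
    qed
    have lowE: "real (card {v\<in>V. real (card {e\<in>E. v \<in> e}) < (A' - \<gamma>1) * n ^ (r - 1)}) \<le> \<zeta> * n"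
      if "uniform V E" "\<not> has_core V E" "(A - \<delta>) * n ^ r \<le> real (card E)" for E
    proof -
      have "(A - \<delta>0) * n ^ r \<le> (A - \<delta>) * n ^ r" using \<delta>(2) n1 by (intro mult_right_mono) auto
      then have "(A - \<delta>0) * n ^ r \<le> real (card E)" using that(3) by simp
      then show ?thesis
        unfolding n_def by (intro low[THEN spec[of _ V], THEN spec[of _ E], THEN mp] conjI)
          (use V that N in \<open>auto simp: N_def\<close>)
    qed
    \<comment> \<open>The thresholds are the same before and after every step, so nothing
      accumulates. Degrees are measured in the current graph.\<close>
    define P where "P E \<longleftrightarrow> ((A - \<delta>) * n ^ r \<le> real (card E) \<longrightarrow> (\<exists>c. (\<forall>x\<in>V. c x < m) \<and>
      (\<forall>e\<in>E. (\<forall>v\<in>e. (A' - \<gamma>1) * n ^ (r - 1) \<le> real (card {e\<in>E. v \<in> e})) \<longrightarrow> inj_on c e)))"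
      for E :: "nat set set"
    have "P E"
      using V E nc
    proof (induction rule: symmetrization_induct)
      case (symmetric E)
      show ?case
        unfolding P_def
      proof
        assume lg: "(A - \<delta>) * n ^ r \<le> real (card E)"
        from symmetric_cases[OF V symmetric]
        show "\<exists>c. (\<forall>x\<in>V. c x < m) \<and>
            (\<forall>e\<in>E. (\<forall>v\<in>e. (A' - \<gamma>1) * n ^ (r - 1) \<le> real (card {e\<in>E. v \<in> e})) \<longrightarrow> inj_on c e)"
        proof
          assume "\<exists>c. (\<forall>x\<in>V. c x < m) \<and> (\<forall>e\<in>E. inj_on c e)"
          then show ?thesis by blast
        next
          assume "fact r * real (card E) \<le> lagrangian_density r F * real (card V) ^ r"
          then have "real (card E) \<le> \<pi> * n ^ r" by (simp add: \<pi>_def n_def field_simps)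
          then have "(A - \<delta>) * n ^ r \<le> \<pi> * n ^ r" using lg by simp
          then have "A - \<delta> \<le> \<pi>" using n1 by simp
          then have False using \<delta>(3) \<pi>A by (simp add: field_simps)
          then show ?thesis ..
        qed
      qed
    next
      case (step E E' v)
      show ?case
        unfolding P_def
      proof
        assume lg: "(A - \<delta>) * n ^ r \<le> real (card E)"
        then have lg': "(A - \<delta>) * n ^ r \<le> real (card E')" using step(7) by simp
        then obtain c where c: "\<forall>x\<in>V. c x < m"
          "\<And>e. e \<in> E' \<Longrightarrow> (\<forall>v\<in>e. (A' - \<gamma>1) * n ^ (r - 1) \<le> real (card {e\<in>E'. v \<in> e})) \<Longrightarrow> inj_on c e"
          using step(8) unfolding P_def by blast
        \<comment> \<open>Edges of \<open>E\<close> that avoid \<open>Z\<close> are edges of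
          \<open>E'\<close> with large degrees there, hence rainbow for the colouring of
          \<open>E'\<close>. This near partition of \<open>E\<close> is upgraded by
          \<open>large_degree_multipartite\<close> to a colouring that proves
          \<open>P E\<close>.\<close>
        define Z where "Z = insert v {v\<in>V. real (card {e\<in>E'. v \<in> e}) < (A' - \<gamma>1) * n ^ (r - 1)}"
        have ZV: "Z \<subseteq> V" using step(5) by (auto simp: Z_def)
        have "card Z \<le> Suc (card {v\<in>V. real (card {e\<in>E'. v \<in> e}) < (A' - \<gamma>1) * n ^ (r - 1)})"
          unfolding Z_def by (rule card_insert_le_m1[OF _ , simplified])
            (simp_all add: card_insert_if V)
        then have "real (card Z) \<le> \<zeta> * n + 1" using lowE[OF step(3,4) lg'] by linarith
        then have Zc: "real (card Z) \<le> \<gamma>2 / 2 * real (card V)"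
          using n\<gamma> unfolding \<zeta>_def n_def by (simp add: field_simps)
        have inj: "inj_on c e" if "e \<in> E" "e \<inter> Z = {}" for e
        proof -
          have "v \<notin> e" using that by (auto simp: Z_def)
          then have "e \<in> E'" using that(1) step(6) by blast
          then show ?thesis
          proof (rule c(2))
            have "e \<subseteq> V" using step(1) that by blast
            then show "\<forall>v\<in>e. (A' - \<gamma>1) * n ^ (r - 1) \<le> real (card {e\<in>E'. v \<in> e})"
              using that(2) by (auto simp: Z_def not_less)
          qed
        qed
        have "(A - \<delta> - \<gamma>2 / 2) * real (card V) ^ r \<le> real (card (rainbow r V c \<inter> E))"
          using lg by (intro card_rainbow_edges_ge[OF V step(1) ZV Zc inj]) (auto simp: n_def)
        moreover have "(A - \<gamma>1) * real (card V) ^ r \<le> (A - \<delta> - \<gamma>2 / 2) * real (card V) ^ r"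
          using \<delta>(4) \<gamma>2 by (intro mult_right_mono) auto
        ultimately have "(A - \<gamma>1) * real (card V) ^ r \<le> real (card (rainbow r V c \<inter> E))" by linarith
        then show "\<exists>c. (\<forall>x\<in>V. c x < m) \<and>
            (\<forall>e\<in>E. (\<forall>v\<in>e. (A' - \<gamma>1) * n ^ (r - 1) \<le> real (card {e\<in>E. v \<in> e})) \<longrightarrow> inj_on c e)"
          unfolding n_def
          by (intro mainp[THEN spec[of _ V], THEN spec[of _ E], THEN spec[of _ c], THEN mp] conjI)
            (use V step c(1) N core_free_extension_free in \<open>auto simp: N_def\<close>)
      qed
    qed
    then obtain c where c: "\<forall>x\<in>V. c x < m"
      "\<And>e. e \<in> E \<Longrightarrow> (\<forall>v\<in>e. (A' - \<gamma>1) * n ^ (r - 1) \<le> real (card {e\<in>E. v \<in> e})) \<Longrightarrow> inj_on c e"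
      using large unfolding P_def n_def by blast
    define Z where "Z = {v\<in>V. real (card {e\<in>E. v \<in> e}) < (A' - \<gamma>1) * n ^ (r - 1)}"
    have ZV: "Z \<subseteq> V" by (auto simp: Z_def)
    have Zc: "real (card Z) \<le> \<zeta> * real (card V)"
      using lowE[OF E nc] large by (simp add: Z_def n_def)
    have "inj_on c e" if "e \<in> E" "e \<inter> Z = {}" for e
    proof (rule c(2)[OF that(1)])
      have "e \<subseteq> V" using E that by blast
      then show "\<forall>v\<in>e. (A' - \<gamma>1) * n ^ (r - 1) \<le> real (card {e\<in>E. v \<in> e})"
        using that(2) by (auto simp: Z_def not_less)
    qed
    then have "(A - \<delta> - \<zeta>) * real (card V) ^ r \<le> real (card (rainbow r V c \<inter> E))"
      using large by (intro card_rainbow_edges_ge[OF V E ZV Zc]) auto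
    moreover have "(A - \<gamma>) * real (card V) ^ r \<le> (A - \<delta> - \<zeta>) * real (card V) ^ r"
      using \<delta>(4) \<gamma>2 by (intro mult_right_mono) (auto simp: \<zeta>_def)
    ultimately show "\<exists>c. (\<forall>x\<in>V. c x < m) \<and> (A - \<gamma>) * real (card V) ^ r \<le> real (card (rainbow r V c \<inter> E))"
      using c(1) by (intro exI[of _ c]) auto
  qed
qed

text \<open>Translates stability to the normalization by n^r. Edges through the deleted vertices are
  the only ones not known to be rainbow.\<close>

lemma near_partition_stable:
  assumes stable: "stable_family r m (core_family r F (m + 1))"
  shows near_partition
  unfolding near_partition_def
proof (intro allI impI)
  fix \<gamma> :: real
  assume \<gamma>0: "\<gamma> > 0"
  then have "\<gamma> / 2 > 0" by simp
  with stable obtain \<delta>1 n1 where \<delta>1: "\<delta>1 > 0" and st: "\<forall>G :: nat hypergraph.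
       r_graph r G \<and> family_free (core_family r F (m + 1)) G \<and> card (verts G) \<ge> n1 \<and>
       real (card (edges G)) > (falling_factorial m r / real m ^ r - \<delta>1) * real (card (verts G) choose r)
       \<longrightarrow> (\<exists>D\<subseteq>verts G. real (card D) \<le> \<gamma> / 2 * real (card (verts G)) \<and>
              multipartite m (induced G (verts G - D)))"
    unfolding stable_family_def by blast
  \<comment> \<open>\<delta>1 / (2 r!) makes the edge count strictly larger than the stability
    threshold; A / 2 keeps it positive in case that threshold is not.\<close>
  define \<delta> where "\<delta> = min (\<gamma> / 2) (min (\<delta>1 / (2 * fact r)) (A / 2))"
  have \<delta>: "\<delta> > 0" "\<delta> \<le> \<gamma> / 2" "\<delta> \<le> \<delta>1 / (2 * fact r)" "\<delta> \<le> A / 2"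
    using \<gamma>0 \<delta>1 A_pos by (auto simp: \<delta>_def)
  show "\<exists>\<delta>>0. \<exists>n1. \<forall>V E. finite V \<and> uniform V E \<and> \<not> has_core V E \<and> n1 \<le> card V \<and>
     (A - \<delta>) * real (card V) ^ r \<le> real (card E) \<longrightarrow>
     (\<exists>c. (\<forall>x\<in>V. c x < m) \<and> (A - \<gamma>) * real (card V) ^ r \<le> real (card (rainbow r V c \<inter> E)))"
  proof (rule exI[of _ \<delta>], rule conjI[OF \<delta>(1)], rule exI[of _ "max n1 1"], intro allI impI, elim conjE)
    fix V :: "nat set" and E
    assume V: "finite V" and E: "uniform V E" and nc: "\<not> has_core V E" and N: "max n1 1 \<le> card V"
      and large: "(A - \<delta>) * real (card V) ^ r \<le> real (card E)"
    have n0: "real (card V) ^ r > 0" using N by simp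
    have rg: "r_graph r (Hypergraph V E)" using V E by (auto simp: r_graph_def)
    have dense: "(fact r * A - \<delta>1) * real (card V choose r) < real (card E)"
    proof (cases "fact r * A - \<delta>1 \<le> 0")
      case True
      then have "(fact r * A - \<delta>1) * real (card V choose r) \<le> 0" by (intro mult_nonpos_nonneg) auto
      also have "0 < (A - \<delta>) * real (card V) ^ r" using \<delta>(4) A_pos n0 by (intro mult_pos_pos) auto
      finally show ?thesis using large by simp
    next
      case False
      have "real (card V choose r) * fact r \<le> real (card V) ^ r"
        using binomial_fact_pow[of "card V" r] by (metis of_nat_fact of_nat_le_iff of_nat_mult of_nat_power)
      then have "real (card V choose r) \<le> real (card V) ^ r / fact r" by (simp add: pos_le_divide_eq)
      then have "(fact r * A - \<delta>1) * real (card V choose r) \<le> (fact r * A - \<delta>1) * (real (card V) ^ r / fact r)"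
        using False by (intro mult_left_mono) auto
      also have "\<dots> = (A - \<delta>1 / fact r) * real (card V) ^ r" by (simp add: field_simps)
      also have "\<dots> < (A - \<delta>) * real (card V) ^ r"
      proof (rule mult_strict_right_mono[OF _ n0])
        have "\<delta>1 / (2 * fact r) < \<delta>1 / fact r" using \<delta>1 by (simp add: field_simps)
        then show "A - \<delta>1 / fact r < A - \<delta>" using \<delta>(3) by linarith
      qed
      finally show ?thesis using large by simp
    qed
    have "\<exists>D\<subseteq>V. real (card D) \<le> \<gamma> / 2 * real (card V) \<and> multipartite m (induced (Hypergraph V E) (V - D))"
      using st[THEN spec[of _ "Hypergraph V E"]] rg family_free_core_family[OF rg] nc N dense density_A by simp
    then obtain Z where Z: "Z \<subseteq> V" "real (card Z) \<le> \<gamma> / 2 * real (card V)"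
      and mp: "multipartite m (induced (Hypergraph V E) (V - Z))" by blast
    from mp obtain P :: "nat \<Rightarrow> nat set" where P: "(\<Union>i<m. P i) = V - Z"
      "\<And>e i. e \<in> E \<Longrightarrow> e \<subseteq> V - Z \<Longrightarrow> i < m \<Longrightarrow> card (e \<inter> P i) \<le> 1"
      unfolding multipartite_def induced_def by auto
    \<comment> \<open>Deleted vertices get the dummy colour 0.\<close>
    define c where "c x = (if x \<in> V - Z then SOME i. i < m \<and> x \<in> P i else 0)" for x
    have cP: "c x < m \<and> x \<in> P (c x)" if "x \<in> V - Z" for x
    proof -
      have "\<exists>i. i < m \<and> x \<in> P i" using P(1) that by blast
      then have "(SOME i. i < m \<and> x \<in> P i) < m \<and> x \<in> P (SOME i. i < m \<and> x \<in> P i)" by (rule someI_ex)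
      then show ?thesis using that by (simp add: c_def)
    qed
    have cm: "\<forall>x\<in>V. c x < m"
    proof
      fix x assume "x \<in> V"
      then show "c x < m" using cP[of x] mr r2 by (cases "x \<in> V - Z") (auto simp: c_def)
    qed
    have "inj_on c e" if e: "e \<in> E" "e \<inter> Z = {}" for e
    proof (rule inj_onI)
      fix x y assume xy: "x \<in> e" "y \<in> e" "c x = c y"
      have eV: "e \<subseteq> V - Z" using e E by blast
      have x: "c x < m" "x \<in> P (c x)" "y \<in> P (c x)" using cP[of x] cP[of y] xy eV by auto
      have "finite (e \<inter> P (c x))" using eV V by (meson finite_Diff finite_Int finite_subset)
      moreover have "card (e \<inter> P (c x)) \<le> 1" using P(2)[OF e(1) eV x(1)] .
      ultimately show "x = y" using xy x by (auto simp: card_le_Suc0_iff_eq)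
    qed
    then have "(A - \<delta> - \<gamma> / 2) * real (card V) ^ r \<le> real (card (rainbow r V c \<inter> E))"
      using large by (intro card_rainbow_edges_ge[OF V E Z]) auto
    moreover have "(A - \<gamma>) * real (card V) ^ r \<le> (A - \<delta> - \<gamma> / 2) * real (card V) ^ r"
      using \<delta>(2) by (intro mult_right_mono) auto
    ultimately show "\<exists>c. (\<forall>x\<in>V. c x < m) \<and> (A - \<gamma>) * real (card V) ^ r \<le> real (card (rainbow r V c \<inter> E))"
      using cm by (intro exI[of _ c]) auto
  qed
qed

text \<open>The degrees force many edges, cleaning loses few of them, and
  \<open>near_partition\<close> colours the cleaned graph.\<close>

lemma min_degree_multipartite:
  assumes near_partition
  shows "\<exists>\<epsilon>>0. \<exists>n0. \<forall>V (E :: nat set set). finite V \<and> uniform V E \<and> n0 \<le> card V \<and> \<not> contains_copy (Hypergraph V E) HH \<and>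
     (\<forall>v\<in>V. (A' - \<epsilon>) * real (card V) ^ (r - 1) \<le> real (card {e\<in>E. v \<in> e})) \<longrightarrow>
     (\<exists>c. (\<forall>x\<in>V. c x < m) \<and> (\<forall>e\<in>E. inj_on c e))"
proof -
  from large_degree_multipartite obtain \<gamma> n0 where \<gamma>: "\<gamma> > 0" and
    mainp: "\<forall>V (E :: nat set set) c. finite V \<and> uniform V E \<and> n0 \<le> card V \<and> (\<forall>x\<in>V. c x < m) \<and>
     (A - \<gamma>) * real (card V) ^ r \<le> real (card (rainbow r V c \<inter> E)) \<and> \<not> contains_copy (Hypergraph V E) HH \<longrightarrow>
     (\<exists>c'. (\<forall>x\<in>V. c' x < m) \<and>
       (\<forall>e\<in>E. (\<forall>v\<in>e. (A' - \<gamma>) * real (card V) ^ (r - 1) \<le> real (card {e\<in>E. v \<in> e})) \<longrightarrow> inj_on c' e))"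
    by (elim exE conjE)
  from assms[unfolded near_partition_def, rule_format, OF \<gamma>] obtain \<delta> n1 where \<delta>: "\<delta> > 0" and
    NP: "\<forall>V E. finite V \<and> uniform V E \<and> \<not> has_core V E \<and> n1 \<le> card V \<and>
     (A - \<delta>) * real (card V) ^ r \<le> real (card E) \<longrightarrow>
     (\<exists>c. (\<forall>x\<in>V. c x < m) \<and> (A - \<gamma>) * real (card V) ^ r \<le> real (card (rainbow r V c \<inter> E)))"
    by (elim exE conjE)
  \<comment> \<open>The degree deficit may use half of \<delta>; the other half pays for
    cleaning.\<close>
  define \<epsilon> where "\<epsilon> = min \<gamma> (real r * \<delta> / 2)"
  have \<epsilon>: "\<epsilon> > 0" "\<epsilon> \<le> \<gamma>" "\<epsilon> \<le> real r * \<delta> / 2" using \<gamma> \<delta> r2 by (auto simp: \<epsilon>_def)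
  define N where "N = max (max n0 n1) (nat \<lceil>2 * real room / \<delta>\<rceil> + 1)"
  show ?thesis
  proof (rule exI[of _ \<epsilon>], rule conjI[OF \<epsilon>(1)], rule exI[of _ N], intro allI impI, elim conjE)
    fix V and E :: "nat set set"
    assume V: "finite V" and E: "uniform V E" and N: "N \<le> card V"
      and free: "\<not> contains_copy (Hypergraph V E) HH"
      and deg: "\<forall>v\<in>V. (A' - \<epsilon>) * real (card V) ^ (r - 1) \<le> real (card {e\<in>E. v \<in> e})"
    define n where "n = real (card V)"
    have n1: "n \<ge> 1" using N by (simp add: N_def n_def)
    have nn: "n * n ^ (r - 1) = n ^ r" using power_split[of "card V"] by (simp add: n_def)
    have room: "real room \<le> \<delta> / 2 * n"
    proof -
      have "2 * real room / \<delta> \<le> n" using N unfolding N_def n_def by linarith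
      then show ?thesis using \<delta> by (simp add: divide_le_eq mult.commute)
    qed
    have fE: "finite E" using uniform_finite[OF V E] .
    have "real r * real (card E) = (\<Sum>v\<in>V. real (card {e\<in>E. v \<in> e}))"
      using sum_degrees[OF V fE, of r] E by (simp flip: of_nat_sum of_nat_mult)
    moreover have "(\<Sum>v\<in>V. (A' - \<epsilon>) * n ^ (r - 1)) \<le> (\<Sum>v\<in>V. real (card {e\<in>E. v \<in> e}))"
      using deg by (intro sum_mono) (auto simp: n_def)
    moreover have "(\<Sum>v\<in>V. (A' - \<epsilon>) * n ^ (r - 1)) = (A' - \<epsilon>) * (n * n ^ (r - 1))" by (simp add: n_def)
    ultimately have "(A' - \<epsilon>) * n ^ r \<le> real r * real (card E)" unfolding nn by linarith
    moreover have "real r * ((A - \<delta> / 2) * n ^ r) \<le> (A' - \<epsilon>) * n ^ r"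
    proof -
      have "real r * (A - \<delta> / 2) \<le> A' - \<epsilon>" using \<epsilon>(3) by (simp add: A'_eq algebra_simps)
      then have "real r * (A - \<delta> / 2) * n ^ r \<le> (A' - \<epsilon>) * n ^ r" using n1 by (intro mult_right_mono) auto
      then show ?thesis by (simp add: mult.assoc)
    qed
    ultimately have "real r * ((A - \<delta> / 2) * n ^ r) \<le> real r * real (card E)" by simp
    then have cE: "(A - \<delta> / 2) * n ^ r \<le> real (card E)" using r2 by simp
    obtain E' where E': "E' \<subseteq> E" "\<not> has_core V E'" "card E \<le> card E' + room * card V ^ (r - 1)"
      using cleaning[OF V _ free] E by blast
    have "real (card E) \<le> real (card E') + real room * n ^ (r - 1)"
      unfolding n_def of_nat_power[symmetric] of_nat_mult[symmetric] of_nat_add[symmetric] of_nat_le_iff by (rule E'(3))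
    also have "\<dots> \<le> real (card E') + \<delta> / 2 * n * n ^ (r - 1)" using room n1 by (intro add_left_mono mult_right_mono) auto
    also have "\<dots> = real (card E') + \<delta> / 2 * n ^ r" using nn by (simp add: mult.assoc)
    finally have cE': "(A - \<delta>) * n ^ r \<le> real (card E')" using cE by (simp add: algebra_simps)
    have "\<exists>c. (\<forall>x\<in>V. c x < m) \<and> (A - \<gamma>) * real (card V) ^ r \<le> real (card (rainbow r V c \<inter> E'))"
      by (intro NP[THEN spec[of _ V], THEN spec[of _ E'], THEN mp] conjI)
        (use V E E' N cE' in \<open>auto simp: N_def n_def\<close>)
    then obtain c where c: "\<forall>x\<in>V. c x < m" "(A - \<gamma>) * real (card V) ^ r \<le> real (card (rainbow r V c \<inter> E'))" by blast
    \<comment> \<open>Back to the full graph: its own degrees are all large, so its deleted edges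
      become rainbow as well.\<close>
    have "card (rainbow r V c \<inter> E') \<le> card (rainbow r V c \<inter> E)" using V E'(1) by (intro card_mono) auto
    then have c2: "(A - \<gamma>) * real (card V) ^ r \<le> real (card (rainbow r V c \<inter> E))" using c(2) by linarith
    have "\<exists>c'. (\<forall>x\<in>V. c' x < m) \<and>
       (\<forall>e\<in>E. (\<forall>v\<in>e. (A' - \<gamma>) * real (card V) ^ (r - 1) \<le> real (card {e\<in>E. v \<in> e})) \<longrightarrow> inj_on c' e)"
      by (intro mainp[THEN spec[of _ V], THEN spec[of _ E], THEN spec[of _ c], THEN mp] conjI)
        (use V E free c(1) c2 N in \<open>auto simp: N_def\<close>)
    then obtain c' where c': "\<forall>x\<in>V. c' x < m" "\<And>e. e \<in> E \<Longrightarrow>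
       (\<forall>v\<in>e. (A' - \<gamma>) * real (card V) ^ (r - 1) \<le> real (card {e\<in>E. v \<in> e})) \<Longrightarrow> inj_on c' e" by blast
    have "(A' - \<gamma>) * real (card V) ^ (r - 1) \<le> real (card {e\<in>E. v \<in> e})" if "v \<in> V" for v
    proof -
      have "(A' - \<gamma>) * real (card V) ^ (r - 1) \<le> (A' - \<epsilon>) * real (card V) ^ (r - 1)"
        using \<epsilon>(2) by (intro mult_right_mono) auto
      then show ?thesis using deg that by fastforce
    qed
    then have "\<forall>e\<in>E. inj_on c' e" using c'(2) E by blast
    then show "\<exists>c. (\<forall>x\<in>V. c x < m) \<and> (\<forall>e\<in>E. inj_on c e)" using c'(1) by blast
  qed
qed

end

section \<open>Turan graphs\<close>

lemma edges_turan_graph: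
  assumes "m > 0"
  shows "edges (turan_graph r n m) = rainbow r {..<n} (\<lambda>v. v mod m)"
proof -
  have "(\<forall>i<m. card (e \<inter> turan_part n m i) \<le> 1) \<longleftrightarrow> inj_on (\<lambda>v. v mod m) e" if e: "e \<subseteq> {..<n}" for e
  proof
    assume le1: "\<forall>i<m. card (e \<inter> turan_part n m i) \<le> 1"
    show "inj_on (\<lambda>v. v mod m) e"
    proof (rule inj_onI)
      fix x y assume xy: "x \<in> e" "y \<in> e" "x mod m = y mod m"
      let ?S = "e \<inter> turan_part n m (x mod m)"
      have "finite ?S" using e finite_subset by auto
      moreover have "card ?S \<le> 1" using le1 assms by simp
      moreover have "x \<in> ?S" "y \<in> ?S" using xy e by (auto simp: turan_part_def)
      ultimately show "x = y" by (auto simp: card_le_Suc0_iff_eq)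
    qed
  next
    assume inj: "inj_on (\<lambda>v. v mod m) e"
    show "\<forall>i<m. card (e \<inter> turan_part n m i) \<le> 1"
    proof (intro allI impI)
      fix i
      have "finite (e \<inter> turan_part n m i)" using e finite_subset by auto
      moreover have "x = y" if "x \<in> e \<inter> turan_part n m i" "y \<in> e \<inter> turan_part n m i" for x y
        using that inj by (auto simp: turan_part_def dest: inj_onD)
      ultimately show "card (e \<inter> turan_part n m i) \<le> 1" by (simp add: card_le_Suc0_iff_eq)
    qed
  qed
  then show ?thesis unfolding turan_graph_def rainbow_def by auto
qed

lemma card_rainbow_le_turan:
  assumes "finite V" "m > 0" "\<And>x. x \<in> V \<Longrightarrow> c x < m"
  shows "card (rainbow r V c) \<le> card (edges (turan_graph r (card V) m))"
proof -
  let ?n = "card V"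
  have tp: "turan_part ?n m i = {v\<in>{..<?n}. v mod m = i}" for i by (auto simp: turan_part_def)
  have cV: "c ` V \<subseteq> {..<m}" using assms(3) by auto
  have cT: "(\<lambda>v. v mod m) ` {..<?n} \<subseteq> {..<m}" using assms(2) by auto
  have "real (card (rainbow r V c)) = esym r {..<m} (\<lambda>i. real (card {v\<in>V. c v = i}))"
    using card_rainbow[OF assms(1) finite_lessThan cV] .
  also have "\<dots> \<le> esym r {..<m} (\<lambda>i. real (card (turan_part ?n m i)))"
  proof (rule esym_balanced_max)
    show "(\<Sum>i<m. card {v\<in>V. c v = i}) = (\<Sum>i<m. card (turan_part ?n m i))"
      unfolding tp using sum_card_fibres[OF assms(1) finite_lessThan cV]
        sum_card_fibres[OF finite_lessThan finite_lessThan cT] by simp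
    show "card (turan_part ?n m i) \<le> card (turan_part ?n m j) + 1" if "i \<in> {..<m}" "j \<in> {..<m}" for i j
      using turan_part_balanced that by simp
  qed simp
  also have "\<dots> = real (card (edges (turan_graph r ?n m)))"
    unfolding edges_turan_graph[OF assms(2)] card_rainbow[OF finite_lessThan finite_lessThan cT] tp ..
  finally show ?thesis by simp
qed

text \<open>The new vertex joins the class of \<open>n mod m\<close> and forms edges with all
  rainbow sets in the other classes, each of size at least \<open>n div m\<close>.\<close>

lemma card_turan_graph_Suc:
  assumes "m > 0" "r > 0"
  shows "real (card (edges (turan_graph r n m))) + real (m - 1 choose (r - 1)) * real (n div m) ^ (r - 1)
    \<le> real (card (edges (turan_graph r (Suc n) m)))"
proof -
  define i where "i = n mod m"
  define Y where "Y = {v\<in>{..<n}. v mod m \<noteq> i}"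
  define Q where "Q = rainbow (r - 1) Y (\<lambda>v. v mod m)"
  let ?c = "\<lambda>v. v mod m"
  have im: "i < m" using assms(1) by (simp add: i_def)
  have fY: "finite Y" by (simp add: Y_def)
  have nQ: "n \<notin> s" if "s \<in> Q" for s using that by (auto simp: Q_def rainbow_def Y_def)
  have "rainbow r {..<n} ?c \<union> insert n ` Q \<subseteq> rainbow r {..<Suc n} ?c"
  proof
    fix e assume "e \<in> rainbow r {..<n} ?c \<union> insert n ` Q"
    then show "e \<in> rainbow r {..<Suc n} ?c"
    proof
      assume "e \<in> rainbow r {..<n} ?c"
      then show ?thesis by (auto simp: rainbow_def)
    next
      assume "e \<in> insert n ` Q"
      then obtain s where s: "s \<in> Q" "e = insert n s" by blast
      have fs: "finite s" using s(1) fY finite_subset by (auto simp: Q_def rainbow_def)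
      have "card e = r" using s fs nQ[OF s(1)] assms(2) by (simp add: Q_def rainbow_def)
      moreover have "?c n \<notin> ?c ` s" using s(1) by (auto simp: Q_def rainbow_def Y_def i_def)
      then have "inj_on ?c e" using s nQ[OF s(1)] by (auto simp: Q_def rainbow_def)
      moreover have "e \<subseteq> {..<Suc n}" using s by (auto simp: Q_def rainbow_def Y_def)
      ultimately show ?thesis by (simp add: rainbow_def)
    qed
  qed
  then have "card (rainbow r {..<n} ?c \<union> insert n ` Q) \<le> card (rainbow r {..<Suc n} ?c)"
    by (intro card_mono) auto
  moreover have "card (rainbow r {..<n} ?c \<union> insert n ` Q) = card (rainbow r {..<n} ?c) + card (insert n ` Q)"
    using fY by (intro card_Un_disjoint) (auto simp: rainbow_def Q_def)
  moreover have "card (insert n ` Q) = card Q"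
    using nQ by (intro card_image inj_onI) (metis insert_ident)
  moreover have "real (card Q) \<ge> real (m - 1 choose (r - 1)) * real (n div m) ^ (r - 1)"
  proof -
    have cY: "?c ` Y \<subseteq> {..<m} - {i}" using assms(1) by (auto simp: Y_def)
    have "real (m - 1 choose (r - 1)) * real (n div m) ^ (r - 1) = esym (r - 1) ({..<m} - {i}) (\<lambda>_. real (n div m))"
      using im by (simp add: esym_const)
    also have "\<dots> \<le> esym (r - 1) ({..<m} - {i}) (\<lambda>j. real (card {v\<in>Y. v mod m = j}))"
    proof (rule esym_mono)
      fix j assume j: "j \<in> {..<m} - {i}"
      then have "{v\<in>Y. v mod m = j} = turan_part n m j" by (auto simp: Y_def turan_part_def)
      then have "card {v\<in>Y. v mod m = j} \<ge> n div m" using turan_part_card[of j m n] j by simp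
      then show "0 \<le> real (n div m) \<and> real (n div m) \<le> real (card {v\<in>Y. v mod m = j})" by simp
    qed
    also have "\<dots> = real (card Q)" unfolding Q_def using card_rainbow[OF fY _ cY] by simp
    finally show ?thesis .
  qed
  ultimately show ?thesis unfolding edges_turan_graph[OF assms(1)] by linarith
qed

context extension_host
begin

text \<open>The rounding in \<open>n div m\<close> costs only order n^(r-2), which the slack
  \<epsilon> n^(r-1) absorbs together with the additional 1. That 1 makes the surplus grow when a
  low-degree vertex is deleted.\<close>

lemma turan_graph_increment:
  assumes "\<epsilon> > 0"
  shows "\<exists>n2. \<forall>n\<ge>n2. real (card (edges (turan_graph r n m))) + (A' - \<epsilon>) * real (Suc n) ^ (r - 1) + 1
    \<le> real (card (edges (turan_graph r (Suc n) m)))"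
proof -
  have m0: "m > 0" and r0: "r > 0" using mr r2 by auto
  define k where "k = r - 1"
  have k1: "k \<ge> 1" using r2 by (simp add: k_def)
  \<comment> \<open>The bound \<open>m\<close> keeps N - m nonnegative; the other makes \<epsilon>
    N^k exceed the loss \<open>A'\<close> k m N^(k-1) by at least 1.\<close>
  define n2 where "n2 = max m (nat \<lceil>(A' * real k * real m + 1) / \<epsilon>\<rceil>)"
  show ?thesis
  proof (intro exI[of _ n2] allI impI)
    fix n assume n: "n \<ge> n2"
    define N where "N = real (Suc n)"
    have N1: "N \<ge> 1" by (simp add: N_def)
    have Nm: "real m \<le> N" using n by (simp add: N_def n2_def)
    have N\<epsilon>: "A' * real k * real m + 1 \<le> \<epsilon> * N"
    proof -
      have "(A' * real k * real m + 1) / \<epsilon> \<le> real n" using n unfolding n2_def by linarith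
      also have "\<dots> \<le> N" by (simp add: N_def)
      finally show ?thesis using assms by (simp add: divide_le_eq mult.commute)
    qed
    have "N - real m \<le> real m * real (n div m)"
    proof -
      have "n = m * (n div m) + n mod m" by simp
      moreover have "n mod m < m" using m0 by simp
      ultimately have "Suc n \<le> m * (n div m) + m" by linarith
      then have "N \<le> real (m * (n div m) + m)" unfolding N_def by (simp only: of_nat_le_iff)
      then show ?thesis by simp
    qed
    then have "(N - real m) ^ k \<le> (real m * real (n div m)) ^ k" using Nm by (intro power_mono) auto
    then have "A' * (N - real m) ^ k \<le> A' * (real m * real (n div m)) ^ k" using A'_pos by (intro mult_left_mono) auto
    also have "\<dots> = real (m - 1 choose k) * real (n div m) ^ k"
      using m0 by (simp add: A'_def k_def power_mult_distrib)
    finally have low: "A' * (N - real m) ^ k \<le> real (m - 1 choose k) * real (n div m) ^ k" .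
    have bern: "N ^ k - real k * real m * N ^ (k - 1) \<le> (N - real m) ^ k"
    proof -
      have "1 + real k * (- (real m / N)) \<le> (1 + - (real m / N)) ^ k"
        using Nm N1 by (intro Bernoulli_inequality) (simp add: field_simps)
      then have "N ^ k * (1 - real k * (real m / N)) \<le> N ^ k * (1 - real m / N) ^ k"
        using N1 by (intro mult_left_mono) auto
      also have "\<dots> = (N - real m) ^ k"
        unfolding power_mult_distrib[symmetric] using N1 by (simp add: right_diff_distrib)
      also have "N ^ k * (1 - real k * (real m / N)) = N ^ k - real k * real m * N ^ (k - 1)"
        using N1 k1 by (cases k) (simp_all add: field_simps)
      finally show ?thesis .
    qed
    have "(A' - \<epsilon>) * N ^ k + 1 \<le> A' * (N - real m) ^ k"
    proof -
      have "(A' * real k * real m + 1) * N ^ (k - 1) \<le> \<epsilon> * N * N ^ (k - 1)"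
        using N\<epsilon> N1 by (intro mult_right_mono) auto
      moreover have "N * N ^ (k - 1) = N ^ k" using k1 by (cases k) auto
      ultimately have "A' * real k * real m * N ^ (k - 1) + N ^ (k - 1) \<le> \<epsilon> * N ^ k"
        unfolding mult.assoc[of \<epsilon>] by (simp add: distrib_right)
      moreover have "N ^ (k - 1) \<ge> 1" using N1 by (rule one_le_power)
      moreover have "A' * (N ^ k - real k * real m * N ^ (k - 1)) \<le> A' * (N - real m) ^ k"
        using bern A'_pos by (intro mult_left_mono) auto
      ultimately show ?thesis by (simp add: algebra_simps)
    qed
    then show "real (card (edges (turan_graph r n m))) + (A' - \<epsilon>) * real (Suc n) ^ (r - 1) + 1
        \<le> real (card (edges (turan_graph r (Suc n) m)))"
      using low card_turan_graph_Suc[OF m0 r0, of n] unfolding N_def k_def by linarith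
  qed
qed

section \<open>Deleting low-degree vertices\<close>

lemma extension_free_mono:
  assumes "\<not> contains_copy (Hypergraph V E) HH" "V' \<subseteq> V" "E' \<subseteq> E"
  shows "\<not> contains_copy (Hypergraph V' E') HH"
proof
  assume "contains_copy (Hypergraph V' E') HH"
  then obtain f where "inj_on f (verts HH)" "f ` verts HH \<subseteq> V'" "\<And>e. e \<in> edges HH \<Longrightarrow> f ` e \<in> E'"
    by (auto simp: contains_copy_def)
  then have "contains_copy (Hypergraph V E) HH"
    unfolding contains_copy_def using assms(2,3) by (intro exI[of _ f]) auto
  then show False using assms(1) by blast
qed

text \<open>A graph exceeding the Turan number is not \<open>m\<close>-partite, so it has a vertex
  of low degree. Deleting this vertex increases the surplus, and the descent ends at a fixed order
  \<open>N0\<close>, where the surplus is bounded.\<close>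

lemma turan_upper_bound:
  assumes near_partition
  shows "\<exists>N. \<forall>V (E :: nat set set). N \<le> card V \<and> finite V \<and> uniform V E \<and> \<not> contains_copy (Hypergraph V E) HH \<longrightarrow>
    card E \<le> card (edges (turan_graph r (card V) m))"
proof -
  define t where "t n = card (edges (turan_graph r n m))" for n
  from min_degree_multipartite[OF assms] obtain \<epsilon> n0 where \<epsilon>: "\<epsilon> > 0" and
    D: "\<forall>V (E :: nat set set). finite V \<and> uniform V E \<and> n0 \<le> card V \<and> \<not> contains_copy (Hypergraph V E) HH \<and>
     (\<forall>v\<in>V. (A' - \<epsilon>) * real (card V) ^ (r - 1) \<le> real (card {e\<in>E. v \<in> e})) \<longrightarrow>
     (\<exists>c. (\<forall>x\<in>V. c x < m) \<and> (\<forall>e\<in>E. inj_on c e))"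
    by (elim exE conjE)
  from turan_graph_increment[OF \<epsilon>] obtain n2 where n2: "\<And>n. n \<ge> n2 \<Longrightarrow>
    real (t n) + (A' - \<epsilon>) * real (Suc n) ^ (r - 1) + 1 \<le> real (t (Suc n))"
    unfolding t_def by blast
  define N0 where "N0 = max n0 n2"
  \<comment> \<open>The surplus plus the number of deletions still possible before order
    \<open>N0\<close> is at most the number of all r-sets on \<open>N0\<close> vertices.\<close>
  have key: "card E + (n - N0) \<le> t n + (N0 choose r)"
    if "n \<ge> N0" "finite V" "uniform V E" "card V = n" "\<not> contains_copy (Hypergraph V E) HH" "t n < card E"
    for n V and E :: "nat set set"
    using that
  proof (induction n arbitrary: V E rule: nat_induct_at_least)
    case base
    have "E \<subseteq> {e. e \<subseteq> V \<and> card e = r}" using base by auto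
    then have "card E \<le> card {e. e \<subseteq> V \<and> card e = r}" using base by (intro card_mono) auto
    then show ?case using base by (simp add: n_subsets)
  next
    case (Suc n)
    have fE: "finite E" using uniform_finite Suc.prems by blast
    have "\<exists>v\<in>V. real (card {e\<in>E. v \<in> e}) < (A' - \<epsilon>) * real (card V) ^ (r - 1)"
    proof (rule ccontr)
      assume "\<not> ?thesis"
      then have "\<exists>c. (\<forall>x\<in>V. c x < m) \<and> (\<forall>e\<in>E. inj_on c e)"
        by (intro D[THEN spec[of _ V], THEN spec[of _ E], THEN mp] conjI)
          (use Suc in \<open>auto simp: N0_def not_less\<close>)
      then obtain c where c: "\<forall>x\<in>V. c x < m" "\<forall>e\<in>E. inj_on c e" by blast
      have "E \<subseteq> rainbow r V c" using Suc.prems c by (auto simp: rainbow_def)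
      then have "card E \<le> card (rainbow r V c)" using Suc.prems by (intro card_mono) auto
      also have "\<dots> \<le> t (Suc n)"
        using card_rainbow_le_turan[of V m c r] Suc.prems c mr r2 by (simp add: t_def)
      finally show False using Suc.prems by simp
    qed
    then obtain v where v: "v \<in> V" "real (card {e\<in>E. v \<in> e}) < (A' - \<epsilon>) * real (card V) ^ (r - 1)" by blast
    define E' where "E' = {e\<in>E. v \<notin> e}"
    have "card E = card E' + card {e\<in>E. v \<in> e}"
    proof -
      have "card (E' \<union> {e\<in>E. v \<in> e}) = card E' + card {e\<in>E. v \<in> e}"
        using fE by (intro card_Un_disjoint) (auto simp: E'_def)
      moreover have "E' \<union> {e\<in>E. v \<in> e} = E" by (auto simp: E'_def)
      ultimately show ?thesis by simp
    qed
    moreover have "n \<ge> n2" using Suc.hyps by (simp add: N0_def)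
    ultimately have "real (card E) + real (t n) + 1 < real (card E') + real (t (Suc n))"
      using n2[of n] v(2) unfolding \<open>card V = Suc n\<close> by linarith
    then have lt: "card E + t n + 1 < card E' + t (Suc n)" by (simp flip: of_nat_add of_nat_Suc)
    have "card E' + (n - N0) \<le> t n + (N0 choose r)"
    proof (rule Suc.IH)
      show "finite (V - {v})" using Suc.prems by simp
      show "uniform (V - {v}) E'" using Suc.prems by (auto simp: E'_def)
      show "card (V - {v}) = n" using Suc.prems v by simp
      show "\<not> contains_copy (Hypergraph (V - {v}) E') HH"
        by (rule extension_free_mono[OF Suc.prems(4)]) (auto simp: E'_def)
      show "t n < card E'" using lt Suc.prems(5) by linarith
    qed
    then show ?case using lt Suc.hyps by linarith
  qed
  \<comment> \<open>From this order on there are more deletions than r-sets on \<open>N0\<close>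
    vertices.\<close>
  show ?thesis
  proof (intro exI[of _ "N0 + (N0 choose r) + 1"] allI impI, elim conjE, rule ccontr)
    fix V and E :: "nat set set"
    assume *: "N0 + (N0 choose r) + 1 \<le> card V" "finite V" "uniform V E"
      "\<not> contains_copy (Hypergraph V E) HH" "\<not> card E \<le> card (edges (turan_graph r (card V) m))"
    have "card E + (card V - N0) \<le> t (card V) + (N0 choose r)"
      by (rule key[OF _ *(2,3) refl *(4)]) (use *(1,5) in \<open>simp_all add: t_def\<close>)
    then show False using *(1,5) unfolding t_def by linarith
  qed
qed

lemma turan_graph_extension_free: "\<not> contains_copy (turan_graph r n m) HH"
proof -
  let ?c = "\<lambda>v. v mod m"
  have m0: "m > 0" using mr r2 by simp
  have "\<not> has_core {..<n} (rainbow r {..<n} ?c)"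
  proof
    assume "has_core {..<n} (rainbow r {..<n} ?c)"
    then obtain C where C: "card C = m + 1"
      and cov: "\<And>u v. u \<in> C \<Longrightarrow> v \<in> C \<Longrightarrow> u \<noteq> v \<Longrightarrow> \<exists>e\<in>rainbow r {..<n} ?c. u \<in> e \<and> v \<in> e"
      by (auto simp: has_core_def)
    have "inj_on ?c C"
    proof (rule inj_onI, rule ccontr)
      fix u v assume uv: "u \<in> C" "v \<in> C" "?c u = ?c v" "u \<noteq> v"
      then obtain e where "e \<in> rainbow r {..<n} ?c" "u \<in> e" "v \<in> e" using cov by blast
      then show False using uv by (auto simp: rainbow_def dest: inj_onD)
    qed
    moreover have "?c ` C \<subseteq> {..<m}" using m0 by auto
    ultimately have "card C \<le> card {..<m}" by (intro card_inj_on_le) auto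
    then show False using C by simp
  qed
  then have "\<not> contains_copy (Hypergraph {..<n} (rainbow r {..<n} ?c)) HH" by (rule core_free_extension_free)
  moreover have "turan_graph r n m = Hypergraph {..<n} (rainbow r {..<n} ?c)"
    using edges_turan_graph[OF m0, of r n] by (simp add: turan_graph_def)
  ultimately show ?thesis by simp
qed

lemma turan_number_extension:
  assumes near_partition
  shows "\<exists>n3>0. \<forall>n\<ge>n3. turan_number r n (extension r F (m + 1)) = card (edges (turan_graph r n m))"
proof -
  from turan_upper_bound[OF assms] obtain N where
    N: "\<forall>V (E :: nat set set). N \<le> card V \<and> finite V \<and> uniform V E \<and> \<not> contains_copy (Hypergraph V E) HH \<longrightarrow>
      card E \<le> card (edges (turan_graph r (card V) m))" ..
  show ?thesis
  proof (rule exI[of _ "Suc N"], intro conjI allI impI)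
    fix n assume n: "n \<ge> Suc N"
    let ?S = "{card (edges G) | G :: nat hypergraph. r_graph r G \<and> card (verts G) = n \<and> \<not> contains_copy G HH}"
    have ub: "y \<le> card (edges (turan_graph r n m))" if "y \<in> ?S" for y
    proof -
      obtain G :: "nat hypergraph" where G: "y = card (edges G)" "r_graph r G" "card (verts G) = n" "\<not> contains_copy G HH"
        using \<open>y \<in> ?S\<close> by blast
      show ?thesis
        using N[THEN spec[of _ "verts G"], THEN spec[of _ "edges G"]] G n by (simp add: r_graph_def)
    qed
    have "Max ?S = card (edges (turan_graph r n m))"
    proof (rule Max_eqI)
      show "finite ?S" using ub by (intro finite_subset[of ?S "{..card (edges (turan_graph r n m))}"]) auto
      have "r_graph r (turan_graph r n m)" "card (verts (turan_graph r n m)) = n"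
        by (auto simp: turan_graph_def r_graph_def)
      then show "card (edges (turan_graph r n m)) \<in> ?S" using turan_graph_extension_free by blast
    qed (rule ub)
    then show "turan_number r n (extension r F (m + 1)) = card (edges (turan_graph r n m))"
      unfolding turan_number_def HH_def .
  qed simp
qed

end

text \<open>Both hypotheses on the number of vertices provide a core vertex lying in at most one edge:
  a new vertex in the first case, the vertex of degree one in the second.\<close>

lemma exists_extension_host:
  fixes F :: "'a hypergraph"
  assumes "r \<ge> 2" "m \<ge> r" "r_graph r F"
    and "card (verts F) \<le> m \<or> (card (verts F) = m + 1 \<and> (\<exists>v\<in>verts F. degree F v = 1))"
  shows "\<exists>b R. extension_host m r F b R"
proof -
  let ?C = "core_vertices F (m + 1)"
  have fV: "finite (verts F)" using assms(3) by (simp add: r_graph_def)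
  have E: "e \<subseteq> verts F" "card e = r" if "e \<in> edges F" for e using that assms(3) by (auto simp: r_graph_def)
  from assms(4) show ?thesis
  proof (elim disjE conjE bexE)
    assume le: "card (verts F) \<le> m"
    have fC: "finite ?C" using fV by (simp add: core_vertices_def)
    have b: "New (m + 1) \<in> ?C" using le by (simp add: core_vertices_def)
    have "card ?C = card (Old ` verts F) + card (New ` {card (verts F)<..m + 1} :: 'a core_vertex set)"
      unfolding core_vertices_def using fV by (intro card_Un_disjoint) auto
    also have "\<dots> = card (verts F) + (m + 1 - card (verts F))" by (simp add: card_image inj_on_def)
    finally have "card (?C - {New (m + 1)}) = m" using le fC b by simp
    then have "r - 1 \<le> card (?C - {New (m + 1)})" using assms(2) by simp
    then obtain R where R: "R \<subseteq> ?C - {New (m + 1)}" "card R = r - 1" "finite R"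
      by (rule obtain_subset_with_card_n)
    have "extension_host m r F (New (m + 1)) R"
      using assms(1-3) le b R by unfold_locales auto
    then show ?thesis by blast
  next
    fix v assume c: "card (verts F) = m + 1" and v: "v \<in> verts F" "degree F v = 1"
    then obtain e where e: "{e \<in> edges F. v \<in> e} = {e}"
      unfolding degree_def by (auto simp: card_1_singleton_iff)
    then have ev: "e \<in> edges F" "v \<in> e" by auto
    have fe: "finite e" using E(1)[OF ev(1)] fV finite_subset by blast
    have OC: "Old ` verts F \<subseteq> ?C" by (simp add: core_vertices_def)
    have "extension_host m r F (Old v) (Old ` (e - {v}))"
    proof unfold_locales
      show "Old v \<in> core_vertices F (m + 1)" using OC v by blast
      show "Old ` (e - {v}) \<subseteq> core_vertices F (m + 1) - {Old v}" using OC E(1)[OF ev(1)] by blast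
      have "card (Old ` (e - {v})) = card (e - {v})" by (rule card_image) (simp add: inj_on_def)
      then show "card (Old ` (e - {v})) = r - 1" using E(2)[OF ev(1)] ev(2) fe by simp
      show "Old ` f = insert (Old v) (Old ` (e - {v}))" if f: "f \<in> edges F" "Old v \<in> Old ` f" for f
      proof -
        have "f = e" using f e by auto
        then show ?thesis using ev(2) by auto
      qed
    qed (use assms c in auto)
    then show ?thesis by blast
  qed
qed

theorem theorem6p4:
  fixes m r :: nat and F :: "'a hypergraph"
  assumes "r \<ge> 2" and "m \<ge> r"
    and "r_graph r F"
    and "card (verts F) \<le> m \<or>
         (card (verts F) = m + 1 \<and> (\<exists>v\<in>verts F. degree F v = 1))"
    and "lagrangian_density r F < falling_factorial m r / real m ^ r \<or>
         (lagrangian_density r F = falling_factorial m r / real m ^ r \<and>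
          stable_family r m (core_family r F (m + 1)))"
  shows "\<exists>n\<^sub>3>0. \<forall>n\<ge>n\<^sub>3.
    turan_number r n (extension r F (m + 1)) = card (edges (turan_graph r n m))"
proof -
  obtain b R where "extension_host m r F b R" using exists_extension_host[OF assms(1-4)] by blast
  then interpret extension_host m r F b R .
  have near_partition
    using assms(5) near_partition_strict near_partition_stable by (auto simp: density_A)
  then show ?thesis by (rule turan_number_extension)
qed

end
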